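(* Let $F \subset \mathbb{R}$ be a self-conformal set with $\mathcal{H}^s(F)>0$ for $s = \dim_{\mathrm{H}}(F) < 1$. Then $s = P^{-1}(0)$ if and only if there are no exact overlaps.
   Context: Self-conformal sets in $\mathbb{R}$: a map on an open set $\Omega\subset\mathbb{R}$ is conformal if it is $C^1$ with non-vanishing derivative and there exist $\alpha,c>0$ with $|\varphi'(x) - \varphi'(y)| \le c|x-y|^\alpha$ for all $x,y \in \Omega$. A finite family $\{\varphi_i\}_{i=1}^N$, $N \ge 2$, is a conformal iterated function system if each $\varphi_i$ is an injective conformal mapping on a common non-empty bounded open convex set (interval) $\Omega \subset \mathbb{R}$ such that $\overline{\varphi_i(\Omega)} \subset \Omega$ and $\|\varphi_i'\| := \sup_{x \in \Omega}|\varphi_i'(x)| < 1$. The associated self-conformal set is the unique non-empty compact set $F \subset \Omega$ with $F = \bigcup_{i=1}^N \varphi_i(F)$. A self-conformal set always comes with a fixed conformal iterated function system defining it. Words: $\Sigma_n=\{1,\dots,N\}^n$ and $\Sigma_*=\bigcup_{n\ge 0}\Sigma_n$ is the set of all finite words. For $\mathtt{i}=i_1\cdots i_n$, $\varphi_{\mathtt{i}} = \varphi_{i_1}\circ\cdots\circ\varphi_{i_n}$ (the identity for the empty word), and $\|\varphi_{\mathtt{i}}'\| = \sup_{x\in\Omega}|\varphi_{\mathtt{i}}'(x)|$. Pressure: $P \colon [0,\infty) \to \mathbb{R}$, $P(t) = \lim_{n \to \infty} \frac{1}{n} \log \sum_{\mathtt{i} \in \Sigma_n} \|\varphi_{\mathtt{i}}'\|^t$,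 which is well defined, convex, continuous and strictly decreasing with a unique zero; $P^{-1}(0)$ denotes that zero. Exact overlap: $F$ has an exact overlap if there exist $\mathtt{i},\mathtt{j}\in\Sigma_*$ with $\mathtt{i}\neq\mathtt{j}$ and $\varphi_{\mathtt{i}}|_F=\varphi_{\mathtt{j}}|_F$. $\mathcal{H}^s$ is the $s$-dimensional Hausdorff measure and $\dim_{\mathrm{H}}$ the Hausdorff dimension. *)

theory Defs
  imports "HOL-Analysis.Analysis"
begin

section \<open>Hausdorff measure and dimension\<close>

text \<open>
  The gauge is \<open>diam(U)\<^sup>s\<close> with \<open>diam(\<emptyset>)\<^sup>s = 0\<close>, and \<open>0\<^sup>0 = 1\<close> for nonempty \<open>U\<close>, so that the
  measure with \<open>s = 0\<close> is the counting measure; the case distinction is needed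
  because \<open>0 powr 0 = 0\<close>.
\<close>

definition hausdorff_gauge :: "real \<Rightarrow> 'a::metric_space set \<Rightarrow> ennreal" where
  "hausdorff_gauge s U =
     (if U = {} then 0 else if s = 0 then 1 else ennreal (diameter U powr s))"

text \<open>
  The covering sets are required to be bounded explicitly, because \<^const>\<open>diameter\<close>
  is an arbitrary real number on unbounded sets.
\<close>

definition hausdorff_premeasure :: "real \<Rightarrow> real \<Rightarrow> 'a::metric_space set \<Rightarrow> ennreal" where
  "hausdorff_premeasure s \<delta> A =
     (INF U \<in> {U :: nat \<Rightarrow> 'a set. A \<subseteq> (\<Union>i. U i) \<and> (\<forall>i. bounded (U i) \<and> diameter (U i) \<le> \<delta>)}.
        \<Sum>i. hausdorff_gauge s (U i))"

definition hausdorff_measure :: "real \<Rightarrow> 'a::metric_space set \<Rightarrow> ennreal" where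
  "hausdorff_measure s A = (SUP \<delta> \<in> {0<..}. hausdorff_premeasure s \<delta> A)"

definition hausdorff_dim :: "'a::metric_space set \<Rightarrow> ereal" where
  "hausdorff_dim A = (INF t \<in> {t. 0 \<le> t \<and> hausdorff_measure t A = 0}. ereal t)"

section \<open>Conformal iterated function systems on the line\<close>

definition conformal_on :: "real set \<Rightarrow> (real \<Rightarrow> real) \<Rightarrow> bool" where
  "conformal_on \<Omega> f \<longleftrightarrow>
     f C1_differentiable_on \<Omega> \<and>
     (\<forall>x\<in>\<Omega>. deriv f x \<noteq> 0) \<and>
     (\<exists>\<alpha>>0. \<exists>c>0. \<forall>x\<in>\<Omega>. \<forall>y\<in>\<Omega>. \<bar>deriv f x - deriv f y\<bar> \<le> c * \<bar>x - y\<bar> powr \<alpha>)"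

definition deriv_norm :: "real set \<Rightarrow> (real \<Rightarrow> real) \<Rightarrow> real" where
  "deriv_norm \<Omega> f = (SUP x\<in>\<Omega>. \<bar>deriv f x\<bar>)"

text \<open>
  The maps are total functions \<open>\<phi> i\<close>, \<open>i \<in> {1..N}\<close>, of which only the values on \<open>\<Omega>\<close> matter.
\<close>

definition conformal_ifs :: "nat \<Rightarrow> real set \<Rightarrow> (nat \<Rightarrow> real \<Rightarrow> real) \<Rightarrow> bool" where
  "conformal_ifs N \<Omega> \<phi> \<longleftrightarrow>
     2 \<le> N \<and>
     \<Omega> \<noteq> {} \<and> bounded \<Omega> \<and> open \<Omega> \<and> convex \<Omega> \<and>
     (\<forall>i\<in>{1..N}. conformal_on \<Omega> (\<phi> i) \<and> inj_on (\<phi> i) \<Omega> \<and>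
        closure (\<phi> i ` \<Omega>) \<subseteq> \<Omega> \<and> deriv_norm \<Omega> (\<phi> i) < 1)"

definition self_conformal_set ::
    "nat \<Rightarrow> real set \<Rightarrow> (nat \<Rightarrow> real \<Rightarrow> real) \<Rightarrow> real set \<Rightarrow> bool" where
  "self_conformal_set N \<Omega> \<phi> F \<longleftrightarrow>
     conformal_ifs N \<Omega> \<phi> \<and>
     F \<noteq> {} \<and> compact F \<and> F \<subseteq> \<Omega> \<and> F = (\<Union>i\<in>{1..N}. \<phi> i ` F)"

section \<open>Words, pressure and exact overlaps\<close>

definition words :: "nat \<Rightarrow> nat \<Rightarrow> nat list set" where
  "words N n = {w \<in> lists {1..N}. length w = n}"

definition word_map :: "(nat \<Rightarrow> real \<Rightarrow> real) \<Rightarrow> nat list \<Rightarrow> real \<Rightarrow> real" where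
  "word_map \<phi> w = foldr (\<circ>) (map \<phi> w) id"

definition pressure :: "nat \<Rightarrow> real set \<Rightarrow> (nat \<Rightarrow> real \<Rightarrow> real) \<Rightarrow> real \<Rightarrow> real" where
  "pressure N \<Omega> \<phi> t =
     lim (\<lambda>n. 1 / real n * ln (\<Sum>w\<in>words N n. deriv_norm \<Omega> (word_map \<phi> w) powr t))"

definition pressure_zero :: "nat \<Rightarrow> real set \<Rightarrow> (nat \<Rightarrow> real \<Rightarrow> real) \<Rightarrow> real" where
  "pressure_zero N \<Omega> \<phi> = (THE t. 0 \<le> t \<and> pressure N \<Omega> \<phi> t = 0)"

definition has_exact_overlap :: "nat \<Rightarrow> (nat \<Rightarrow> real \<Rightarrow> real) \<Rightarrow> real set \<Rightarrow> bool" where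
  "has_exact_overlap N \<phi> F \<longleftrightarrow>
     (\<exists>v\<in>lists {1..N}. \<exists>w\<in>lists {1..N}. v \<noteq> w \<and> (\<forall>x\<in>F. word_map \<phi> v x = word_map \<phi> w x))"

end

theory Submission
  imports Defs
begin

text \<open>
  The bound \<open>dim F \<le> P\<inverse>(0)\<close> comes from covering \<open>F\<close> by its cylinders \<open>\<phi>\<^sub>w(F)\<close>. If two words of equal length give the same
  map on \<open>F\<close>, one of them can be dropped at every stage of this covering, and comparing the content of cylinders with a
  superadditive mass on the tree of words yields content zero at the exponent \<open>P\<inverse>(0)\<close>, so \<open>s\<close> cannot be \<open>P\<inverse>(0)\<close>.

  Conversely, suppose \<open>s < P\<inverse>(0)\<close>. Disjoint cylinders satisfy \<open>\<Sum> \<parallel>\<phi>\<^sub>w'\<parallel>\<^sup>s \<le> const\<close>, since otherwise a separated subsystem would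
  have dimension above \<open>s\<close>. Positivity of the \<open>s\<close>-dimensional content localises this to Ahlfors upper regularity: an
  interval \<open>J\<close> contains at most \<open>const (|J| / \<delta>)\<^sup>s\<close> points of \<open>F\<close> that are \<open>\<delta>\<close>-separated. As \<open>s < P\<inverse>(0)\<close>, there are many
  more words of norm about \<open>r\<close> than the \<open>r\<close>-intervals needed to cover \<open>F\<close>, so by the pigeonhole principle some
  \<open>\<phi>\<^sub>v\<close> and \<open>\<phi>\<^sub>w\<close>, \<open>v \<noteq> w\<close>, are arbitrarily close relative to \<open>r\<close> in the \<open>C\<^sup>1\<close> sense. Without exact overlaps the
  displacement \<open>\<phi>\<^sub>w - \<phi>\<^sub>v\<close> is nonzero somewhere on \<open>F\<close>, and small displacements at well-chosen scales produce in \<open>F\<close>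
  approximate arithmetic progressions of any length. This contradicts upper regularity with \<open>s < 1\<close>.
\<close>

section \<open>Hausdorff content\<close>

text \<open>Because cylinders may overlap, no measure is at hand that gives \<open>cyl w\<close> a
  mass comparable with \<open>wnorm w powr s\<close>. Two set functions replace it: Hausdorff
  content, which is subadditive, finite on bounded sets and scales under word maps, and the packing
  number \<open>pk\<close>, which is superadditive because it counts only disjoint cylinders.
  Content suffices because for positive exponents it has the same null sets as the measure, and the
  measure of \<open>F\<close> could be infinite a priori. Both halves contain a self-improvement
  argument: a bound content <= M * mass, uniform over all words, is inserted into a cover by
  subcylinders and comes out with a smaller M. The gain is the duplicated cylinder in the first
  half, and an interval packed too densely for its length in the second. Uniformity rests on a
  distortion constant \<open>C\<close> that does not depend on the word. For progressions the order
  of choices matters: the old spacing is known before the close pair is picked, so closeness can be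
  demanded relative to it. How small the displacement then turns out to be is irrelevant, since the
  progression is shrunk to match it.\<close>

definition hausdorff_content :: "real \<Rightarrow> 'a::metric_space set \<Rightarrow> ennreal" where
  "hausdorff_content t A =
     (INF U \<in> {U :: nat \<Rightarrow> 'a set. A \<subseteq> (\<Union>i. U i) \<and> (\<forall>i. bounded (U i))}. \<Sum>i. hausdorff_gauge t (U i))"

lemma hausdorff_gauge_pos:
  assumes "t > 0"
  shows "hausdorff_gauge t U = ennreal (diameter U powr t)"
  using assms by (auto simp: hausdorff_gauge_def)

lemma hausdorff_content_le:
  fixes U :: "nat \<Rightarrow> 'a::metric_space set"
  assumes "A \<subseteq> (\<Union>i. U i)" "\<And>i. bounded (U i)"
  shows "hausdorff_content t A \<le> (\<Sum>i. hausdorff_gauge t (U i))"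
  unfolding hausdorff_content_def by (rule INF_lower) (use assms in auto)

lemma hausdorff_content_lessE:
  fixes A :: "'a::metric_space set"
  assumes "hausdorff_content t A < e"
  obtains U :: "nat \<Rightarrow> 'a set" where "A \<subseteq> (\<Union>i. U i)" "\<And>i. bounded (U i)"
    "(\<Sum>i. hausdorff_gauge t (U i)) < e"
  using assms unfolding hausdorff_content_def INF_less_iff by auto

lemma hausdorff_content_mono:
  assumes "A \<subseteq> B"
  shows "hausdorff_content t A \<le> hausdorff_content t B"
  unfolding hausdorff_content_def by (rule INF_superset_mono) (use assms in auto)

lemma hausdorff_content_bounded:
  fixes A :: "'a::metric_space set"
  assumes "bounded A"
  shows "hausdorff_content t A \<le> hausdorff_gauge t A"
proof -
  have "hausdorff_content t A \<le> (\<Sum>i. hausdorff_gauge t (if i = (0::nat) then A else {}))"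
    by (rule hausdorff_content_le) (use assms in auto)
  also have "\<dots> = (\<Sum>i\<in>{0}. hausdorff_gauge t (if i = (0::nat) then A else {}))"
    by (rule suminf_finite) (auto simp: hausdorff_gauge_def)
  finally show ?thesis by simp
qed

lemma hausdorff_content_empty [simp]: "hausdorff_content t {} = 0"
  using hausdorff_content_bounded[of "{}" t] by (simp add: hausdorff_gauge_def)

lemma hausdorff_content_finite:
  assumes "bounded A"
  shows "hausdorff_content t A < \<infinity>"
  using hausdorff_content_bounded[OF assms, of t]
  by (rule le_less_trans) (simp add: hausdorff_gauge_def)

lemma hausdorff_content_UN_nat:
  fixes A :: "nat \<Rightarrow> 'a::metric_space set"
  shows "hausdorff_content t (\<Union>n. A n) \<le> (\<Sum>n. hausdorff_content t (A n))"
proof (rule ennreal_le_epsilon)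
  fix e :: real assume e: "e > 0" and fin: "(\<Sum>n. hausdorff_content t (A n)) < top"
  define d where "d n = ennreal (e * (1/2) ^ Suc n)" for n
  have "\<exists>U. A n \<subseteq> (\<Union>i. U i) \<and> (\<forall>i. bounded (U i)) \<and>
     (\<Sum>i. hausdorff_gauge t (U i)) \<le> hausdorff_content t (A n) + d n" for n
  proof -
    have "hausdorff_content t (A n) \<le> (\<Sum>n. hausdorff_content t (A n))"
      using sum_le_suminf[of "\<lambda>n. hausdorff_content t (A n)" "{n}"] by simp
    hence "hausdorff_content t (A n) < top" using fin by (rule le_less_trans)
    moreover have "d n > 0" using e by (simp add: d_def)
    ultimately have "hausdorff_content t (A n) < hausdorff_content t (A n) + d n"
      using ennreal_add_left_cancel_less[of "hausdorff_content t (A n)" 0 "d n"] by simp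
    then show ?thesis by (rule hausdorff_content_lessE) (auto intro: less_imp_le)
  qed
  then obtain U where U: "\<And>n. A n \<subseteq> (\<Union>i. U n i)" "\<And>n i. bounded (U n i)"
     "\<And>n. (\<Sum>i. hausdorff_gauge t (U n i)) \<le> hausdorff_content t (A n) + d n" by metis
  define V where "V k = case_prod U (prod_decode k)" for k
  have "hausdorff_content t (\<Union>n. A n) \<le> (\<Sum>k. hausdorff_gauge t (V k))"
  proof (rule hausdorff_content_le)
    show "(\<Union>n. A n) \<subseteq> (\<Union>k. V k)"
    proof safe
      fix x n assume "x \<in> A n"
      then obtain i where "x \<in> U n i" using U(1) by blast
      hence "x \<in> V (prod_encode (n, i))" by (simp add: V_def)
      thus "x \<in> (\<Union>k. V k)" by blast
    qed
  qed (auto simp: V_def U split: prod.split)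
  also have "\<dots> = (\<Sum>n. \<Sum>i. hausdorff_gauge t (U n i))"
    using suminf_ennreal_2dimen[of "\<lambda>n. \<Sum>i. hausdorff_gauge t (U n i)" "\<lambda>p. hausdorff_gauge t (case_prod U p)"]
    by (simp add: V_def)
  also have "\<dots> \<le> (\<Sum>n. hausdorff_content t (A n) + d n)"
    by (intro suminf_le U) auto
  also have "\<dots> = (\<Sum>n. hausdorff_content t (A n)) + (\<Sum>n. d n)"
    by (rule suminf_add[symmetric]) auto
  also have "(\<Sum>n. d n) = ennreal e"
  proof -
    have "(\<lambda>n. e * (1/2) ^ Suc n) sums (e * 1)"
      by (intro sums_mult power_half_series)
    thus ?thesis unfolding d_def using e by (intro suminf_ennreal_eq) auto
  qed
  finally show "hausdorff_content t (\<Union>n. A n) \<le> (\<Sum>n. hausdorff_content t (A n)) + ennreal e" .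
qed

text \<open>Bounding finite partial sums suits families produced by Vitali's lemma, whose finite
  subfamilies are packings. \<open>to_nat_on\<close> turns the index set into a sequence whose terms
  \<open>B n\<close> are single sets \<open>A x\<close> or empty.\<close>

lemma hausdorff_content_UN_countable:
  fixes A :: "'b \<Rightarrow> 'a::metric_space set"
  assumes C: "countable C"
    and bound: "\<And>S. finite S \<Longrightarrow> S \<subseteq> C \<Longrightarrow> (\<Sum>x\<in>S. hausdorff_content t (A x)) \<le> M"
  shows "hausdorff_content t (\<Union>x\<in>C. A x) \<le> M"
proof -
  define g where "g = to_nat_on C"
  have inj: "inj_on g C" unfolding g_def using C by (rule inj_on_to_nat_on)
  define B where "B n = (\<Union>x\<in>{x\<in>C. g x = n}. A x)" for n
  have "hausdorff_content t (\<Union>x\<in>C. A x) \<le> hausdorff_content t (\<Union>n. B n)"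
    by (rule hausdorff_content_mono) (auto simp: B_def)
  also have "\<dots> \<le> (\<Sum>n. hausdorff_content t (B n))" by (rule hausdorff_content_UN_nat)
  also have "\<dots> \<le> M"
  proof (rule suminf_le_const)
    fix n
    define S where "S = {x\<in>C. g x < n}"
    have S: "S \<subseteq> C" "inj_on g S" using inj by (auto simp: S_def inj_on_def)
    have fS: "finite S" by (rule inj_on_finite[OF S(2), of "{..<n}"]) (auto simp: S_def)
    have "(\<Sum>k<n. hausdorff_content t (B k)) = (\<Sum>k\<in>g ` S. hausdorff_content t (B k))"
    proof (rule sum.mono_neutral_right)
      show "\<forall>i\<in>{..<n} - g ` S. hausdorff_content t (B i) = 0"
      proof
        fix i assume "i \<in> {..<n} - g ` S"
        hence "B i = {}" by (auto simp: B_def S_def)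
        thus "hausdorff_content t (B i) = 0" by simp
      qed
    qed (auto simp: S_def)
    also have "\<dots> = (\<Sum>x\<in>S. hausdorff_content t (B (g x)))"
      by (rule sum.reindex[OF S(2), unfolded o_def])
    also have "\<dots> = (\<Sum>x\<in>S. hausdorff_content t (A x))"
    proof (rule sum.cong)
      fix x assume x: "x \<in> S"
      hence "{y\<in>C. g y = g x} = {x}" using inj S(1) by (auto simp: inj_on_def)
      thus "hausdorff_content t (B (g x)) = hausdorff_content t (A x)" by (simp add: B_def)
    qed simp
    also have "\<dots> \<le> M" by (rule bound) (use fS S in auto)
    finally show "(\<Sum>k<n. hausdorff_content t (B k)) \<le> M" .
  qed simp
  finally show ?thesis .
qed

lemma hausdorff_content_UN_finite:
  fixes A :: "'b \<Rightarrow> 'a::metric_space set"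
  assumes "finite C"
  shows "hausdorff_content t (\<Union>x\<in>C. A x) \<le> (\<Sum>x\<in>C. hausdorff_content t (A x))"
  by (rule hausdorff_content_UN_countable)
     (use assms in \<open>auto intro: sum_mono2 countable_finite\<close>)

lemma hausdorff_content_Un:
  "hausdorff_content t (A \<union> B) \<le> hausdorff_content t A + hausdorff_content t B"
  using hausdorff_content_UN_finite[of "{True, False}" t "\<lambda>b. if b then A else B"]
  by (simp add: Un_commute)

lemma diameter_image_le:
  fixes f :: "'a::metric_space \<Rightarrow> 'b::metric_space"
  assumes "bounded S" "a \<ge> 0"
    and lip: "\<And>x y. x \<in> S \<Longrightarrow> y \<in> S \<Longrightarrow> dist (f x) (f y) \<le> a * dist x y"
  shows "diameter (f ` S) \<le> a * diameter S"
proof (cases "S = {}")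
  case False
  have "(SUP (x, y)\<in>f ` S \<times> f ` S. dist x y) \<le> a * diameter S"
  proof (rule cSUP_least)
    show "f ` S \<times> f ` S \<noteq> {}" using False by simp
    fix p assume "p \<in> f ` S \<times> f ` S"
    then obtain u v where uv: "u \<in> S" "v \<in> S" "p = (f u, f v)" by auto
    have "dist (f u) (f v) \<le> a * dist u v" using lip uv by simp
    also have "\<dots> \<le> a * diameter S"
      using diameter_bounded_bound[OF assms(1) uv(1,2)] assms(2) by (rule mult_left_mono)
    finally show "(case p of (x, y) \<Rightarrow> dist x y) \<le> a * diameter S" using uv by simp
  qed
  thus ?thesis using False by (simp add: diameter_def)
qed simp

lemma bounded_image_lipschitz:
  fixes f :: "'a::metric_space \<Rightarrow> 'b::metric_space"
  assumes "bounded S" "a \<ge> 0"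
    and lip: "\<And>x y. x \<in> S \<Longrightarrow> y \<in> S \<Longrightarrow> dist (f x) (f y) \<le> a * dist x y"
  shows "bounded (f ` S)"
proof (cases "S = {}")
  case False
  then obtain u where u: "u \<in> S" by auto
  show ?thesis unfolding bounded_def
  proof (intro exI ballI)
    fix y assume "y \<in> f ` S"
    then obtain v where v: "v \<in> S" "y = f v" by auto
    have "dist (f u) y \<le> a * dist u v" using lip u v by simp
    also have "\<dots> \<le> a * diameter S"
      using diameter_bounded_bound[OF assms(1) u v(1)] assms(2) by (rule mult_left_mono)
    finally show "dist (f u) y \<le> a * diameter S" .
  qed
qed simp

lemma hausdorff_content_image:
  fixes f :: "'a::metric_space \<Rightarrow> 'b::metric_space"
  assumes t: "t > 0" and a0: "a > 0"
    and lip: "\<And>x y. x \<in> A \<Longrightarrow> y \<in> A \<Longrightarrow> dist (f x) (f y) \<le> a * dist x y"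
  shows "hausdorff_content t (f ` A) \<le> ennreal (a powr t) * hausdorff_content t A"
proof (rule ccontr)
    assume "\<not> ?thesis"
    hence *: "ennreal (a powr t) * hausdorff_content t A < hausdorff_content t (f ` A)" by simp
    have "hausdorff_content t A < ennreal ((1/a) powr t) * hausdorff_content t (f ` A)"
    proof -
      have "ennreal ((1/a) powr t) * (ennreal (a powr t) * hausdorff_content t A) = hausdorff_content t A"
        using a0 by (simp add: mult.assoc[symmetric] ennreal_mult[symmetric] powr_mult[symmetric])
      moreover have "ennreal ((1/a) powr t) * (ennreal (a powr t) * hausdorff_content t A)
         < ennreal ((1/a) powr t) * hausdorff_content t (f ` A)"
        using * a0 by (intro ennreal_mult_strict_left_mono) auto
      ultimately show ?thesis by simp
    qed
    then obtain U where U: "A \<subseteq> (\<Union>i. U i)" "\<And>i. bounded (U i)"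
      "(\<Sum>i. hausdorff_gauge t (U i)) < ennreal ((1/a) powr t) * hausdorff_content t (f ` A)"
      by (rule hausdorff_content_lessE) blast
    \<comment> \<open>The covering sets are cut down to \<open>A\<close> because \<open>f\<close> is
      assumed Lipschitz only there.\<close>
    have bd: "bounded (U i \<inter> A)" for i using U(2) by (rule bounded_subset) auto
  have cover: "f ` A \<subseteq> (\<Union>i. f ` (U i \<inter> A))" using U(1) by blast
  have "hausdorff_content t (f ` A) \<le> (\<Sum>i. hausdorff_gauge t (f ` (U i \<inter> A)))"
      by (rule hausdorff_content_le[OF cover]) (auto intro!: bounded_image_lipschitz[OF bd less_imp_le[OF a0]] lip)
    also have "\<dots> \<le> (\<Sum>i. ennreal (a powr t) * hausdorff_gauge t (U i))"
    proof (rule suminf_le)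
      fix i
      have "diameter (f ` (U i \<inter> A)) \<le> a * diameter (U i \<inter> A)"
        by (rule diameter_image_le[OF bd less_imp_le[OF a0]]) (auto intro: lip)
      also have "\<dots> \<le> a * diameter (U i)" using a0
        by (intro mult_left_mono diameter_subset U) auto
      finally have "diameter (f ` (U i \<inter> A)) powr t \<le> (a * diameter (U i)) powr t"
        using t by (intro powr_mono2 diameter_ge_0 bounded_image_lipschitz[OF bd less_imp_le[OF a0]]) (auto intro: lip)
      thus "hausdorff_gauge t (f ` (U i \<inter> A)) \<le> ennreal (a powr t) * hausdorff_gauge t (U i)"
        using t a0 diameter_ge_0[OF U(2)[of i]]
        by (simp add: hausdorff_gauge_pos ennreal_mult[symmetric] powr_mult)
    qed auto
    also have "\<dots> = ennreal (a powr t) * (\<Sum>i. hausdorff_gauge t (U i))" by simp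
    also have "\<dots> < ennreal (a powr t) * (ennreal ((1/a) powr t) * hausdorff_content t (f ` A))"
      using U(3) a0 by (intro ennreal_mult_strict_left_mono) auto
    also have "\<dots> = hausdorff_content t (f ` A)"
      using a0 by (simp add: mult.assoc[symmetric] ennreal_mult[symmetric] powr_mult[symmetric])
    finally show False by simp
  qed

text \<open>A cover of total gauge below \<open>\<delta> powr t\<close> automatically consists of
  sets of diameter at most \<delta>, so it is admissible for the premeasure at scale
  \<delta>.\<close>

lemma hausdorff_measure_eq_0:
  fixes A :: "'a::metric_space set"
  assumes t: "t > 0" and 0: "hausdorff_content t A = 0"
  shows "hausdorff_measure t A = 0"
proof -
  have "hausdorff_premeasure t \<delta> A \<le> 0" if \<delta>: "\<delta> > 0" for \<delta>
  proof (rule ennreal_le_epsilon)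
    fix e :: real assume e: "e > 0"
    have "hausdorff_content t A < ennreal (min e (\<delta> powr t))" using 0 e \<delta> by simp
    then obtain U where U: "A \<subseteq> (\<Union>i. U i)" "\<And>i. bounded (U i)"
      "(\<Sum>i. hausdorff_gauge t (U i)) < ennreal (min e (\<delta> powr t))"
      by (rule hausdorff_content_lessE) blast
    have "diameter (U i) \<le> \<delta>" for i
    proof (rule ccontr)
      assume "\<not> diameter (U i) \<le> \<delta>"
      hence "\<delta> powr t \<le> diameter (U i) powr t" using t \<delta> by (intro powr_mono2) auto
      hence "ennreal (\<delta> powr t) \<le> hausdorff_gauge t (U i)"
        using t by (simp add: hausdorff_gauge_pos ennreal_leI)
      also have "\<dots> \<le> (\<Sum>i. hausdorff_gauge t (U i))"
        using sum_le_suminf[of "\<lambda>n. hausdorff_gauge t (U n)" "{i}"] by simp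
      also have "\<dots> < ennreal (min e (\<delta> powr t))" by (rule U)
      also have "\<dots> \<le> ennreal (\<delta> powr t)" by (rule ennreal_leI) simp
      finally show False by simp
    qed
    hence "hausdorff_premeasure t \<delta> A \<le> (\<Sum>i. hausdorff_gauge t (U i))"
      unfolding hausdorff_premeasure_def by (intro INF_lower) (use U in auto)
    also have "\<dots> \<le> ennreal (min e (\<delta> powr t))" using U(3) by simp
    also have "\<dots> \<le> 0 + ennreal e" by (simp add: ennreal_leI)
    finally show "hausdorff_premeasure t \<delta> A \<le> 0 + ennreal e" .
  qed
  hence "hausdorff_measure t A \<le> 0"
    unfolding hausdorff_measure_def by (intro SUP_least) auto
  thus ?thesis by simp
qed

lemma hausdorff_dim_le:
  assumes "t > 0" "hausdorff_content t A = 0"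
  shows "hausdorff_dim A \<le> ereal t"
  unfolding hausdorff_dim_def
  by (rule INF_lower) (use assms hausdorff_measure_eq_0 in auto)

lemma hausdorff_dim_nonneg: "hausdorff_dim A \<ge> 0"
  unfolding hausdorff_dim_def by (rule INF_greatest) auto

text \<open>Some exponent \<open>r\<close> below \<open>t\<close> has measure zero. For sets of
  diameter at most 1 the gauge can only drop when the exponent is raised from \<open>r\<close> to
  \<open>t\<close>.\<close>

lemma hausdorff_content_above_dim:
  fixes A :: "'a::metric_space set"
  assumes dim: "hausdorff_dim A < ereal t"
  shows "hausdorff_content t A = 0"
proof -
  obtain r where r: "0 \<le> r" "hausdorff_measure r A = 0" "r < t"
    using dim unfolding hausdorff_dim_def INF_less_iff by auto
  have "hausdorff_premeasure r 1 A \<le> hausdorff_measure r A"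
    unfolding hausdorff_measure_def by (rule SUP_upper) auto
  hence 0: "hausdorff_premeasure r 1 A = 0" using r by simp
  have "hausdorff_content t A \<le> hausdorff_premeasure r 1 A"
    unfolding hausdorff_premeasure_def
  proof (rule INF_greatest)
    fix U :: "nat \<Rightarrow> 'a set"
    assume "U \<in> {U. A \<subseteq> \<Union> (range U) \<and> (\<forall>i. bounded (U i) \<and> diameter (U i) \<le> 1)}"
    hence U: "A \<subseteq> \<Union> (range U)" "\<And>i. bounded (U i)" "\<And>i. diameter (U i) \<le> 1" by auto
    have "hausdorff_content t A \<le> (\<Sum>i. hausdorff_gauge t (U i))"
      by (rule hausdorff_content_le) (use U in auto)
    also have "\<dots> \<le> (\<Sum>i. hausdorff_gauge r (U i))"
    proof (rule suminf_le)
      fix i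
      have d: "0 \<le> diameter (U i)" using U(2) by (rule diameter_ge_0)
      show "hausdorff_gauge t (U i) \<le> hausdorff_gauge r (U i)"
      \<comment> \<open>At \<open>r = 0\<close> the gauge of a nonempty set is 1 by convention and
        not a value of \<open>powr\<close>.\<close>
      proof (cases "r = 0")
        case True
        have "diameter (U i) powr t \<le> 1"
          using d U(3)[of i] r by (intro powr_le1) auto
        thus ?thesis using r True by (auto simp: hausdorff_gauge_def)
      next
        case False
        have "diameter (U i) powr t \<le> diameter (U i) powr r"
          using d U(3)[of i] r by (intro powr_mono') auto
        thus ?thesis using r False by (auto simp: hausdorff_gauge_def ennreal_leI)
      qed
    qed auto
    finally show "hausdorff_content t A \<le> (\<Sum>i. hausdorff_gauge r (U i))" .
  qed
  thus ?thesis using 0 by simp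
qed

section \<open>Real-valued content of bounded sets\<close>

definition hcontent :: "real \<Rightarrow> 'a::metric_space set \<Rightarrow> real" where
  "hcontent t A = enn2real (hausdorff_content t A)"

text \<open>Since \<open>enn2real\<close> sends infinity to 0, \<open>hcontent\<close> is
  informative only on bounded sets, where the content is finite; the upper bounds below therefore
  ask for boundedness or for an explicit finite bound.\<close>

lemma hcontent_nonneg [simp]: "0 \<le> hcontent t A"
  by (simp add: hcontent_def)

lemma ennreal_hcontent: "bounded A \<Longrightarrow> ennreal (hcontent t A) = hausdorff_content t A"
  using hausdorff_content_finite[of A t] by (simp add: hcontent_def)

lemma hcontent_leI: "hausdorff_content t A \<le> ennreal r \<Longrightarrow> 0 \<le> r \<Longrightarrow> hcontent t A \<le> r"
  unfolding hcontent_def using enn2real_mono[of "hausdorff_content t A" "ennreal r"] by simp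

lemma hcontent_mono: "A \<subseteq> B \<Longrightarrow> bounded B \<Longrightarrow> hcontent t A \<le> hcontent t B"
  by (rule hcontent_leI) (use hausdorff_content_mono[of A B t] in \<open>auto simp: ennreal_hcontent\<close>)

lemma hcontent_UN_finite:
  assumes "finite S" "\<And>x. x \<in> S \<Longrightarrow> bounded (A x)"
  shows "hcontent t (\<Union>x\<in>S. A x) \<le> (\<Sum>x\<in>S. hcontent t (A x))"
proof (rule hcontent_leI)
  have "hausdorff_content t (\<Union>x\<in>S. A x) \<le> (\<Sum>x\<in>S. hausdorff_content t (A x))"
    by (rule hausdorff_content_UN_finite[OF assms(1)])
  also have "\<dots> = (\<Sum>x\<in>S. ennreal (hcontent t (A x)))"
    by (rule sum.cong) (simp_all add: ennreal_hcontent[OF assms(2)])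
  also have "\<dots> = ennreal (\<Sum>x\<in>S. hcontent t (A x))" by simp
  finally show "hausdorff_content t (\<Union>x\<in>S. A x) \<le> ennreal (\<Sum>x\<in>S. hcontent t (A x))" .
qed (simp add: sum_nonneg)

lemma hcontent_Un:
  assumes "bounded A" "bounded B"
  shows "hcontent t (A \<union> B) \<le> hcontent t A + hcontent t B"
  by (rule hcontent_leI)
     (use hausdorff_content_Un[of t A B] assms in \<open>auto simp: ennreal_hcontent[symmetric]\<close>)

lemma hcontent_diameter: "t > 0 \<Longrightarrow> bounded A \<Longrightarrow> hcontent t A \<le> diameter A powr t"
  by (rule hcontent_leI) (use hausdorff_content_bounded[of A t] in \<open>auto simp: hausdorff_gauge_pos\<close>)

lemma hcontent_image:
  fixes f :: "'a::metric_space \<Rightarrow> 'b::metric_space"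
  assumes "t > 0" "a > 0" "bounded A"
    and lip: "\<And>x y. x \<in> A \<Longrightarrow> y \<in> A \<Longrightarrow> dist (f x) (f y) \<le> a * dist x y"
  shows "hcontent t (f ` A) \<le> a powr t * hcontent t A"
  by (rule hcontent_leI)
     (use hausdorff_content_image[OF assms(1,2) lip] assms(3) in \<open>auto simp: ennreal_mult ennreal_hcontent\<close>)

section \<open>Derivatives and distortion of word maps\<close>

text \<open>The chain-rule product along the orbit. As an explicit product it splits over
  concatenation without differentiability side conditions; on \<Omega> it is the derivative of the
  word map by \<open>word_map_deriv\<close>.\<close>

primrec word_deriv :: "(nat \<Rightarrow> real \<Rightarrow> real) \<Rightarrow> nat list \<Rightarrow> real \<Rightarrow> real" where
  "word_deriv \<phi> [] x = 1"
| "word_deriv \<phi> (i # w) x = deriv (\<phi> i) (word_map \<phi> w x) * word_deriv \<phi> w x"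

lemma word_map_Nil [simp]: "word_map \<phi> [] = id"
  by (simp add: word_map_def)

lemma word_map_Cons [simp]: "word_map \<phi> (i # w) = \<phi> i \<circ> word_map \<phi> w"
  by (simp add: word_map_def)

lemma word_map_append [simp]: "word_map \<phi> (v @ w) = word_map \<phi> v \<circ> word_map \<phi> w"
  by (induction v) auto

lemma word_deriv_append:
  "word_deriv \<phi> (v @ w) x = word_deriv \<phi> v (word_map \<phi> w x) * word_deriv \<phi> w x"
  by (induction v) auto

lemma finite_indexed_le_one_bound:
  fixes f :: "'a \<Rightarrow> real"
  assumes "finite A" "A \<noteq> {}" "\<And>i. i \<in> A \<Longrightarrow> f i < 1"
  obtains r where "0 < r" "r < 1" "\<And>i. i \<in> A \<Longrightarrow> f i \<le> r"
proof
  show "0 < max (1/2) (Max (f ` A))" by simp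
  show "max (1/2) (Max (f ` A)) < 1" using assms by simp
  show "f i \<le> max (1/2) (Max (f ` A))" if "i \<in> A" for i
    using that assms(1) by (simp add: le_max_iff_disj)
qed

lemma finite_indexed_pos_bound:
  fixes f :: "'a \<Rightarrow> real"
  assumes "finite A" "A \<noteq> {}" "\<And>i. i \<in> A \<Longrightarrow> 0 < f i"
  obtains r where "0 < r" "\<And>i. i \<in> A \<Longrightarrow> r \<le> f i"
proof
  show "0 < Min (f ` A)" using assms by simp
  show "Min (f ` A) \<le> f i" if "i \<in> A" for i using that assms(1) by simp
qed

locale self_conformal =
  fixes N :: nat and \<Omega> F :: "real set" and \<phi> :: "nat \<Rightarrow> real \<Rightarrow> real"
  assumes self_conformal: "self_conformal_set N \<Omega> \<phi> F"
begin

abbreviation Words :: "nat list set" where "Words \<equiv> lists {1..N}"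
abbreviation press :: "real \<Rightarrow> real" where "press \<equiv> pressure N \<Omega> \<phi>"
abbreviation pzero :: real where "pzero \<equiv> pressure_zero N \<Omega> \<phi>"

abbreviation wmap :: "nat list \<Rightarrow> real \<Rightarrow> real" where "wmap \<equiv> word_map \<phi>"
abbreviation wder :: "nat list \<Rightarrow> real \<Rightarrow> real" where "wder \<equiv> word_deriv \<phi>"

lemma ifs: "conformal_ifs N \<Omega> \<phi>" "F \<noteq> {}" "compact F" "F \<subseteq> \<Omega>" "F = (\<Union>i\<in>{1..N}. \<phi> i ` F)"
  using self_conformal by (simp_all add: self_conformal_set_def)

lemma N_ge_2: "2 \<le> N" using ifs(1) by (simp add: conformal_ifs_def)

lemma Omega: "\<Omega> \<noteq> {}" "bounded \<Omega>" "open \<Omega>" "convex \<Omega>"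
  using ifs(1) by (simp_all add: conformal_ifs_def)

lemma map_in_Omega: "i \<in> {1..N} \<Longrightarrow> x \<in> \<Omega> \<Longrightarrow> \<phi> i x \<in> \<Omega>"
  using ifs(1) closure_subset unfolding conformal_ifs_def by blast

lemma map_in_F: "i \<in> {1..N} \<Longrightarrow> x \<in> F \<Longrightarrow> \<phi> i x \<in> F"
  using ifs(5) by blast

lemma F_cases:
  assumes "x \<in> F"
  obtains i y where "i \<in> {1..N}" "y \<in> F" "x = \<phi> i y"
proof -
  have "x \<in> (\<Union>i\<in>{1..N}. \<phi> i ` F)" using assms ifs(5) by simp
  thus ?thesis using that by blast
qed

lemma map_C1:
  assumes "i \<in> {1..N}"
  shows "\<forall>x\<in>\<Omega>. (\<phi> i has_real_derivative deriv (\<phi> i) x) (at x)"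
    "continuous_on \<Omega> (deriv (\<phi> i))" "\<forall>x\<in>\<Omega>. deriv (\<phi> i) x \<noteq> 0"
proof -
  have co: "conformal_on \<Omega> (\<phi> i)" using ifs(1) assms by (simp add: conformal_ifs_def)
  thus "\<forall>x\<in>\<Omega>. deriv (\<phi> i) x \<noteq> 0" by (simp add: conformal_on_def)
  obtain D where D: "\<forall>x\<in>\<Omega>. (\<phi> i has_vector_derivative D x) (at x)" "continuous_on \<Omega> D"
    using co unfolding conformal_on_def C1_differentiable_on_def by blast
  have eq: "deriv (\<phi> i) x = D x" if "x \<in> \<Omega>" for x
    using D(1) that by (intro DERIV_imp_deriv) (simp add: has_real_derivative_iff_has_vector_derivative)
  show "\<forall>x\<in>\<Omega>. (\<phi> i has_real_derivative deriv (\<phi> i) x) (at x)"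
    using D(1) eq by (simp add: has_real_derivative_iff_has_vector_derivative)
  show "continuous_on \<Omega> (deriv (\<phi> i))"
    using D(2) eq continuous_on_cong by (metis (no_types, lifting))
qed

lemma map_holder:
  assumes "i \<in> {1..N}"
  obtains \<alpha> c where "\<alpha> > 0" "c > 0"
    "\<And>x y. x \<in> \<Omega> \<Longrightarrow> y \<in> \<Omega> \<Longrightarrow> \<bar>deriv (\<phi> i) x - deriv (\<phi> i) y\<bar> \<le> c * \<bar>x - y\<bar> powr \<alpha>"
proof -
  have "conformal_on \<Omega> (\<phi> i)" using ifs(1) assms by (simp add: conformal_ifs_def)
  thus ?thesis using that unfolding conformal_on_def by blast
qed

lemma deriv_le_norm:
  assumes "i \<in> {1..N}" "x \<in> \<Omega>"
  shows "\<bar>deriv (\<phi> i) x\<bar> \<le> deriv_norm \<Omega> (\<phi> i)"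
  unfolding deriv_norm_def
proof (rule cSUP_upper[OF assms(2)])
  obtain \<alpha> c where h: "\<alpha> > 0" "c > 0"
    "\<And>x y. x \<in> \<Omega> \<Longrightarrow> y \<in> \<Omega> \<Longrightarrow> \<bar>deriv (\<phi> i) x - deriv (\<phi> i) y\<bar> \<le> c * \<bar>x - y\<bar> powr \<alpha>"
    using map_holder[OF assms(1)] by blast
  show "bdd_above ((\<lambda>x. \<bar>deriv (\<phi> i) x\<bar>) ` \<Omega>)"
  proof (rule bdd_aboveI2)
    fix y assume y: "y \<in> \<Omega>"
    have "\<bar>y - x\<bar> \<le> diameter \<Omega>"
      using diameter_bounded_bound[OF Omega(2) y assms(2)] by (simp add: dist_real_def)
    hence "c * \<bar>y - x\<bar> powr \<alpha> \<le> c * diameter \<Omega> powr \<alpha>"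
      using h by (intro mult_left_mono powr_mono2) auto
    thus "\<bar>deriv (\<phi> i) y\<bar> \<le> \<bar>deriv (\<phi> i) x\<bar> + c * diameter \<Omega> powr \<alpha>"
      using h(3)[OF y assms(2)] by linarith
  qed
qed

lemma ratio:
  obtains \<rho> where "0 < \<rho>" "\<rho> < 1" "\<And>i x. i \<in> {1..N} \<Longrightarrow> x \<in> \<Omega> \<Longrightarrow> \<bar>deriv (\<phi> i) x\<bar> \<le> \<rho>"
proof -
  obtain r where "0 < r" "r < 1" "\<And>i. i \<in> {1..N} \<Longrightarrow> deriv_norm \<Omega> (\<phi> i) \<le> r"
    using finite_indexed_le_one_bound[of "{1..N}" "\<lambda>i. deriv_norm \<Omega> (\<phi> i)"] N_ge_2 ifs(1)
    by (auto simp: conformal_ifs_def)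
  thus ?thesis using deriv_le_norm that by (meson order_trans)
qed

text \<open>The hull of the closed images of \<Omega> stays inside \<Omega> by convexity. A compact
  interval is wanted because the derivatives, though nonzero on \<Omega>, may tend to 0 at its
  boundary.\<close>

lemma invariant_interval:
  obtains lo hi where "lo \<le> hi" "{lo..hi} \<subseteq> \<Omega>" "\<And>i x. i \<in> {1..N} \<Longrightarrow> x \<in> \<Omega> \<Longrightarrow> \<phi> i x \<in> {lo..hi}"
proof -
  define E where "E = (\<Union>i\<in>{1..N}. closure (\<phi> i ` \<Omega>))"
  have sub: "E \<subseteq> \<Omega>" using ifs(1) by (auto simp: E_def conformal_ifs_def)
  have ne: "E \<noteq> {}" using Omega(1) N_ge_2 closure_subset by (fastforce simp: E_def)
  have "closed E" unfolding E_def by (intro closed_UN) auto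
  moreover have bE: "bounded E" using sub Omega(2) bounded_subset by blast
  ultimately have mem: "Inf E \<in> E" "Sup E \<in> E"
    using ne by (auto intro!: closed_contains_Inf closed_contains_Sup bounded_imp_bdd_below bounded_imp_bdd_above)
  have le: "Inf E \<le> x" "x \<le> Sup E" if "x \<in> E" for x
    using that bE by (auto intro: cInf_lower cSup_upper bounded_imp_bdd_below bounded_imp_bdd_above)
  show ?thesis
  proof
    show "Inf E \<le> Sup E" using le mem by blast
    thus "{Inf E..Sup E} \<subseteq> \<Omega>"
      using mem sub closed_segment_subset[OF _ _ Omega(4), of "Inf E" "Sup E"]
      by (auto simp: closed_segment_eq_real_ivl)
    fix i x assume "i \<in> {1..N}" "x \<in> \<Omega>"
    hence "\<phi> i x \<in> E" unfolding E_def by (intro UN_I[of i] subsetD[OF closure_subset] imageI)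
    thus "\<phi> i x \<in> {Inf E..Sup E}" using le by auto
  qed
qed

text \<open>An intermediate-value argument: the image of the connected set \<Omega> under the
  continuous derivative avoids 0.\<close>

lemma deriv_same_sign:
  assumes i: "i \<in> {1..N}" and xy: "x \<in> \<Omega>" "y \<in> \<Omega>"
  shows "deriv (\<phi> i) x / deriv (\<phi> i) y > 0"
proof (rule ccontr)
  let ?d = "deriv (\<phi> i)"
  assume "\<not> ?thesis"
  hence "?d x < 0 \<and> 0 < ?d y \<or> ?d y < 0 \<and> 0 < ?d x"
    using map_C1(3)[OF i] xy by (auto simp: zero_less_divide_iff not_less neq_iff)
  moreover have "connected (?d ` \<Omega>)"
    using map_C1(2)[OF i] convex_connected[OF Omega(4)] connected_continuous_image by blast
  ultimately have "0 \<in> ?d ` \<Omega>"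
    using xy connected_contains_Icc[of "?d ` \<Omega>"] by (smt (verit) atLeastAtMost_iff imageI subsetD)
  thus False using map_C1(3)[OF i] by auto
qed

lemma word_map_in_Omega: "w \<in> Words \<Longrightarrow> x \<in> \<Omega> \<Longrightarrow> wmap w x \<in> \<Omega>"
  by (induction w) (auto simp: map_in_Omega simp del: atLeastAtMost_iff)

lemma word_map_in_F: "w \<in> Words \<Longrightarrow> x \<in> F \<Longrightarrow> wmap w x \<in> F"
  by (induction w) (auto simp: map_in_F simp del: atLeastAtMost_iff)

lemma word_map_deriv:
  "w \<in> Words \<Longrightarrow> x \<in> \<Omega> \<Longrightarrow> (wmap w has_real_derivative wder w x) (at x)"
proof (induction w)
  case Nil
  then show ?case by (simp add: id_def)
next
  case (Cons i w)
  hence i: "i \<in> {1..N}" and w: "w \<in> Words" by auto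
  show ?case unfolding word_map_Cons word_deriv.simps
    by (rule DERIV_chain) (use map_C1(1)[OF i] word_map_in_Omega[OF w] Cons w in blast)+
qed

text \<open>The Hoelder bound is divided by the positive minimum of the absolute derivative on
  \<open>K\<close>; then \<open>1 + x <= exp x\<close> gives a multiplicative form that composes
  along words.\<close>

lemma deriv_ratio_le:
  assumes i: "i \<in> {1..N}" and K: "compact K" "K \<subseteq> \<Omega>" "K \<noteq> {}"
  obtains \<alpha> c :: real where "\<alpha> > 0" "c > 0"
    "\<And>x y. x \<in> K \<Longrightarrow> y \<in> K \<Longrightarrow> deriv (\<phi> i) x / deriv (\<phi> i) y \<le> exp (c * \<bar>x - y\<bar> powr \<alpha>)"
proof -
  let ?d = "deriv (\<phi> i)"
  obtain \<alpha> c where h: "\<alpha> > 0" "c > 0"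
    "\<And>x y. x \<in> \<Omega> \<Longrightarrow> y \<in> \<Omega> \<Longrightarrow> \<bar>?d x - ?d y\<bar> \<le> c * \<bar>x - y\<bar> powr \<alpha>"
    using map_holder[OF i] by blast
  have "continuous_on K (\<lambda>x. \<bar>?d x\<bar>)"
    using map_C1(2)[OF i] K(2) by (intro continuous_on_rabs) (rule continuous_on_subset)
  then obtain z where z: "z \<in> K" "\<And>y. y \<in> K \<Longrightarrow> \<bar>?d z\<bar> \<le> \<bar>?d y\<bar>"
    using continuous_attains_inf[OF K(1,3)] by blast
  have z0: "\<bar>?d z\<bar> > 0" using map_C1(3)[OF i] z(1) K(2) by auto
  show ?thesis
  proof (rule that[of \<alpha> "c / \<bar>?d z\<bar>"])
    show "\<alpha> > 0" by fact
    show "c / \<bar>?d z\<bar> > 0" using h(2) z0 by simp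
    fix x y assume xy: "x \<in> K" "y \<in> K"
    have y0: "\<bar>?d y\<bar> > 0" using z(2)[OF xy(2)] z0 by simp
    have "?d x / ?d y = 1 + (?d x - ?d y) / ?d y" using y0 by (simp add: field_simps)
    also have "\<dots> \<le> 1 + \<bar>?d x - ?d y\<bar> / \<bar>?d y\<bar>"
      by (metis abs_divide abs_ge_self add_left_mono)
    also have "\<dots> \<le> 1 + (c * \<bar>x - y\<bar> powr \<alpha>) / \<bar>?d z\<bar>"
      using h xy K(2) z(2)[OF xy(2)] z0 y0 by (intro add_left_mono frac_le) auto
    also have "\<dots> \<le> exp (c * \<bar>x - y\<bar> powr \<alpha> / \<bar>?d z\<bar>)" by (rule exp_ge_add_one_self)
    finally show "?d x / ?d y \<le> exp (c / \<bar>?d z\<bar> * \<bar>x - y\<bar> powr \<alpha>)" by simp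
  qed
qed

lemma word_deriv_nonzero: "w \<in> Words \<Longrightarrow> x \<in> \<Omega> \<Longrightarrow> wder w x \<noteq> 0"
proof (induction w)
  case (Cons i w)
  hence "i \<in> {1..N}" "w \<in> Words" by auto
  thus ?case using Cons map_C1(3)[OF \<open>i \<in> {1..N}\<close>] word_map_in_Omega by auto
qed simp

lemma abs_word_deriv_le:
  assumes "\<And>i x. i \<in> {1..N} \<Longrightarrow> x \<in> \<Omega> \<Longrightarrow> \<bar>deriv (\<phi> i) x\<bar> \<le> \<rho>"
  shows "w \<in> Words \<Longrightarrow> x \<in> \<Omega> \<Longrightarrow> \<bar>wder w x\<bar> \<le> \<rho> ^ length w"
proof (induction w)
  case (Cons i w)
  hence "i \<in> {1..N}" "w \<in> Words" by auto
  moreover have "0 \<le> \<rho>"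
    using assms[OF \<open>i \<in> {1..N}\<close> \<open>x \<in> \<Omega>\<close>] by linarith
  ultimately show ?case using Cons assms word_map_in_Omega
    by (auto simp: abs_mult intro!: mult_mono)
qed simp

lemma lipschitz_Omega:
  assumes x: "x \<in> \<Omega>" "y \<in> \<Omega>" and w: "w \<in> Words"
    and M: "\<And>z. z \<in> \<Omega> \<Longrightarrow> \<bar>wder w z\<bar> \<le> M"
  shows "\<bar>wmap w x - wmap w y\<bar> \<le> M * \<bar>x - y\<bar>"
  using field_differentiable_bound[OF Omega(4), of "wmap w" "wder w" M x y]
    has_field_derivative_at_within[OF word_map_deriv[OF w]] x M
  by (simp add: abs_minus_commute)

text \<open>Adding up the modulus \<open>\<omega>(d) = (\<Sum>i. c i * d powr \<alpha> i)\<close> over the scales \<open>\<rho>\<^sup>k d\<close> gives a modulus \<open>W\<close> with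
  \<open>W(\<rho> d) + \<omega>(d) = W(d)\<close>, which is what an induction on the word needs.\<close>
lemma word_deriv_ratio_le:
  assumes K: "compact K" "K \<subseteq> \<Omega>" "K \<noteq> {}" and inv: "\<And>i x. i \<in> {1..N} \<Longrightarrow> x \<in> \<Omega> \<Longrightarrow> \<phi> i x \<in> K"
  obtains W where "\<And>d. 0 \<le> W d" "\<And>d e. 0 \<le> d \<Longrightarrow> d \<le> e \<Longrightarrow> W d \<le> W e" "(W \<longlongrightarrow> 0) (at_right 0)"
    "\<And>w x y. w \<in> Words \<Longrightarrow> x \<in> K \<Longrightarrow> y \<in> K \<Longrightarrow>
       0 < wder w x / wder w y \<and> wder w x / wder w y \<le> exp (W \<bar>x - y\<bar>)"
proof -
  obtain \<rho> where \<rho>: "0 < \<rho>" "\<rho> < 1" "\<And>i x. i \<in> {1..N} \<Longrightarrow> x \<in> \<Omega> \<Longrightarrow> \<bar>deriv (\<phi> i) x\<bar> \<le> \<rho>"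
    using ratio by blast
  have "\<exists>\<alpha> c. \<alpha> > 0 \<and> c > 0 \<and>
      (\<forall>x\<in>K. \<forall>y\<in>K. deriv (\<phi> i) x / deriv (\<phi> i) y \<le> exp (c * \<bar>x - y\<bar> powr \<alpha>))" if "i \<in> {1..N}" for i
    using deriv_ratio_le[OF that K] by metis
  then obtain \<alpha> c where h: "\<And>i. i \<in> {1..N} \<Longrightarrow> \<alpha> i > 0" "\<And>i. i \<in> {1..N} \<Longrightarrow> c i > 0"
    "\<And>i x y. i \<in> {1..N} \<Longrightarrow> x \<in> K \<Longrightarrow> y \<in> K \<Longrightarrow> deriv (\<phi> i) x / deriv (\<phi> i) y \<le> exp (c i * \<bar>x - y\<bar> powr \<alpha> i)"
    by metis
  \<comment> \<open>Sum over \<open>k\<close> of the geometric series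
    \<open>c i * (\<rho> powr \<alpha> i) ^ k\<close>, the distortion accumulated over all
    scales.\<close>
  define C where "C i = c i / (1 - \<rho> powr \<alpha> i)" for i
  have \<rho>\<alpha>: "\<rho> powr \<alpha> i < 1" if "i \<in> {1..N}" for i
    using powr_less_mono2[OF h(1)[OF that] _ \<rho>(2)] \<rho>(1) by simp
  have C: "C i > 0" if "i \<in> {1..N}" for i using h(2) \<rho>\<alpha> that by (simp add: C_def)
  define W where "W d = (\<Sum>i\<in>{1..N}. C i * d powr \<alpha> i)" for d
  have W_step: "W (\<rho> * d) + c i * d powr \<alpha> i \<le> W d" if i: "i \<in> {1..N}" and d: "d \<ge> 0" for d i
  proof -
    have "c i * d powr \<alpha> i \<le> (\<Sum>j\<in>{1..N}. c j * d powr \<alpha> j)"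
      by (rule member_le_sum[OF i]) (use less_imp_le[OF h(2)] in auto)
    also have "W (\<rho> * d) + \<dots> = W d"
      unfolding W_def sum.distrib[symmetric]
    proof (rule sum.cong)
      fix j assume j: "j \<in> {1..N}"
      have c: "c j = C j * (1 - \<rho> powr \<alpha> j)" using \<rho>\<alpha>[OF j] by (simp add: C_def)
      show "C j * (\<rho> * d) powr \<alpha> j + c j * d powr \<alpha> j = C j * d powr \<alpha> j"
        unfolding c using \<rho>(1) d by (simp add: powr_mult algebra_simps)
    qed simp
    finally show ?thesis by simp
  qed
  have mono: "W d \<le> W e" if "0 \<le> d" "d \<le> e" for d e
    unfolding W_def
  proof (intro sum_mono mult_left_mono)
    fix i assume i: "i \<in> {1..N}"
    show "d powr \<alpha> i \<le> e powr \<alpha> i" using that h(1)[OF i] by (intro powr_mono2) auto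
    show "0 \<le> C i" using C[OF i] by simp
  qed
  have lip: "\<bar>\<phi> i x - \<phi> i y\<bar> \<le> \<rho> * \<bar>x - y\<bar>" if "i \<in> {1..N}" "x \<in> K" "y \<in> K" for i x y
    using lipschitz_Omega[of x y "[i]" \<rho>] that \<rho>(3) K(2) by auto
  have "0 < wder w x / wder w y \<and> wder w x / wder w y \<le> exp (W \<bar>x - y\<bar>)"
    if "w \<in> Words" "x \<in> K" "y \<in> K" for w x y
    using that
  \<comment> \<open>The innermost letter is split off: it brings the two points closer by the factor
    \<rho> before the rest of the word acts, which is what \<open>W_step\<close> absorbs.\<close>
  proof (induction w arbitrary: x y rule: rev_induct)
    case Nil
    have "0 \<le> W \<bar>x - y\<bar>" unfolding W_def by (intro sum_nonneg mult_nonneg_nonneg) (use less_imp_le[OF C] in auto)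
    then show ?case by simp
  next
    case (snoc i w)
    hence i: "i \<in> {1..N}" and w: "w \<in> Words" by auto
    have im: "\<phi> i x \<in> K" "\<phi> i y \<in> K" using inv i snoc.prems K(2) by auto
    have eq: "wder (w @ [i]) x / wder (w @ [i]) y =
      wder w (\<phi> i x) / wder w (\<phi> i y) * (deriv (\<phi> i) x / deriv (\<phi> i) y)"
      by (simp add: word_deriv_append)
    note IH = snoc.IH[OF w im]
    have s: "0 < deriv (\<phi> i) x / deriv (\<phi> i) y" using deriv_same_sign[OF i] snoc.prems K(2) by auto
    have "wder w (\<phi> i x) / wder w (\<phi> i y) * (deriv (\<phi> i) x / deriv (\<phi> i) y) \<le>
      exp (W \<bar>\<phi> i x - \<phi> i y\<bar>) * exp (c i * \<bar>x - y\<bar> powr \<alpha> i)"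
      using IH s h(3)[OF i snoc.prems(2,3)] by (intro mult_mono) auto
    also have "\<dots> = exp (W \<bar>\<phi> i x - \<phi> i y\<bar> + c i * \<bar>x - y\<bar> powr \<alpha> i)" by (simp add: exp_add)
    also have "\<dots> \<le> exp (W \<bar>x - y\<bar>)"
      using mono[OF abs_ge_zero lip[OF i snoc.prems(2,3)]] W_step[OF i abs_ge_zero, of "x - y"] by simp
    finally show ?case unfolding eq using mult_pos_pos[OF conjunct1[OF IH] s] by blast
  qed
  moreover have "(W \<longlongrightarrow> 0) (at_right 0)"
    unfolding W_def
  proof (rule tendsto_null_sum)
    fix i assume i: "i \<in> {1..N}"
    have "((\<lambda>d. d powr \<alpha> i) \<longlongrightarrow> 0 powr \<alpha> i) (at_right 0)"
      using h(1)[OF i] eventually_at_right_less[of "0::real"]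
      by (intro tendsto_powr') (auto intro!: eventually_mono[OF eventually_at_right_less[of "0::real"]])
    thus "((\<lambda>d. C i * d powr \<alpha> i) \<longlongrightarrow> 0) (at_right 0)"
      using tendsto_mult_right_zero by fastforce
  qed
  moreover have "0 \<le> W d" for d
    unfolding W_def by (intro sum_nonneg mult_nonneg_nonneg) (use less_imp_le[OF C] in auto)
  ultimately show ?thesis using mono that by blast
qed

text \<open>Only \<open>x\<close> is confined to the compact interval, while \<open>y\<close> may be
  anywhere in \<Omega>. After the innermost letter both points lie in \<open>{lo..hi}\<close>, where
  the ratio bound applies; the derivative of that letter is at most 1 in modulus at \<open>y\<close>
  and at least \<open>r\<close> at \<open>x\<close>.\<close>

lemma bounded_distortion:
  obtains lo hi C where "lo \<le> hi" "{lo..hi} \<subseteq> \<Omega>" "F \<subseteq> {lo..hi}"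
    "\<And>i x. i \<in> {1..N} \<Longrightarrow> x \<in> \<Omega> \<Longrightarrow> \<phi> i x \<in> {lo..hi}"
    "C \<ge> 1"
    "\<And>w x y. w \<in> Words \<Longrightarrow> x \<in> {lo..hi} \<Longrightarrow> y \<in> \<Omega> \<Longrightarrow>
        \<bar>wder w y\<bar> \<le> C * \<bar>wder w x\<bar>"
    "\<And>\<epsilon>. \<epsilon> > 0 \<Longrightarrow> \<exists>d>0. \<forall>w\<in>Words. \<forall>x\<in>{lo..hi}. \<forall>y\<in>{lo..hi}. \<bar>x - y\<bar> \<le> d \<longrightarrow>
        \<bar>wder w x - wder w y\<bar> \<le> \<epsilon> * \<bar>wder w y\<bar>"
proof -
  obtain lo hi where K: "lo \<le> hi" "{lo..hi} \<subseteq> \<Omega>" "\<And>i x. i \<in> {1..N} \<Longrightarrow> x \<in> \<Omega> \<Longrightarrow> \<phi> i x \<in> {lo..hi}"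
    using invariant_interval by blast
  obtain W where W: "\<And>d. 0 \<le> W d" "\<And>d e. 0 \<le> d \<Longrightarrow> d \<le> e \<Longrightarrow> W d \<le> W e" "(W \<longlongrightarrow> 0) (at_right 0)"
    "\<And>w x y. w \<in> Words \<Longrightarrow> x \<in> {lo..hi} \<Longrightarrow> y \<in> {lo..hi} \<Longrightarrow>
       0 < wder w x / wder w y \<and> wder w x / wder w y \<le> exp (W \<bar>x - y\<bar>)"
    using word_deriv_ratio_le[of "{lo..hi}"] K by auto
  obtain \<rho> where \<rho>: "0 < \<rho>" "\<rho> < 1" "\<And>i x. i \<in> {1..N} \<Longrightarrow> x \<in> \<Omega> \<Longrightarrow> \<bar>deriv (\<phi> i) x\<bar> \<le> \<rho>"
    using ratio by blast
  have "\<exists>r>0. \<forall>x\<in>{lo..hi}. r \<le> \<bar>deriv (\<phi> i) x\<bar>" if i: "i \<in> {1..N}" for i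
  proof -
    have "continuous_on {lo..hi} (\<lambda>x. \<bar>deriv (\<phi> i) x\<bar>)"
      using map_C1(2)[OF i] K(2) by (intro continuous_on_rabs) (rule continuous_on_subset)
    then obtain z where "z \<in> {lo..hi}" "\<forall>y\<in>{lo..hi}. \<bar>deriv (\<phi> i) z\<bar> \<le> \<bar>deriv (\<phi> i) y\<bar>"
      using continuous_attains_inf[of "{lo..hi}" "\<lambda>x. \<bar>deriv (\<phi> i) x\<bar>"] K(1)
      by (metis atLeastatMost_empty_iff2 compact_Icc not_less)
    thus ?thesis using map_C1(3)[OF i] K(2) by (intro exI[of _ "\<bar>deriv (\<phi> i) z\<bar>"]) auto
  qed
  then obtain f where f: "\<And>i. i \<in> {1..N} \<Longrightarrow> f i > 0"
    "\<And>i x. i \<in> {1..N} \<Longrightarrow> x \<in> {lo..hi} \<Longrightarrow> f i \<le> \<bar>deriv (\<phi> i) x\<bar>" by metis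
  obtain r where r: "r > 0" "\<And>i. i \<in> {1..N} \<Longrightarrow> r \<le> f i"
    using finite_indexed_pos_bound[of "{1..N}" f] f(1) N_ge_2 by auto
  have dr: "r \<le> \<bar>deriv (\<phi> i) x\<bar>" if "i \<in> {1..N}" "x \<in> {lo..hi}" for i x
    using f(2)[OF that] r(2)[OF that(1)] by linarith
  define C where "C = max 1 (exp (W (hi - lo)) / r)"
  show ?thesis
  proof
    show "lo \<le> hi" "{lo..hi} \<subseteq> \<Omega>" by fact+
    show "\<phi> i x \<in> {lo..hi}" if "i \<in> {1..N}" "x \<in> \<Omega>" for i x using K(3) that .
    show "F \<subseteq> {lo..hi}"
    proof
      fix x assume "x \<in> F"
      then obtain i y where "i \<in> {1..N}" "y \<in> F" "x = \<phi> i y" using F_cases by blast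
      thus "x \<in> {lo..hi}" using K(3) ifs(4) by blast
    qed
    show "C \<ge> 1" by (simp add: C_def)
    show "\<bar>wder w y\<bar> \<le> C * \<bar>wder w x\<bar>"
      if w: "w \<in> Words" and x: "x \<in> {lo..hi}" and y: "y \<in> \<Omega>" for w x y
    proof (cases w rule: rev_cases)
      case Nil
      then show ?thesis by (simp add: C_def)
    next
      case (snoc u i)
      hence i: "i \<in> {1..N}" and u: "u \<in> Words" using w by auto
      have xO: "x \<in> \<Omega>" using x K(2) by auto
      have im: "\<phi> i x \<in> {lo..hi}" "\<phi> i y \<in> {lo..hi}" using K(3)[OF i] xO y by auto
      have imO: "\<phi> i x \<in> \<Omega>" using im(1) K(2) by auto
      have rw: "r \<le> \<bar>deriv (\<phi> i) x\<bar>" by (rule dr[OF i x])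
      have nz: "wder u (\<phi> i x) \<noteq> 0" using word_deriv_nonzero[OF u imO] .
      have "wder u (\<phi> i y) / wder u (\<phi> i x) \<le> exp (W (hi - lo))"
        "0 < wder u (\<phi> i y) / wder u (\<phi> i x)"
        using W(4)[OF u im(2,1)] W(2)[of "\<bar>\<phi> i y - \<phi> i x\<bar>" "hi - lo"] im
        by (auto intro: order_trans)
      hence "\<bar>wder u (\<phi> i y)\<bar> / \<bar>wder u (\<phi> i x)\<bar> \<le> exp (W (hi - lo))"
        by (metis abs_divide abs_of_pos)
      hence 1: "\<bar>wder u (\<phi> i y)\<bar> \<le> exp (W (hi - lo)) * \<bar>wder u (\<phi> i x)\<bar>"
        using nz by (simp add: divide_le_eq)
      have "\<bar>wder w y\<bar> = \<bar>wder u (\<phi> i y)\<bar> * \<bar>deriv (\<phi> i) y\<bar>"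
        by (simp add: snoc word_deriv_append abs_mult)
      also have "\<dots> \<le> \<bar>wder u (\<phi> i y)\<bar> * 1"
        using \<rho>(2) \<rho>(3)[OF i y] by (intro mult_left_mono) auto
      also have "\<dots> \<le> exp (W (hi - lo)) * \<bar>wder u (\<phi> i x)\<bar>" using 1 by simp
      also have "\<dots> \<le> exp (W (hi - lo)) * \<bar>wder u (\<phi> i x)\<bar> * (\<bar>deriv (\<phi> i) x\<bar> / r)"
        using mult_left_mono[of 1 "\<bar>deriv (\<phi> i) x\<bar> / r" "exp (W (hi - lo)) * \<bar>wder u (\<phi> i x)\<bar>"] rw r(1)
        by simp
      also have "\<dots> = exp (W (hi - lo)) / r * \<bar>wder w x\<bar>"
        by (simp add: snoc word_deriv_append abs_mult)
      also have "\<dots> \<le> C * \<bar>wder w x\<bar>"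
        by (intro mult_right_mono) (auto simp: C_def)
      finally show ?thesis .
    qed
    show "\<exists>d>0. \<forall>w\<in>Words. \<forall>x\<in>{lo..hi}. \<forall>y\<in>{lo..hi}. \<bar>x - y\<bar> \<le> d \<longrightarrow>
        \<bar>wder w x - wder w y\<bar> \<le> \<epsilon> * \<bar>wder w y\<bar>" if e: "\<epsilon> > 0" for \<epsilon>
    proof -
      define \<eta> where "\<eta> = min \<epsilon> (1/2)"
      have \<eta>: "0 < \<eta>" "\<eta> \<le> \<epsilon>" "\<eta> < 1" using e by (auto simp: \<eta>_def)
      have "0 < ln (1 + \<eta>)" using \<eta> by simp
      hence "\<forall>\<^sub>F d in at_right 0. W d < ln (1 + \<eta>)" using W(3) order_tendstoD(2) by blast
      then obtain b where b: "b > 0" "\<And>d. 0 < d \<Longrightarrow> d < b \<Longrightarrow> W d < ln (1 + \<eta>)"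
        unfolding eventually_at_right_field by auto
      have "\<bar>wder w x - wder w y\<bar> \<le> \<epsilon> * \<bar>wder w y\<bar>"
        if w: "w \<in> Words" and xy: "x \<in> {lo..hi}" "y \<in> {lo..hi}" "\<bar>x - y\<bar> \<le> b/2" for w x y
      proof -
        let ?q = "wder w x / wder w y" and ?q' = "wder w y / wder w x"
        have "W \<bar>x - y\<bar> \<le> W (b/2)" by (rule W(2)) (use xy in auto)
        also have "\<dots> < ln (1 + \<eta>)" using b by simp
        finally have E: "exp (W \<bar>x - y\<bar>) \<le> 1 + \<eta>" using \<eta> by (simp add: ln_ge_iff[symmetric] less_imp_le)
        have q: "0 < ?q" "?q \<le> 1 + \<eta>" "0 < ?q'" "?q' \<le> 1 + \<eta>"
          using W(4)[OF w xy(1,2)] W(4)[OF w xy(2,1)] E by (auto simp: abs_minus_commute)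
        \<comment> \<open>The lower bound on the ratio comes from the upper bound on its inverse,
          since \<open>1 - \<eta> <= 1 / (1 + \<eta>)\<close>.\<close>
        have "1 \<le> (1 + \<eta>) * ?q"
          using q(1,4) by (simp add: divide_le_eq le_divide_eq zero_less_divide_iff split: if_splits)
        moreover have "(1 + \<eta>) * (1 - \<eta>) \<le> 1" using \<eta> by (simp add: algebra_simps)
        ultimately have "(1 + \<eta>) * (1 - \<eta>) \<le> (1 + \<eta>) * ?q" by linarith
        hence "1 - \<eta> \<le> ?q" using \<eta>(1) by (simp only: mult_le_cancel_left_pos)
        hence "\<bar>?q - 1\<bar> \<le> \<eta>" using q(2) by linarith
        moreover have "wder w y \<noteq> 0" using q(1) by auto
        hence "\<bar>wder w x - wder w y\<bar> = \<bar>?q - 1\<bar> * \<bar>wder w y\<bar>"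
          unfolding abs_mult[symmetric] by (simp add: left_diff_distrib)
        ultimately show ?thesis using \<eta>(2) by (auto intro!: mult_right_mono)
      qed
      thus ?thesis using b(1) by (intro exI[of _ "b/2"]) auto
    qed
  qed
qed

end

declare One_nat_def [simp del] \<comment> \<open>otherwise \<open>{1..N}\<close> is rewritten to \<open>{Suc 0..N}\<close>\<close>

text \<open>With the interval, the distortion constant and the contraction ratio as parameters,
  later definitions such as \<open>\<kappa>\<close>, \<open>D\<close> and \<open>KR\<close> can
  depend on them.\<close>

locale conformal_words = self_conformal +
  fixes lo hi C \<rho> :: real
  assumes lo_le_hi: "lo \<le> hi" and interval_Omega: "{lo..hi} \<subseteq> \<Omega>" and F_interval: "F \<subseteq> {lo..hi}"
    and map_interval: "\<And>i x. i \<in> {1..N} \<Longrightarrow> x \<in> \<Omega> \<Longrightarrow> \<phi> i x \<in> {lo..hi}"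
    and C_ge_1: "C \<ge> 1"
    and distortion: "\<And>w x y. w \<in> Words \<Longrightarrow> x \<in> {lo..hi} \<Longrightarrow> y \<in> \<Omega> \<Longrightarrow>
        \<bar>wder w y\<bar> \<le> C * \<bar>wder w x\<bar>"
    and small_distortion: "\<And>\<epsilon>. \<epsilon> > 0 \<Longrightarrow> \<exists>d>0. \<forall>w\<in>Words. \<forall>x\<in>{lo..hi}. \<forall>y\<in>{lo..hi}. \<bar>x - y\<bar> \<le> d \<longrightarrow>
        \<bar>wder w x - wder w y\<bar> \<le> \<epsilon> * \<bar>wder w y\<bar>"
    and rho: "0 < \<rho>" "\<rho> < 1" "\<And>i x. i \<in> {1..N} \<Longrightarrow> x \<in> \<Omega> \<Longrightarrow> \<bar>deriv (\<phi> i) x\<bar> \<le> \<rho>"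

lemma (in self_conformal) conformal_words_exists:
  obtains lo hi C \<rho> where "conformal_words N \<Omega> F \<phi> lo hi C \<rho>"
proof -
  obtain \<rho> where "0 < \<rho>" "\<rho> < 1" "\<And>i x. i \<in> {1..N} \<Longrightarrow> x \<in> \<Omega> \<Longrightarrow> \<bar>deriv (\<phi> i) x\<bar> \<le> \<rho>"
    using ratio by blast
  note \<rho> = this
  show ?thesis
  proof (rule bounded_distortion)
    fix lo hi C
    assume *: "lo \<le> hi" "{lo..hi} \<subseteq> \<Omega>" "F \<subseteq> {lo..hi}"
      "\<And>i x. i \<in> {1..N} \<Longrightarrow> x \<in> \<Omega> \<Longrightarrow> \<phi> i x \<in> {lo..hi}" "C \<ge> 1"
      "\<And>w x y. w \<in> Words \<Longrightarrow> x \<in> {lo..hi} \<Longrightarrow> y \<in> \<Omega> \<Longrightarrow>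
        \<bar>wder w y\<bar> \<le> C * \<bar>wder w x\<bar>"
      "\<And>\<epsilon>. \<epsilon> > 0 \<Longrightarrow> \<exists>d>0. \<forall>w\<in>Words. \<forall>x\<in>{lo..hi}. \<forall>y\<in>{lo..hi}. \<bar>x - y\<bar> \<le> d \<longrightarrow>
        \<bar>wder w x - wder w y\<bar> \<le> \<epsilon> * \<bar>wder w y\<bar>"
    have "conformal_words_axioms N \<Omega> F \<phi> lo hi C \<rho>"
      by (rule conformal_words_axioms.intro; fact)
    with self_conformal_axioms have "conformal_words N \<Omega> F \<phi> lo hi C \<rho>"
      by (rule conformal_words.intro)
    thus ?thesis by (rule that)
  qed
qed

lemma UN_remove_dup:
  assumes "v \<in> A" "w \<in> A" "v \<noteq> w" "f v = f w"
  shows "(\<Union>x\<in>A. f x) = (\<Union>x\<in>A - {w}. f x)"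
  using assms by (auto; metis)

lemma finite_words [simp]: "finite (words N n)"
  using finite_lists_length_eq[of "{1..N}" n] by (auto simp: words_def lists_eq_set conj_commute)

lemma words_add:
  "bij_betw (\<lambda>(v, w). v @ w) (words N m \<times> words N n) (words N (m + n))"
  unfolding bij_betw_def
proof
  show "inj_on (\<lambda>(v, w). v @ w) (words N m \<times> words N n)"
    by (auto simp: inj_on_def words_def)
  have "w \<in> (\<lambda>(v, w). v @ w) ` (words N m \<times> words N n)" if "w \<in> words N (m + n)" for w
  proof (rule image_eqI)
    show "w = (case (take m w, drop m w) of (v, w) \<Rightarrow> v @ w)" by simp
    show "(take m w, drop m w) \<in> words N m \<times> words N n"
      using that by (auto simp: words_def dest: in_set_takeD in_set_dropD)
  qed
  thus "(\<lambda>(v, w). v @ w) ` (words N m \<times> words N n) = words N (m + n)"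
    by (auto simp: words_def)
qed

lemma sum_words_add:
  "(\<Sum>w\<in>words N (m + n). f w) = (\<Sum>v\<in>words N m. \<Sum>w\<in>words N n. f (v @ w))"
proof -
  have "(\<Sum>w\<in>words N (m + n). f w) = (\<Sum>p\<in>words N m \<times> words N n. f (case p of (v, w) \<Rightarrow> v @ w))"
    by (rule sum.reindex_bij_betw[OF words_add, symmetric])
  thus ?thesis by (simp add: sum.cartesian_product split_def)
qed

section \<open>Norms of words and stopping times\<close>

context conformal_words
begin

definition wnorm :: "nat list \<Rightarrow> real" where
  "wnorm w = deriv_norm \<Omega> (wmap w)"

lemma wnorm_eq:
  assumes "w \<in> Words"
  shows "wnorm w = (SUP x\<in>\<Omega>. \<bar>wder w x\<bar>)"
  unfolding wnorm_def deriv_norm_def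
proof (rule SUP_cong)
  fix x assume "x \<in> \<Omega>"
  thus "\<bar>deriv (wmap w) x\<bar> = \<bar>wder w x\<bar>"
    using DERIV_imp_deriv[OF word_map_deriv[OF assms]] by simp
qed simp

lemma lo_in: "lo \<in> {lo..hi}" "lo \<in> \<Omega>"
  using lo_le_hi interval_Omega by auto

lemma word_deriv_le_wnorm:
  assumes "w \<in> Words" "x \<in> \<Omega>"
  shows "\<bar>wder w x\<bar> \<le> wnorm w"
  unfolding wnorm_eq[OF assms(1)]
proof (rule cSUP_upper[OF assms(2)])
  show "bdd_above ((\<lambda>x. \<bar>wder w x\<bar>) ` \<Omega>)"
    using distortion[OF assms(1) lo_in(1)] by (rule bdd_aboveI2)
qed

lemma wnorm_least:
  assumes "w \<in> Words" "\<And>x. x \<in> \<Omega> \<Longrightarrow> \<bar>wder w x\<bar> \<le> M"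
  shows "wnorm w \<le> M"
  unfolding wnorm_eq[OF assms(1)] by (rule cSUP_least) (use Omega(1) assms(2) in auto)

lemma wnorm_le:
  assumes "w \<in> Words" "x \<in> {lo..hi}"
  shows "wnorm w \<le> C * \<bar>wder w x\<bar>"
  using distortion[OF assms] by (rule wnorm_least[OF assms(1)])

lemma wnorm_pos:
  assumes "w \<in> Words"
  shows "wnorm w > 0"
  using word_deriv_le_wnorm[OF assms lo_in(2)] word_deriv_nonzero[OF assms lo_in(2)] by linarith

lemma wnorm_Nil [simp]: "wnorm [] = 1"
  using Omega(1) by (simp add: wnorm_eq)

lemma wnorm_le_power:
  assumes "w \<in> Words"
  shows "wnorm w \<le> \<rho> ^ length w"
  by (rule wnorm_least[OF assms]) (rule abs_word_deriv_le[OF rho(3) assms])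

lemma wnorm_le_1:
  assumes "w \<in> Words"
  shows "wnorm w \<le> 1"
  using wnorm_le_power[OF assms] power_le_one[of \<rho> "length w"] rho by linarith

lemma wnorm_append_le:
  assumes v: "v \<in> Words" and w: "w \<in> Words"
  shows "wnorm (v @ w) \<le> wnorm v * wnorm w"
proof (rule wnorm_least)
  fix x assume x: "x \<in> \<Omega>"
  show "\<bar>wder (v @ w) x\<bar> \<le> wnorm v * wnorm w"
    unfolding word_deriv_append abs_mult
    using x v w wnorm_pos[OF v] by (intro mult_mono word_deriv_le_wnorm word_map_in_Omega) auto
qed (use v w in auto)

lemma word_map_interval:
  assumes "w \<in> Words" "w \<noteq> []" "x \<in> \<Omega>"
  shows "wmap w x \<in> {lo..hi}"
proof -
  obtain i u where "w = i # u" using assms(2) by (cases w) auto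
  moreover from this have "i \<in> {1..N}" "u \<in> Words" using assms(1) by auto
  ultimately show ?thesis using map_interval word_map_in_Omega assms(3) by auto
qed

lemma word_map_interval':
  assumes "w \<in> Words" "x \<in> {lo..hi}"
  shows "wmap w x \<in> {lo..hi}"
  using word_map_interval[OF assms(1)] assms(2) interval_Omega by (cases "w = []") auto

text \<open>The inner word maps \<Omega> into \<open>{lo..hi}\<close>, where \<open>wder v\<close>
  has modulus at least \<open>wnorm v / C\<close>. The empty word is separate, since the identity
  does not map \<Omega> into that interval.\<close>

lemma wnorm_append_ge:
  assumes v: "v \<in> Words" and w: "w \<in> Words"
  shows "wnorm v * wnorm w \<le> C * wnorm (v @ w)"
proof (cases "w = []")
  case True
  have "1 * wnorm v \<le> C * wnorm v" using C_ge_1 wnorm_pos[OF v] by (intro mult_right_mono) auto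
  thus ?thesis using True by simp
next
  case False
  have "wnorm w \<le> C * wnorm (v @ w) / wnorm v"
  proof (rule wnorm_least[OF w])
    fix x assume x: "x \<in> \<Omega>"
    have "wnorm v * \<bar>wder w x\<bar> \<le> C * \<bar>wder v (wmap w x)\<bar> * \<bar>wder w x\<bar>"
      by (intro mult_right_mono wnorm_le[OF v word_map_interval[OF w False x]]) auto
    also have "\<dots> = C * \<bar>wder (v @ w) x\<bar>" by (simp add: word_deriv_append abs_mult)
    also have "\<dots> \<le> C * wnorm (v @ w)"
      using C_ge_1 v w x by (intro mult_left_mono word_deriv_le_wnorm) auto
    finally show "\<bar>wder w x\<bar> \<le> C * wnorm (v @ w) / wnorm v"
      using wnorm_pos[OF v] by (simp add: pos_le_divide_eq mult.commute)
  qed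
  thus ?thesis using wnorm_pos[OF v] by (simp add: pos_le_divide_eq mult.commute)
qed

lemma wnorm_powr_append_le:
  assumes "v \<in> Words" "w \<in> Words" "t \<ge> 0"
  shows "wnorm (v @ w) powr t \<le> wnorm v powr t * wnorm w powr t"
proof -
  have "wnorm (v @ w) powr t \<le> (wnorm v * wnorm w) powr t"
    using wnorm_append_le[OF assms(1,2)] wnorm_pos[of "v @ w"] assms by (intro powr_mono2) auto
  thus ?thesis by (simp only: powr_mult)
qed

lemma wnorm_powr_append_ge:
  assumes "v \<in> Words" "w \<in> Words" "t \<ge> 0"
  shows "wnorm v powr t * wnorm w powr t \<le> C powr t * wnorm (v @ w) powr t"
proof -
  have "(wnorm v * wnorm w) powr t \<le> (C * wnorm (v @ w)) powr t"
    using wnorm_append_ge[OF assms(1,2)] assms wnorm_pos[OF assms(1)] wnorm_pos[OF assms(2)]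
    by (intro powr_mono2) auto
  thus ?thesis by (simp only: powr_mult)
qed

lemma word_map_lipschitz:
  assumes "w \<in> Words" "x \<in> \<Omega>" "y \<in> \<Omega>"
  shows "\<bar>wmap w x - wmap w y\<bar> \<le> wnorm w * \<bar>x - y\<bar>"
  by (rule lipschitz_Omega[OF assms(2,3,1)]) (rule word_deriv_le_wnorm[OF assms(1)])

lemma word_map_mvt:
  assumes w: "w \<in> Words" and xy: "x \<in> {lo..hi}" "y \<in> {lo..hi}"
  obtains z where "min x y \<le> z" "z \<le> max x y"
    "wmap w x - wmap w y = (x - y) * wder w z"
proof -
  have *: "\<exists>z. a \<le> z \<and> z \<le> b \<and> wmap w b - wmap w a = (b - a) * wder w z"
    if "a < b" "a \<in> {lo..hi}" "b \<in> {lo..hi}" for a b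
  proof -
    have "\<exists>z. a < z \<and> z < b \<and> wmap w b - wmap w a = (b - a) * wder w z"
      by (rule MVT2[OF that(1)]) (use that interval_Omega in \<open>auto intro!: word_map_deriv[OF w]\<close>)
    thus ?thesis by (auto intro: less_imp_le)
  qed
  consider "x < y" | "y < x" | "x = y" by linarith
  thus ?thesis
  proof cases
    case 1
    then obtain z where z: "x \<le> z" "z \<le> y" "wmap w y - wmap w x = (y - x) * wder w z"
      using * xy by blast
    show ?thesis by (rule that[of z]) (use z in \<open>auto simp: algebra_simps\<close>)
  next
    case 2
    then obtain z where z: "y \<le> z" "z \<le> x" "wmap w x - wmap w y = (x - y) * wder w z"
      using * xy by blast
    show ?thesis by (rule that[of z]) (use z in auto)
  next
    case 3
    show ?thesis by (rule that[of x]) (use 3 in auto)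
  qed
qed

text \<open>Mean value theorem plus distortion. Together with \<open>word_map_lipschitz\<close> it
  makes every word map a similarity on \<open>{lo..hi}\<close> up to the factor
  \<open>C\<close>.\<close>

lemma word_map_expand:
  assumes w: "w \<in> Words" and xy: "x \<in> {lo..hi}" "y \<in> {lo..hi}"
  shows "wnorm w * \<bar>x - y\<bar> \<le> C * \<bar>wmap w x - wmap w y\<bar>"
proof -
  obtain z where z: "min x y \<le> z" "z \<le> max x y"
    "wmap w x - wmap w y = (x - y) * wder w z"
    using word_map_mvt[OF assms] by blast
  have "wnorm w * \<bar>x - y\<bar> \<le> C * \<bar>wder w z\<bar> * \<bar>x - y\<bar>"
    by (intro mult_right_mono wnorm_le[OF w]) (use z xy in \<open>auto simp: min_def max_def split: if_splits\<close>)
  thus ?thesis by (simp add: z(3) abs_mult mult_ac)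
qed

lemma word_map_inj: "w \<in> Words \<Longrightarrow> inj_on (wmap w) {lo..hi}"
proof (rule inj_onI, rule ccontr)
  fix x y assume w: "w \<in> Words" and xy: "x \<in> {lo..hi}" "y \<in> {lo..hi}"
    and "wmap w x = wmap w y" "x \<noteq> y"
  thus False using word_map_expand[OF w xy] wnorm_pos[OF w] by (simp add: mult_le_0_iff)
qed

lemma F_cases_word:
  assumes "x \<in> F"
  obtains w z where "w \<in> words N n" "z \<in> F" "x = wmap w z"
proof -
  have "\<exists>w\<in>words N n. \<exists>z\<in>F. x = wmap w z" using assms
  proof (induction n arbitrary: x)
    case 0
    thus ?case by (intro bexI[of _ "[]"] bexI[of _ x]) (auto simp: words_def)
  next
    case (Suc n)
    obtain i y where iy: "i \<in> {1..N}" "y \<in> F" "x = \<phi> i y" using F_cases[OF Suc.prems] by blast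
    obtain w z where "w \<in> words N n" "z \<in> F" "y = wmap w z" using Suc.IH[OF iy(2)] by blast
    thus ?case using iy by (intro bexI[of _ "i # w"] bexI[of _ z]) (auto simp: words_def)
  qed
  thus ?thesis using that by blast
qed

lemma F_eq_UN_words: "F = (\<Union>w\<in>words N n. wmap w ` F)"
proof
  show "F \<subseteq> (\<Union>w\<in>words N n. wmap w ` F)"
  proof
    fix x assume "x \<in> F"
    then obtain w z where "w \<in> words N n" "z \<in> F" "x = wmap w z" by (rule F_cases_word)
    thus "x \<in> (\<Union>w\<in>words N n. wmap w ` F)" by (intro UN_I[of w] image_eqI[of _ _ z])
  qed
  show "(\<Union>w\<in>words N n. wmap w ` F) \<subseteq> F"
  proof (intro UN_least image_subsetI)
    fix w x assume "w \<in> words N n" "x \<in> F"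
    thus "wmap w x \<in> F" by (intro word_map_in_F) (simp add: words_def)
  qed
qed

text \<open>Appending a letter to a word keeps at least this fraction of its norm; the division by
  \<open>C\<close> pays for \<open>wnorm_append_ge\<close>.\<close>

definition \<kappa> :: real where "\<kappa> = Min ((\<lambda>i. wnorm [i]) ` {1..N}) / C"

lemma kappa: "0 < \<kappa>" "\<kappa> \<le> 1"
  and kappa_le: "u \<in> Words \<Longrightarrow> i \<in> {1..N} \<Longrightarrow> \<kappa> * wnorm u \<le> wnorm (u @ [i])"
proof -
  let ?m = "Min ((\<lambda>i. wnorm [i]) ` {1..N})"
  have ne: "(\<lambda>i. wnorm [i]) ` {1..N} \<noteq> {}" using N_ge_2 by auto
  have "?m \<in> (\<lambda>i. wnorm [i]) ` {1..N}" using ne by (intro Min_in) auto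
  then obtain j where j: "j \<in> {1..N}" "?m = wnorm [j]" by blast
  have m: "0 < ?m" "?m \<le> 1"
    unfolding j(2) using j(1) by (auto intro!: wnorm_pos wnorm_le_1)
  show "0 < \<kappa>" using m C_ge_1 by (simp add: \<kappa>_def)
  show "\<kappa> \<le> 1" using m C_ge_1 by (simp add: \<kappa>_def divide_le_eq)
  show "\<kappa> * wnorm u \<le> wnorm (u @ [i])" if u: "u \<in> Words" and i: "i \<in> {1..N}"
  proof -
    have "?m \<le> wnorm [i]" using i by (intro Min_le) auto
    hence "?m * wnorm u \<le> wnorm [i] * wnorm u" using wnorm_pos[OF u] by (intro mult_right_mono) auto
    also have "\<dots> \<le> C * wnorm (u @ [i])"
      using wnorm_append_ge[OF u, of "[i]"] i by (simp add: mult.commute)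
    finally show ?thesis using C_ge_1 by (simp add: \<kappa>_def divide_le_eq mult.commute)
  qed
qed

text \<open>A coding of \<open>z0\<close> is read letter by letter until the norm first drops to
  \<open>x\<close> or below; one letter cannot overshoot below \<open>\<kappa> * x\<close>. The
  proof is by contradiction: without such a stopping time there would be words of every length with
  norm above \<open>x\<close>, against \<open>wnorm_le_power\<close>.\<close>

lemma stopping:
  assumes z0: "z0 \<in> F" and x: "0 < x" "x \<le> 1"
  obtains u z where "u \<in> Words" "z \<in> F" "z0 = wmap u z" "\<kappa> * x \<le> wnorm u" "wnorm u \<le> x"
proof (rule ccontr)
  assume "\<not> thesis"
  hence no: False if "u \<in> Words" "z \<in> F" "z0 = wmap u z" "\<kappa> * x \<le> wnorm u" "wnorm u \<le> x" for u z
    using \<open>\<And>u z. \<lbrakk>u \<in> Words; z \<in> F; z0 = wmap u z; \<kappa> * x \<le> wnorm u; wnorm u \<le> x\<rbrakk> \<Longrightarrow> thesis\<close> that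
    by blast
  have "\<exists>u\<in>words N n. \<exists>z\<in>F. z0 = wmap u z \<and> wnorm u > x" for n
  proof (induction n)
    case 0
    have "\<kappa> * x \<le> 1" using kappa x by (intro mult_le_one) auto
    hence "x \<noteq> 1" using no[of "[]" z0] z0 by auto
    hence "x < 1" using x by simp
    thus ?case using z0 by (intro bexI[of _ "[]"] bexI[of _ z0]) (auto simp: words_def)
  next
    case (Suc n)
    then obtain u z where u: "u \<in> Words" "length u = n" "z \<in> F" "z0 = wmap u z" "wnorm u > x"
      by (auto simp: words_def)
    obtain i y where iy: "i \<in> {1..N}" "y \<in> F" "z = \<phi> i y" using F_cases[OF u(3)] by blast
    have ui: "u @ [i] \<in> Words" "z0 = wmap (u @ [i]) y" using u iy by auto
    have "\<kappa> * x \<le> \<kappa> * wnorm u" using kappa u(5) by (intro mult_left_mono) auto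
    hence "\<kappa> * x \<le> wnorm (u @ [i])" using kappa_le[OF u(1) iy(1)] by linarith
    hence "\<not> wnorm (u @ [i]) \<le> x" using no[OF ui(1) iy(2) ui(2)] by blast
    hence "wnorm (u @ [i]) > x" by simp
    thus ?case using ui iy u by (intro bexI[of _ "u @ [i]"] bexI[of _ y]) (auto simp: words_def)
  qed
  moreover obtain n where n: "\<rho> ^ n < x" using real_arch_pow_inv[OF x(1) rho(2)] by blast
  ultimately obtain u where u: "u \<in> words N n" "wnorm u > x" by blast
  hence "wnorm u \<le> \<rho> ^ n" using wnorm_le_power[of u] by (auto simp: words_def)
  thus False using u n by linarith
qed

lemma small_word:
  assumes "z0 \<in> F" "0 < e"
  obtains u z where "u \<in> Words" "z \<in> F" "z0 = wmap u z" "wnorm u \<le> e"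
proof -
  have "0 < min e 1" "min e 1 \<le> 1" using assms(2) by auto
  then obtain u z where u: "u \<in> Words" "z \<in> F" "z0 = wmap u z" "wnorm u \<le> min e 1"
    by (rule stopping[OF assms(1)])
  show ?thesis by (rule that[OF u(1-3)]) (use u(4) in simp)
qed

section \<open>Pressure\<close>

definition psum :: "nat \<Rightarrow> real \<Rightarrow> real" where
  "psum n t = (\<Sum>w\<in>words N n. wnorm w powr t)"

lemma words_lists: "w \<in> words N n \<Longrightarrow> w \<in> Words" "w \<in> words N n \<Longrightarrow> length w = n"
  by (auto simp: words_def)

lemma words_nonempty: "words N n \<noteq> {}"
proof -
  have "replicate n 1 \<in> words N n" using N_ge_2 by (auto simp: words_def)
  thus ?thesis by blast
qed

lemma psum_pos: "psum n t > 0"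
  unfolding psum_def
proof (rule sum_pos)
  fix w assume "w \<in> words N n"
  hence "wnorm w > 0" using wnorm_pos words_lists by blast
  thus "0 < wnorm w powr t" by simp
qed (use words_nonempty in auto)

lemma psum_add_le: "t \<ge> 0 \<Longrightarrow> psum (m + n) t \<le> psum m t * psum n t"
  unfolding psum_def sum_words_add sum_product
proof (intro sum_mono)
  fix v w assume "v \<in> words N m" "w \<in> words N n" "t \<ge> 0"
  thus "wnorm (v @ w) powr t \<le> wnorm v powr t * wnorm w powr t"
    using words_lists by (intro wnorm_powr_append_le) auto
qed

lemma psum_add_ge: "t \<ge> 0 \<Longrightarrow> psum m t * psum n t \<le> C powr t * psum (m + n) t"
  unfolding psum_def sum_words_add sum_product
  unfolding sum_distrib_left
proof (intro sum_mono)
  fix v w assume "v \<in> words N m" "w \<in> words N n" "t \<ge> 0"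
  thus "wnorm v powr t * wnorm w powr t \<le> C powr t * wnorm (v @ w) powr t"
    using words_lists by (intro wnorm_powr_append_ge) auto
qed

definition logsum :: "nat \<Rightarrow> real \<Rightarrow> real" where "logsum n t = ln (psum n t)"

text \<open>Distortion makes the sums submultiplicative, and supermultiplicative up to
  \<open>C powr t\<close>. The error is independent of the lengths, so more is gained than from
  Fekete's lemma: a rate of convergence.\<close>

lemma logsum_add:
  assumes "t \<ge> 0"
  shows "\<bar>logsum (m + n) t - logsum m t - logsum n t\<bar> \<le> t * ln C"
proof -
  have "logsum (m + n) t \<le> ln (psum m t * psum n t)"
    unfolding logsum_def using psum_add_le[OF assms] psum_pos by (intro ln_mono) auto
  moreover have "ln (psum m t * psum n t) \<le> ln (C powr t * psum (m + n) t)"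
    using psum_add_ge[OF assms] psum_pos C_ge_1 by (intro ln_mono) (auto simp: less_imp_le)
  moreover have "0 \<le> t * ln C" using assms C_ge_1 by simp
  moreover have "ln (psum m t * psum n t) = logsum m t + logsum n t"
    using psum_pos[of m t] psum_pos[of n t] by (simp add: logsum_def ln_mult)
  moreover have "ln (C powr t * psum (m + n) t) = t * ln C + logsum (m + n) t"
    using psum_pos[of "m + n" t] C_ge_1 by (simp add: logsum_def ln_mult ln_powr)
  ultimately show ?thesis by linarith
qed

lemma logsum_mult:
  assumes "t \<ge> 0"
  shows "\<bar>logsum (Suc k * m) t - Suc k * logsum m t\<bar> \<le> k * (t * ln C)"
proof (induction k)
  case (Suc k)
  have "\<bar>logsum (m + Suc k * m) t - logsum m t - logsum (Suc k * m) t\<bar> \<le> t * ln C"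
    by (rule logsum_add[OF assms])
  thus ?case using Suc by (simp add: algebra_simps abs_le_iff)
qed simp

text \<open>Both averages are compared with the average at length \<open>m * n\<close>.\<close>

lemma logsum_diff:
  assumes t: "t \<ge> 0" and mn: "m > 0" "n > 0"
  shows "\<bar>logsum n t / n - logsum m t / m\<bar> \<le> t * ln C / n + t * ln C / m"
proof -
  have *: "\<bar>logsum (m * n) t / (m * n) - logsum n t / n\<bar> \<le> t * ln C / n"
    if mn: "m > 0" "n > 0" for m n :: nat
  proof -
    obtain k where k: "m = Suc k" using mn(1) gr0_implies_Suc by blast
    have "0 \<le> t * ln C" using t C_ge_1 by simp
    hence "k * (t * ln C) \<le> m * (t * ln C)" using k by (intro mult_right_mono) auto
    hence "\<bar>logsum (m * n) t - m * logsum n t\<bar> \<le> m * (t * ln C)"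
      using logsum_mult[OF t, of k n] k by simp
    hence "\<bar>logsum (m * n) t - m * logsum n t\<bar> / (m * n) \<le> m * (t * ln C) / (m * n)"
      by (intro divide_right_mono) auto
    moreover have "\<bar>logsum (m * n) t - m * logsum n t\<bar> / (m * n) = \<bar>logsum (m * n) t / (m * n) - logsum n t / n\<bar>"
    proof -
      have "logsum (m * n) t / (m * n) - logsum n t / n = (logsum (m * n) t - m * logsum n t) / (m * n)"
        using mn by (simp add: field_simps)
      thus ?thesis by simp
    qed
    ultimately show ?thesis using mn by simp
  qed
  show ?thesis using *[OF mn] *[OF mn(2,1)] by (simp add: mult.commute abs_le_iff)
qed

lemma pressure_limit:
  assumes t: "t \<ge> 0"
  shows "(\<lambda>n. logsum n t / n) \<longlonglongrightarrow> press t"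
proof -
  have "Cauchy (\<lambda>n. logsum n t / n)"
  proof (rule CauchyI)
    fix e :: real assume e: "e > 0"
    let ?c = "t * ln C"
    have c0: "0 \<le> ?c" using t C_ge_1 by simp
    obtain M :: nat where M: "2 * ?c / e < M" using reals_Archimedean2 by blast
    show "\<exists>M. \<forall>m\<ge>M. \<forall>n\<ge>M. norm (logsum m t / m - logsum n t / n) < e"
    proof (intro exI allI impI)
      fix m n assume mn: "m \<ge> Suc M" "n \<ge> Suc M"
      have small: "?c / k < e / 2" if "k \<ge> Suc M" for k :: nat
      proof -
        have "2 * ?c < e * M" using M e by (simp add: divide_less_eq mult.commute)
        also have "\<dots> \<le> e * k" using that e by (intro mult_left_mono) auto
        finally show ?thesis using that by (simp add: divide_less_eq)
      qed
      have "\<bar>logsum m t / m - logsum n t / n\<bar> \<le> ?c / m + ?c / n"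
        by (rule logsum_diff[OF t]) (use mn in auto)
      thus "norm (logsum m t / m - logsum n t / n) < e"
        using small[OF mn(1)] small[OF mn(2)] unfolding real_norm_def by linarith
    qed
  qed
  hence "convergent (\<lambda>n. logsum n t / n)" by (simp add: Cauchy_convergent_iff)
  moreover have "press t = lim (\<lambda>n. logsum n t / n)"
    unfolding pressure_def logsum_def psum_def wnorm_def by simp
  ultimately show ?thesis by (simp add: convergent_LIMSEQ_iff)
qed

text \<open>Let \<open>m\<close> tend to infinity in \<open>logsum_diff\<close>. As the error does
  not grow with \<open>n\<close>, the sums at the zero of the pressure stay bounded above and away
  from 0, which \<open>psum_bounds\<close> records.\<close>

lemma logsum_pressure:
  assumes t: "t \<ge> 0"
  shows "\<bar>logsum n t - n * press t\<bar> \<le> t * ln C"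
proof (cases "n = 0")
  case True
  have "words N 0 = {[]}" by (auto simp: words_def)
  thus ?thesis using True t C_ge_1 by (simp add: logsum_def psum_def)
next
  case False
  have lim: "(\<lambda>m. t * ln C / n + t * ln C / m - \<bar>logsum n t / n - logsum m t / m\<bar>) \<longlonglongrightarrow>
      t * ln C / n + 0 - \<bar>logsum n t / n - press t\<bar>"
    by (intro tendsto_intros pressure_limit[OF t] lim_const_over_n)
  have "0 \<le> t * ln C / n + 0 - \<bar>logsum n t / n - press t\<bar>"
  proof (rule tendsto_lowerbound[OF lim])
    show "\<forall>\<^sub>F m in sequentially. 0 \<le> t * ln C / n + t * ln C / m - \<bar>logsum n t / n - logsum m t / m\<bar>"
      using eventually_gt_at_top[of "0::nat"]
    proof eventually_elim
      case (elim m)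
      thus ?case using logsum_diff[OF t elim, of n] False by simp
    qed
  qed simp
  hence "\<bar>logsum n t / n - press t\<bar> \<le> t * ln C / n" by simp
  hence "n * \<bar>logsum n t / n - press t\<bar> \<le> n * (t * ln C / n)" by (intro mult_left_mono) auto
  moreover have "n * \<bar>logsum n t / n - press t\<bar> = \<bar>n * (logsum n t / n - press t)\<bar>"
    by (simp add: abs_mult)
  ultimately show ?thesis using False by (simp add: algebra_simps)
qed

lemma psum_bounds:
  assumes t: "t \<ge> 0" and 0: "press t = 0"
  shows "psum n t \<le> C powr t" "1 \<le> C powr t * psum n t"
proof -
  have "logsum n t \<le> t * ln C" "- (t * ln C) \<le> logsum n t" using logsum_pressure[OF t, of n] 0 by auto
  moreover have "psum n t = exp (logsum n t)" using psum_pos by (simp add: logsum_def)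
  moreover have "C powr t = exp (t * ln C)" using C_ge_1 by (simp add: powr_def)
  ultimately show "psum n t \<le> C powr t" "1 \<le> C powr t * psum n t"
    by (simp_all add: exp_add[symmetric])
qed

lemma wnorm_ge_power:
  assumes "w \<in> Words"
  shows "\<kappa> ^ length w \<le> wnorm w"
  using assms
proof (induction w rule: rev_induct)
  case (snoc i w)
  hence i: "i \<in> {1..N}" and w: "w \<in> Words" by auto
  have "\<kappa> * \<kappa> ^ length w \<le> \<kappa> * wnorm w" using snoc.IH[OF w] kappa by (intro mult_left_mono) auto
  thus ?case using kappa_le[OF w i] by simp
qed simp

text \<open>Norms of words of length \<open>n\<close> lie between \<open>\<kappa> ^ n\<close> and
  \<open>\<rho> ^ n\<close>, so raising the exponent changes every term by a controlled
  factor.\<close>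

lemma logsum_shift:
  assumes "0 \<le> t" "t \<le> u"
  shows "logsum n u \<le> logsum n t + n * ((u - t) * ln \<rho>)" "logsum n t + n * ((u - t) * ln \<kappa>) \<le> logsum n u"
proof -
  have *: "wnorm w powr u = wnorm w powr t * wnorm w powr (u - t)" for w by (simp add: powr_add[symmetric])
  have "psum n u \<le> psum n t * (\<rho> ^ n) powr (u - t)"
    unfolding psum_def sum_distrib_right *
  proof (intro sum_mono mult_left_mono powr_mono2)
    fix w assume "w \<in> words N n"
    hence w: "w \<in> Words" "length w = n" using words_lists by auto
    show "wnorm w \<le> \<rho> ^ n" using wnorm_le_power[OF w(1)] w(2) by simp
    show "0 \<le> wnorm w" using wnorm_pos[OF w(1)] by simp
  qed (use assms in auto)
  hence "logsum n u \<le> ln (psum n t * (\<rho> ^ n) powr (u - t))"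
    unfolding logsum_def using psum_pos by (intro ln_mono) auto
  thus "logsum n u \<le> logsum n t + n * ((u - t) * ln \<rho>)"
    using psum_pos[of n t] rho(1) by (simp add: ln_mult logsum_def ln_powr ln_realpow mult.left_commute)
  have "psum n t * (\<kappa> ^ n) powr (u - t) \<le> psum n u"
    unfolding psum_def sum_distrib_right *
  proof (intro sum_mono mult_left_mono powr_mono2)
    fix w assume "w \<in> words N n"
    hence w: "w \<in> Words" "length w = n" using words_lists by auto
    show "\<kappa> ^ n \<le> wnorm w" using wnorm_ge_power[OF w(1)] w(2) by simp
    show "0 \<le> \<kappa> ^ n" using kappa by simp
  qed (use assms in auto)
  hence "ln (psum n t * (\<kappa> ^ n) powr (u - t)) \<le> logsum n u"
    unfolding logsum_def using psum_pos[of n t] kappa by (intro ln_mono) auto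
  thus "logsum n t + n * ((u - t) * ln \<kappa>) \<le> logsum n u"
    using psum_pos[of n t] kappa(1) by (simp add: ln_mult logsum_def ln_powr ln_realpow mult.left_commute)
qed

lemma pressure_shift:
  assumes tu: "0 \<le> t" "t \<le> u"
  shows "press u \<le> press t + (u - t) * ln \<rho>"
    "press t + (u - t) * ln \<kappa> \<le> press u"
proof -
  have u: "0 \<le> u" using tu by simp
  show "press u \<le> press t + (u - t) * ln \<rho>"
  proof (rule tendsto_le[OF _ _ pressure_limit[OF u]])
    show "(\<lambda>n. logsum n t / n + (u - t) * ln \<rho>) \<longlonglongrightarrow> press t + (u - t) * ln \<rho>"
      by (intro tendsto_intros pressure_limit[OF tu(1)])
    show "\<forall>\<^sub>F n in sequentially. logsum n u / n \<le> logsum n t / n + (u - t) * ln \<rho>"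
      using eventually_gt_at_top[of "0::nat"]
    proof eventually_elim
      case (elim n)
      have "logsum n u / n \<le> (logsum n t + n * ((u - t) * ln \<rho>)) / n"
        using logsum_shift(1)[OF tu, of n] by (rule divide_right_mono) simp
      thus ?case using elim by (simp add: add_divide_distrib)
    qed
  qed simp
  show "press t + (u - t) * ln \<kappa> \<le> press u"
  proof (rule tendsto_le[OF _ pressure_limit[OF u]])
    show "(\<lambda>n. logsum n t / n + (u - t) * ln \<kappa>) \<longlonglongrightarrow> press t + (u - t) * ln \<kappa>"
      by (intro tendsto_intros pressure_limit[OF tu(1)])
    show "\<forall>\<^sub>F n in sequentially. logsum n t / n + (u - t) * ln \<kappa> \<le> logsum n u / n"
      using eventually_gt_at_top[of "0::nat"]
    proof eventually_elim
      case (elim n)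
      have "(logsum n t + n * ((u - t) * ln \<kappa>)) / n \<le> logsum n u / n"
        using logsum_shift(2)[OF tu, of n] by (rule divide_right_mono) simp
      thus ?case using elim by (simp add: add_divide_distrib)
    qed
  qed simp
qed

lemma ln_rho_neg: "ln \<rho> < 0" using rho by simp

lemma pressure_strict_decreasing:
  assumes "0 \<le> t" "t < u"
  shows "press u < press t"
  using pressure_shift(1)[of t u] assms mult_pos_neg[of "u - t" "ln \<rho>"] ln_rho_neg by simp

lemma card_words: "card (words N n) = N ^ n"
  using card_lists_length_eq[of "{1..N}" n] by (simp add: words_def lists_eq_set conj_commute)

lemma pressure_0: "press 0 = ln N"
proof -
  have "psum n 0 = real N ^ n" for n
  proof -
    have "psum n 0 = (\<Sum>w\<in>words N n. 1)"
      unfolding psum_def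
    proof (rule sum.cong)
      fix w assume "w \<in> words N n"
      hence "wnorm w > 0" using wnorm_pos words_lists by blast
      thus "wnorm w powr 0 = 1" by simp
    qed simp
    thus ?thesis by (simp add: card_words)
  qed
  hence eq: "logsum n 0 = n * ln N" for n using N_ge_2 by (simp add: logsum_def ln_realpow)
  have "(\<lambda>n. logsum n 0 / n) \<longlonglongrightarrow> ln N"
    by (rule tendsto_eventually) (use eventually_gt_at_top[of "0::nat"] in \<open>eventually_elim, simp add: eq\<close>)
  thus ?thesis using pressure_limit[of 0] LIMSEQ_unique by blast
qed

lemma pressure_continuous: "continuous_on {0..b} press"
proof (rule lipschitz_on_continuous_on)
  let ?P = press
  have k: "ln \<kappa> \<le> 0" using kappa by simp
  have *: "\<bar>?P u - ?P t\<bar> \<le> - ln \<kappa> * \<bar>u - t\<bar>" if "0 \<le> t" "t \<le> u" for t u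
  proof -
    have "?P u \<le> ?P t" using pressure_strict_decreasing[of t u] that by (cases "t = u") auto
    thus ?thesis using pressure_shift(2)[OF that] that by (simp add: algebra_simps)
  qed
  show "(- ln \<kappa>)-lipschitz_on {0..b} ?P"
  proof (rule lipschitz_onI)
    fix t u assume "t \<in> {0..b}" "u \<in> {0..b}"
    thus "dist (?P t) (?P u) \<le> - ln \<kappa> * dist t u"
      using *[of t u] *[of u t] by (cases "t \<le> u") (auto simp: dist_real_def abs_minus_commute)
  qed (use k in simp)
qed

lemma pressure_zero:
  shows "0 < pzero" "press pzero = 0"
proof -
  let ?P = press
  have N: "0 < ln (real N)" using N_ge_2 by simp
  \<comment> \<open>The line \<open>ln N + b * ln \<rho>\<close>, an upper bound for the pressure at
    \<open>b\<close>, vanishes here.\<close>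
  define b where "b = - ln N / ln \<rho>"
  have b: "0 \<le> b" using N ln_rho_neg by (simp add: b_def divide_le_0_iff less_imp_le)
  have "?P b \<le> ln N + (b - 0) * ln \<rho>" using pressure_shift(1)[of 0 b] b pressure_0 by simp
  hence "?P b \<le> 0" using ln_rho_neg by (simp add: b_def)
  then obtain t where t: "0 \<le> t" "?P t = 0"
    using IVT2'[of ?P b 0 0] b pressure_continuous pressure_0 N by auto
  have "pzero = t"
    unfolding pressure_zero_def
  proof (rule the_equality)
    show "0 \<le> t \<and> ?P t = 0" using t by simp
    fix u assume "0 \<le> u \<and> ?P u = 0"
    thus "u = t" using pressure_strict_decreasing[of t u] pressure_strict_decreasing[of u t] t by (metis less_irrefl linorder_neqE)
  qed
  moreover have "t \<noteq> 0" using t N pressure_0 by auto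
  ultimately show "0 < pzero" "?P pzero = 0" using t by auto
qed

section \<open>Upper bound for the dimension\<close>

lemma bounded_word_image: "w \<in> Words \<Longrightarrow> A \<subseteq> \<Omega> \<Longrightarrow> bounded (wmap w ` A)"
  using word_map_in_Omega Omega(2) by (metis bounded_subset image_subsetI subsetD)

lemma hcontent_word_image:
  assumes "t > 0" "w \<in> Words" "A \<subseteq> \<Omega>"
  shows "hcontent t (wmap w ` A) \<le> wnorm w powr t * hcontent t A"
proof (rule hcontent_image[OF assms(1) wnorm_pos[OF assms(2)]])
  show "bounded A" using assms(3) Omega(2) bounded_subset by blast
  fix x y assume "x \<in> A" "y \<in> A"
  thus "dist (wmap w x) (wmap w y) \<le> wnorm w * dist x y"
    unfolding dist_real_def using assms(3) by (intro word_map_lipschitz[OF assms(2)]) auto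
qed

lemma bounded_F: "bounded F" using ifs(3) compact_imp_bounded by blast

text \<open>For \<open>t\<close> above the zero some \<open>psum n t\<close> is below 1. The cover
  by words of length \<open>n\<close> then bounds the finite number \<open>hcontent t F\<close> by a
  proper fraction of itself, so it vanishes.\<close>

lemma dim_le_pressure_zero: "hausdorff_dim F \<le> ereal pzero"
proof (rule ereal_le_epsilon2)
  fix e :: real assume e: "e > 0"
  let ?p = pzero and ?P = press
  define t where "t = ?p + e"
  have t: "0 < t" using pressure_zero e by (simp add: t_def)
  have neg: "?P t < 0" using pressure_strict_decreasing[of ?p t] pressure_zero e by (simp add: t_def)
  \<comment> \<open>Long enough for the negative drift \<open>n * ?P t\<close> to beat the error
    \<open>t * ln C\<close> of \<open>logsum_pressure\<close>.\<close>
  obtain n :: nat where n: "t * ln C / - ?P t < n" using reals_Archimedean2 by blast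
  hence "t * ln C < n * - ?P t" using neg by (subst (asm) pos_divide_less_eq) auto
  hence "logsum n t < 0" using logsum_pressure[of t n] t by (simp add: abs_le_iff)
  hence lt: "psum n t < 1" using psum_pos by (simp add: logsum_def)
  have "hcontent t F \<le> (\<Sum>w\<in>words N n. hcontent t (wmap w ` F))"
    by (subst F_eq_UN_words[of n])
       (use words_lists ifs(4) in \<open>auto intro!: hcontent_UN_finite bounded_word_image\<close>)
  also have "\<dots> \<le> (\<Sum>w\<in>words N n. wnorm w powr t * hcontent t F)"
    by (intro sum_mono hcontent_word_image t ifs(4)) (use words_lists in auto)
  also have "\<dots> = psum n t * hcontent t F" by (simp add: psum_def sum_distrib_right)
  finally have "hcontent t F * (1 - psum n t) \<le> 0" by (simp add: algebra_simps)
  hence "hcontent t F = 0" using lt hcontent_nonneg[of t F] by (simp add: mult_le_0_iff)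
  hence "hausdorff_content t F = 0" using ennreal_hcontent[OF bounded_F, of t] by simp
  hence "hausdorff_dim F \<le> ereal t" using t by (rule hausdorff_dim_le[rotated])
  thus "hausdorff_dim F \<le> ereal ?p + ereal e" by (simp add: t_def)
qed

lemma wnorm_lt_1:
  assumes "u \<in> Words" "u \<noteq> []"
  shows "wnorm u < 1"
proof -
  have "\<rho> ^ length u \<le> \<rho> ^ 1"
    by (rule power_decreasing) (use rho assms(2) in \<open>auto simp: Suc_le_eq One_nat_def\<close>)
  hence "\<rho> ^ length u < 1" using rho by simp
  thus ?thesis using wnorm_le_power[OF assms(1)] by linarith
qed

section \<open>Exact overlaps lower the dimension\<close>

text \<open>The words \<open>v @ w\<close> and \<open>w @ v\<close> have equal length and the same
  map on \<open>F\<close>. If they coincided, one of \<open>v\<close>, \<open>w\<close> would be a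
  prefix of the other and the remaining word would fix \<open>F\<close> pointwise, which a strict
  contraction cannot do once \<open>F\<close> has two points. On a one-point \<open>F\<close> two
  single letters serve.\<close>

lemma exact_overlap_same_length:
  assumes "has_exact_overlap N \<phi> F"
  obtains n v w where "v \<in> words N n" "w \<in> words N n" "v \<noteq> w" "\<And>x. x \<in> F \<Longrightarrow> wmap v x = wmap w x"
proof (cases "\<exists>x y. x \<in> F \<and> y \<in> F \<and> x \<noteq> y")
  case False
  have "\<phi> 1 x = \<phi> 2 x" if "x \<in> F" for x
    using False map_in_F[of 1 x] map_in_F[of 2 x] that N_ge_2 by auto
  thus ?thesis using N_ge_2 by (intro that[of "[1]" 1 "[2]"]) (auto simp: words_def)
next
  case True
  then obtain x y where xy: "x \<in> F" "y \<in> F" "x \<noteq> y" by blast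
  obtain v w where vw: "v \<in> Words" "w \<in> Words" "v \<noteq> w"
    "\<And>x. x \<in> F \<Longrightarrow> wmap v x = wmap w x"
    using assms unfolding has_exact_overlap_def by blast
  have no_prefix: False if u: "v @ u = w" and v: "v \<in> Words" and w: "w \<in> Words" and ne: "v \<noteq> w"
      and eq: "\<And>x. x \<in> F \<Longrightarrow> wmap v x = wmap w x" for v w u
  proof -
    have u': "u \<in> Words" "u \<noteq> []" using u w ne by auto
    have fixed: "wmap u x = x" if x: "x \<in> F" for x
    proof (rule inj_onD[OF word_map_inj[OF v]])
      show "wmap v (wmap u x) = wmap v x" using eq[OF x] u by auto
      show "wmap u x \<in> {lo..hi}" "x \<in> {lo..hi}"
        using x word_map_in_F[OF u'(1) x] F_interval by auto
    qed
    have "\<bar>x - y\<bar> \<le> wnorm u * \<bar>x - y\<bar>"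
      using word_map_lipschitz[OF u'(1), of x y] fixed xy ifs(4) by auto
    moreover have "wnorm u * \<bar>x - y\<bar> < 1 * \<bar>x - y\<bar>"
      using wnorm_lt_1[OF u'] xy(3) by (intro mult_strict_right_mono) auto
    ultimately show False by simp
  qed
  have "v @ w \<noteq> w @ v"
  proof
    assume "v @ w = w @ v"
    then obtain us where "v = w @ us \<or> v @ us = w" unfolding append_eq_append_conv2 by blast
    thus False using no_prefix[of v us w] no_prefix[of w us v] vw by metis
  qed
  moreover have "wmap (v @ w) x = wmap (w @ v) x" if "x \<in> F" for x
    using vw that word_map_in_F by auto
  ultimately show ?thesis using vw by (intro that[of "v @ w" "length v + length w" "w @ v"]) (auto simp: words_def)
qed

text \<open>\<open>cyl_mass t u\<close> plays the role of a conformal measure of the cylinder \<open>u\<close>: it is superadditive along the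
  tree of words and, at the zero of the pressure, comparable with \<open>wnorm u powr t\<close>.\<close>
definition cyl_mass :: "real \<Rightarrow> nat list \<Rightarrow> real" where
  "cyl_mass t u = enn2real (liminf (\<lambda>m. ennreal (\<Sum>x\<in>words N m. wnorm (u @ x) powr t)))"

lemma cyl_sum_bounds:
  assumes t: "t > 0" and 0: "press t = 0" and u: "u \<in> Words"
  shows "(\<Sum>x\<in>words N m. wnorm (u @ x) powr t) \<le> C powr t * wnorm u powr t"
    "wnorm u powr t \<le> C powr t * C powr t * (\<Sum>x\<in>words N m. wnorm (u @ x) powr t)"
proof -
  have "(\<Sum>x\<in>words N m. wnorm (u @ x) powr t) \<le> (\<Sum>x\<in>words N m. wnorm u powr t * wnorm x powr t)"
  proof (rule sum_mono)
    fix x assume "x \<in> words N m"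
    hence x: "x \<in> Words" by (rule words_lists)
    show "wnorm (u @ x) powr t \<le> wnorm u powr t * wnorm x powr t"
      by (rule wnorm_powr_append_le[OF u x less_imp_le[OF t]])
  qed
  also have "\<dots> = wnorm u powr t * psum m t" by (simp add: psum_def sum_distrib_left)
  also have "\<dots> \<le> wnorm u powr t * C powr t"
    using psum_bounds(1)[OF less_imp_le[OF t] 0, of m] by (intro mult_left_mono) auto
  finally show "(\<Sum>x\<in>words N m. wnorm (u @ x) powr t) \<le> C powr t * wnorm u powr t" by (simp add: mult.commute)
  have "wnorm u powr t * psum m t = (\<Sum>x\<in>words N m. wnorm u powr t * wnorm x powr t)"
    by (simp add: psum_def sum_distrib_left)
  also have "\<dots> \<le> (\<Sum>x\<in>words N m. C powr t * wnorm (u @ x) powr t)"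
  proof (rule sum_mono)
    fix x assume "x \<in> words N m"
    hence x: "x \<in> Words" by (rule words_lists)
    show "wnorm u powr t * wnorm x powr t \<le> C powr t * wnorm (u @ x) powr t"
      by (rule wnorm_powr_append_ge[OF u x less_imp_le[OF t]])
  qed
  also have "\<dots> = C powr t * (\<Sum>x\<in>words N m. wnorm (u @ x) powr t)" by (simp add: sum_distrib_left)
  finally have *: "wnorm u powr t * psum m t \<le> C powr t * (\<Sum>x\<in>words N m. wnorm (u @ x) powr t)" .
  have "wnorm u powr t * 1 \<le> wnorm u powr t * (C powr t * psum m t)"
    using psum_bounds(2)[OF less_imp_le[OF t] 0, of m] by (intro mult_left_mono) auto
  also have "\<dots> = C powr t * (wnorm u powr t * psum m t)" by simp
  also have "\<dots> \<le> C powr t * (C powr t * (\<Sum>x\<in>words N m. wnorm (u @ x) powr t))"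
    by (rule mult_left_mono[OF *]) simp
  finally show "wnorm u powr t \<le> C powr t * C powr t * (\<Sum>x\<in>words N m. wnorm (u @ x) powr t)"
    by (simp add: mult.assoc)
qed

lemma cyl_mass_bounds:
  assumes t: "t > 0" and 0: "press t = 0" and u: "u \<in> Words"
  shows "ennreal (cyl_mass t u) = liminf (\<lambda>m. ennreal (\<Sum>x\<in>words N m. wnorm (u @ x) powr t))" (is ?A)
    "cyl_mass t u \<le> C powr t * wnorm u powr t" (is ?B)
    "wnorm u powr t \<le> C powr t * C powr t * cyl_mass t u" (is ?D)
proof -
  let ?f = "\<lambda>m. (\<Sum>x\<in>words N m. wnorm (u @ x) powr t)"
  let ?K = "C powr t * C powr t"
  have K: "?K > 0" using C_ge_1 by simp
  have up: "liminf (\<lambda>m. ennreal (?f m)) \<le> ennreal (C powr t * wnorm u powr t)"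
  proof -
    have "liminf (\<lambda>m. ennreal (?f m)) \<le> liminf (\<lambda>m::nat. ennreal (C powr t * wnorm u powr t))"
      by (intro Liminf_mono always_eventually allI ennreal_leI cyl_sum_bounds(1)[OF assms])
    thus ?thesis by (simp add: Liminf_const)
  qed
  have fin: "liminf (\<lambda>m. ennreal (?f m)) < top" using up by (rule le_less_trans) simp
  thus eq: ?A by (simp add: cyl_mass_def)
  show ?B using up unfolding eq[symmetric] by (simp add: ennreal_le_iff)
  have "ennreal (wnorm u powr t / ?K) \<le> liminf (\<lambda>m. ennreal (?f m))"
  proof (rule Liminf_bounded, intro always_eventually allI ennreal_leI)
    fix m show "wnorm u powr t / ?K \<le> ?f m"
      using cyl_sum_bounds(2)[OF assms, of m] K by (simp add: pos_divide_le_eq mult_ac)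
  qed
  hence "wnorm u powr t / ?K \<le> cyl_mass t u"
    unfolding eq[symmetric] by (subst (asm) ennreal_le_iff) (auto simp: cyl_mass_def)
  thus ?D using K by (simp add: pos_divide_le_eq mult_ac)
qed

text \<open>Words of length \<open>m + n\<close> below \<open>u\<close> split into those below the
  words \<open>u @ x\<close>, and a finite sum of liminfs is at most the liminf of the sums: Fatou's
  lemma for the counting measure.\<close>

lemma cyl_mass_superadditive:
  assumes t: "t > 0" and 0: "press t = 0" and u: "u \<in> Words"
  shows "(\<Sum>x\<in>words N n. cyl_mass t (u @ x)) \<le> cyl_mass t u"
proof -
  let ?f = "\<lambda>u m. (\<Sum>x\<in>words N m. wnorm (u @ x) powr t)"
  have ux: "u @ x \<in> Words" if "x \<in> words N n" for x using u words_lists(1)[OF that] by simp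
  have "ennreal (\<Sum>x\<in>words N n. cyl_mass t (u @ x)) = (\<Sum>x\<in>words N n. ennreal (cyl_mass t (u @ x)))"
    by (rule sum_ennreal[symmetric]) (simp add: cyl_mass_def)
  also have "\<dots> = (\<Sum>x\<in>words N n. liminf (\<lambda>m. ennreal (?f (u @ x) m)))"
    by (rule sum.cong) (use cyl_mass_bounds(1)[OF t 0 ux] in auto)
  also have "\<dots> = (\<integral>\<^sup>+x. liminf (\<lambda>m. ennreal (?f (u @ x) m)) \<partial>count_space (words N n))"
    by (simp add: nn_integral_count_space_finite)
  also have "\<dots> \<le> liminf (\<lambda>m. (\<integral>\<^sup>+x. ennreal (?f (u @ x) m) \<partial>count_space (words N n)))"
    by (rule nn_integral_liminf) simp
  also have "(\<lambda>m. (\<integral>\<^sup>+x. ennreal (?f (u @ x) m) \<partial>count_space (words N n))) = (\<lambda>m. ennreal (?f u (m + n)))"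
    by (simp add: nn_integral_count_space_finite sum_words_add add.commute[of _ n] sum_ennreal sum_nonneg)
  also have "liminf (\<lambda>m. ennreal (?f u (m + n))) = liminf (\<lambda>m. ennreal (?f u m))"
    by (rule liminf_shift_k)
  also have "\<dots> = ennreal (cyl_mass t u)" by (rule cyl_mass_bounds(1)[OF assms, symmetric])
  finally show ?thesis by (subst (asm) ennreal_le_iff) (auto simp: cyl_mass_def)
qed

text \<open>A bound \<open>c u <= M * cyl_mass t u\<close> for all \<open>u\<close> improves to one
  with \<open>(1 - q) * M\<close>: a cover of \<open>cyl u\<close> by its descendants of relative
  length \<open>n\<close> may omit \<open>u @ w\<close>, which carries at least the fraction
  \<open>q\<close> of the mass. Iteration drives the content to 0.\<close>

lemma overlap_content_zero:
  assumes t: "t > 0" and 0: "press t = 0"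
    and ov: "v \<in> words N n" "w \<in> words N n" "v \<noteq> w" "\<And>x. x \<in> F \<Longrightarrow> wmap v x = wmap w x"
  shows "hausdorff_content t F = 0"
proof -
  define c where "c u = hcontent t (wmap u ` F)" for u
  let ?b = "cyl_mass t" and ?W = "Words"
  let ?K = "C powr t * C powr t"
  have w: "w \<in> ?W" using words_lists ov by blast
  have K: "?K > 0" using C_ge_1 by simp
  have bpos: "?b u > 0" if "u \<in> ?W" for u
  proof -
    have "0 < wnorm u powr t" using wnorm_pos[OF that] by simp
    hence "0 < ?K * ?b u" using cyl_mass_bounds(3)[OF t 0 that] by linarith
    thus ?thesis using K by (simp add: zero_less_mult_iff)
  qed
  \<comment> \<open>Three losses: splitting off \<open>w\<close> costs the \<open>C\<close> in the
    numerator, and comparing \<open>cyl_mass\<close> with the norm from above and from below costs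
    \<open>C powr t\<close> and \<open>?K\<close>.\<close>
  define q where "q = (wnorm w / C) powr t / (?K * C powr t)"
  have q0: "q > 0" using wnorm_pos[OF w] C_ge_1 by (simp add: q_def)
  have qb: "q * ?b u \<le> ?b (u @ w)" if u: "u \<in> ?W" for u
  proof -
    have uw: "u @ w \<in> ?W" using u w by simp
    have 1: "wnorm u powr t * (wnorm w / C) powr t \<le> wnorm (u @ w) powr t"
      using wnorm_powr_append_ge[OF u w less_imp_le[OF t]] C_ge_1
      by (simp add: powr_divide pos_divide_le_eq mult.commute)
    have "q * ?b u \<le> q * (C powr t * wnorm u powr t)"
      using q0 cyl_mass_bounds(2)[OF t 0 u] by (intro mult_left_mono) auto
    also have "\<dots> = wnorm u powr t * (wnorm w / C) powr t / ?K"
      using C_ge_1 by (simp add: q_def)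
    also have "\<dots> \<le> wnorm (u @ w) powr t / ?K"
      using K 1 by (intro divide_right_mono) auto
    also have "\<dots> \<le> ?b (u @ w)"
      using cyl_mass_bounds(3)[OF t 0 uw] K by (simp add: pos_divide_le_eq mult.commute)
    finally show ?thesis .
  qed
  \<comment> \<open>Keeps the factor \<open>1 - q\<close> nonnegative throughout the
    iteration.\<close>
  have q1: "q \<le> 1"
  proof -
    have "?b w \<le> (\<Sum>x\<in>words N n. ?b ([] @ x))"
      using ov(2) by (simp, intro member_le_sum) (auto simp: cyl_mass_def)
    hence "?b w \<le> ?b []" using cyl_mass_superadditive[OF t 0, of "[]" n] by simp
    hence "q * ?b [] \<le> 1 * ?b []" using qb[of "[]"] by simp
    thus ?thesis using bpos[of "[]"] by simp
  qed
  have cover: "wmap u ` F = (\<Union>x\<in>words N n - {w}. wmap (u @ x) ` F)" for u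
  proof -
    have "F = (\<Union>x\<in>words N n. wmap x ` F)" by (rule F_eq_UN_words)
    also have "\<dots> = (\<Union>x\<in>words N n - {w}. wmap x ` F)"
    proof (rule UN_remove_dup[OF ov(1-3)])
      show "wmap v ` F = wmap w ` F" using ov(4) by (intro image_cong) auto
    qed
    finally have "wmap u ` F = wmap u ` (\<Union>x\<in>words N n - {w}. wmap x ` F)" by (rule arg_cong)
    thus ?thesis by (simp add: image_UN image_comp)
  qed
  have step: "c u \<le> (1 - q) * M * ?b u" if u: "u \<in> ?W" and M: "\<And>u. u \<in> ?W \<Longrightarrow> c u \<le> M * ?b u" "M \<ge> 0" for u M
  proof -
    have ux: "u @ x \<in> ?W" if "x \<in> words N n" for x using u words_lists(1)[OF that] by simp
    have "c u \<le> (\<Sum>x\<in>words N n - {w}. c (u @ x))"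
      unfolding c_def cover[of u]
    proof (rule hcontent_UN_finite)
      fix x assume "x \<in> words N n - {w}"
      hence "u @ x \<in> ?W" using ux by blast
      thus "bounded (wmap (u @ x) ` F)" using ifs(4) by (rule bounded_word_image)
    qed simp
    also have "\<dots> \<le> (\<Sum>x\<in>words N n - {w}. M * ?b (u @ x))"
      by (intro sum_mono M(1) ux) auto
    also have "\<dots> = M * ((\<Sum>x\<in>words N n. ?b (u @ x)) - ?b (u @ w))"
      using ov(2) by (simp add: sum_distrib_left[symmetric] sum_diff1)
    also have "\<dots> \<le> M * (?b u - q * ?b u)"
      using cyl_mass_superadditive[OF t 0 u, of n] qb[OF u] M(2) by (intro mult_left_mono) linarith+
    finally show ?thesis by (simp add: algebra_simps)
  qed
  define M where "M = ?K * hcontent t F"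
  have M0: "M \<ge> 0" using K by (simp add: M_def)
  have base: "c u \<le> M * ?b u" if u: "u \<in> ?W" for u
  proof -
    have "c u \<le> wnorm u powr t * hcontent t F"
      unfolding c_def by (rule hcontent_word_image[OF t u ifs(4)])
    also have "\<dots> \<le> (?K * ?b u) * hcontent t F"
      by (intro mult_right_mono cyl_mass_bounds(3)[OF t 0 u]) simp
    finally show ?thesis by (simp add: M_def mult_ac)
  qed
  have iter: "\<forall>u\<in>?W. c u \<le> (1 - q) ^ k * M * ?b u" for k
  proof (induction k)
    case (Suc k)
    show ?case
    proof
      fix u assume u: "u \<in> ?W"
      have "c u \<le> (1 - q) * ((1 - q) ^ k * M) * ?b u"
        by (rule step[OF u]) (use Suc q1 M0 in auto)
      thus "c u \<le> (1 - q) ^ Suc k * M * ?b u" by (simp add: mult_ac)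
    qed
  qed (use base in auto)
  have "(\<lambda>k. (1 - q) ^ k * M * ?b []) \<longlonglongrightarrow> 0 * M * ?b []"
    using q0 q1 by (intro tendsto_intros LIMSEQ_power_zero) auto
  hence "c [] \<le> 0 * M * ?b []"
    by (rule LIMSEQ_le_const) (use iter in auto)
  hence "hcontent t F = 0" using hcontent_nonneg[of t F] by (simp add: c_def)
  thus ?thesis using ennreal_hcontent[OF bounded_F, of t] by simp
qed

lemma overlap_imp_dim_neq:
  assumes "has_exact_overlap N \<phi> F" "hausdorff_measure s F > 0"
  shows "s \<noteq> pzero"
proof (rule exact_overlap_same_length[OF assms(1)])
  fix n v w
  assume ov: "v \<in> words N n" "w \<in> words N n" "v \<noteq> w" "\<And>x. x \<in> F \<Longrightarrow> wmap v x = wmap w x"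
  show ?thesis
  proof
    assume s: "s = pzero"
    have "hausdorff_content s F = 0" using overlap_content_zero[OF _ _ ov, of s] pressure_zero s by simp
    thus False using hausdorff_measure_eq_0[of s F] pressure_zero s assms(2) by auto
  qed
qed

end

section \<open>Packings by cylinders\<close>

context conformal_words
begin

definition cyl :: "nat list \<Rightarrow> real set" where "cyl w = wmap w ` F"

lemma cylI: "x \<in> F \<Longrightarrow> wmap w x \<in> cyl w"
  by (simp add: cyl_def)

lemma cyl_nonempty: "cyl w \<noteq> {}"
  using ifs(2) by (simp add: cyl_def)

lemma cyl_append: "cyl (u @ v) = wmap u ` cyl v"
  by (simp add: cyl_def image_comp)

lemma compact_cyl: "w \<in> Words \<Longrightarrow> compact (cyl w)"
  unfolding cyl_def using ifs(3,4) word_map_deriv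
  by (intro compact_continuous_image continuous_at_imp_continuous_on ballI) (meson DERIV_isCont subsetD)

lemma cyl_subset_F: "w \<in> Words \<Longrightarrow> cyl w \<subseteq> F"
  unfolding cyl_def using word_map_in_F by blast

lemma disjoint_cyl_gap:
  assumes "finite T" "T \<subseteq> Words"
    and disj: "\<And>v w. v \<in> T \<Longrightarrow> w \<in> T \<Longrightarrow> v \<noteq> w \<Longrightarrow> cyl v \<inter> cyl w = {}"
  obtains g where "g > 0"
    "\<forall>v\<in>T. \<forall>w\<in>T. v \<noteq> w \<longrightarrow> (\<forall>x\<in>cyl v. \<forall>y\<in>cyl w. g \<le> \<bar>x - y\<bar>)"
proof -
  define P where "P = {p \<in> T \<times> T. fst p \<noteq> snd p}"
  have "\<exists>d>0. \<forall>x\<in>cyl (fst p). \<forall>y\<in>cyl (snd p). d \<le> dist x y" if "p \<in> P" for p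
  proof -
    have "fst p \<in> T" "snd p \<in> T" "fst p \<noteq> snd p" using that by (auto simp: P_def)
    thus ?thesis using assms(2) disj
      by (intro separate_compact_closed compact_cyl compact_imp_closed[OF compact_cyl]) auto
  qed
  then obtain d where d: "\<And>p. p \<in> P \<Longrightarrow> d p > 0"
    "\<And>p x y. p \<in> P \<Longrightarrow> x \<in> cyl (fst p) \<Longrightarrow> y \<in> cyl (snd p) \<Longrightarrow> d p \<le> dist x y" by metis
  have fin: "finite P" using assms(1) by (simp add: P_def)
  define g where "g = Min (insert 1 (d ` P))"
  show ?thesis
  proof (rule that[of g]; (intro ballI impI)?)
    show "g > 0" using fin d(1) by (simp add: g_def)
    fix v w x y assume vw: "v \<in> T" "w \<in> T" "v \<noteq> w" and xy: "x \<in> cyl v" "y \<in> cyl w"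
    hence p: "(v, w) \<in> P" by (simp add: P_def)
    hence "g \<le> d (v, w)" unfolding g_def using fin by (intro Min_le) auto
    also have "\<dots> \<le> dist x y" using d(2)[OF p] xy by simp
    finally show "g \<le> \<bar>x - y\<bar>" by (simp add: dist_real_def)
  qed
qed

text \<open>By induction on the number of covering sets: if all of them are smaller than the gap, then each of them meets at most
  one cylinder of \<open>T\<close>, and pulling back gives a cover of \<open>F\<close> by fewer sets for each cylinder.\<close>
lemma separated_finite_cover:
  assumes t: "t > 0" and T: "finite T" "T \<subseteq> Words" "2 \<le> card T"
    and g: "g > 0" "\<forall>v\<in>T. \<forall>w\<in>T. v \<noteq> w \<longrightarrow> (\<forall>x\<in>cyl v. \<forall>y\<in>cyl w. g \<le> \<bar>x - y\<bar>)"
    and sum: "1 \<le> (\<Sum>w\<in>T. (wnorm w / C) powr t)"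
    and U: "finite I" "F \<subseteq> (\<Union>i\<in>I. U i)" "\<And>i. i \<in> I \<Longrightarrow> bounded (U i)"
  shows "g powr t \<le> (\<Sum>i\<in>I. diameter (U i) powr t)"
  using U
proof (induction "card I" arbitrary: I U rule: less_induct)
  case less
  show ?case
  proof (cases "\<exists>i\<in>I. g \<le> diameter (U i)")
    case True
    then obtain i where i: "i \<in> I" "g \<le> diameter (U i)" by blast
    have "g powr t \<le> diameter (U i) powr t" using i g(1) t by (intro powr_mono2) auto
    also have "\<dots> \<le> (\<Sum>i\<in>I. diameter (U i) powr t)"
      by (rule member_le_sum) (use i less.prems(1) in auto)
    finally show ?thesis .
  next
    case False
    hence small: "diameter (U i) < g" if "i \<in> I" for i using that by force
    define J where "J w = {i \<in> I. U i \<inter> cyl w \<noteq> {}}" for w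
    have fJ: "finite (J w)" for w using less.prems(1) by (simp add: J_def)
    have Jdisj: "J v \<inter> J w = {}" if vw: "v \<in> T" "w \<in> T" "v \<noteq> w" for v w
    proof (rule ccontr)
      assume "J v \<inter> J w \<noteq> {}"
      then obtain i where "i \<in> J v" "i \<in> J w" by blast
      then obtain x y where i: "i \<in> I" and xy: "x \<in> U i" "x \<in> cyl v" "y \<in> U i" "y \<in> cyl w"
        unfolding J_def by blast
      have "g \<le> \<bar>x - y\<bar>" using g(2) vw xy by blast
      also have "\<dots> \<le> diameter (U i)"
        using diameter_bounded_bound[OF less.prems(3)[OF i] xy(1,3)] by (simp add: dist_real_def)
      finally show False using small[OF i] by simp
    qed
    have Jne: "J w \<noteq> {}" if w: "w \<in> T" for w
    proof -
      obtain x where "x \<in> F" using ifs(2) by blast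
      hence x: "wmap w x \<in> cyl w" "wmap w x \<in> F"
        using word_map_in_F[of w x] cylI[of x w] w T(2) by auto
      then obtain i where "i \<in> I" "wmap w x \<in> U i" using less.prems(2) by blast
      thus ?thesis using x unfolding J_def by blast
    qed
    \<comment> \<open>A second word of \<open>T\<close> occupies a covering set that misses
      \<open>cyl w\<close>, so the induction hypothesis applies to strictly fewer sets; this is
      where \<open>2 <= card T\<close> enters.\<close>
    have Jcard: "card (J w) < card I" if w: "w \<in> T" for w
    proof -
      have "\<not> T \<subseteq> {w}" using T(3) card_mono[of "{w}" T] by auto
      then obtain v where v: "v \<in> T" "v \<noteq> w" by blast
      obtain j where "j \<in> J v" using Jne[OF v(1)] by blast
      hence "j \<in> I - J w" using Jdisj[OF v(1) w v(2)] by (auto simp: J_def)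
      hence "J w \<subset> I" by (auto simp: J_def)
      thus ?thesis by (rule psubset_card_mono[OF less.prems(1)])
    qed
    have part: "(wnorm w / C) powr t * g powr t \<le> (\<Sum>i\<in>J w. diameter (U i) powr t)" if w: "w \<in> T" for w
    proof -
      have wW: "w \<in> Words" using w T(2) by blast
      have wp: "wnorm w > 0" by (rule wnorm_pos[OF wW])
      define V where "V i = {x \<in> F. wmap w x \<in> U i}" for i
      have "g powr t \<le> (\<Sum>i\<in>J w. diameter (V i) powr t)"
      proof (rule less.hyps[OF Jcard[OF w] fJ])
        show "F \<subseteq> (\<Union>i\<in>J w. V i)"
        proof
          fix x assume x: "x \<in> F"
          hence "wmap w x \<in> F" by (rule word_map_in_F[OF wW])
          then obtain i where i: "i \<in> I" "wmap w x \<in> U i" using less.prems(2) by blast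
          hence "i \<in> J w" using cylI[OF x, of w] by (auto simp: J_def)
          thus "x \<in> (\<Union>i\<in>J w. V i)" using x i by (auto simp: V_def)
        qed
        show "bounded (V i)" for i by (rule bounded_subset[OF bounded_F]) (auto simp: V_def)
      qed
      hence "(wnorm w / C) powr t * g powr t \<le> (\<Sum>i\<in>J w. (wnorm w / C) powr t * diameter (V i) powr t)"
        unfolding sum_distrib_left[symmetric] by (intro mult_left_mono) auto
      also have "\<dots> \<le> (\<Sum>i\<in>J w. diameter (U i) powr t)"
      proof (rule sum_mono)
        fix i assume "i \<in> J w"
        hence i: "i \<in> I" by (simp add: J_def)
        have d0: "0 \<le> diameter (U i)" by (rule diameter_ge_0[OF less.prems(3)[OF i]])
        have dV0: "0 \<le> diameter (V i)"
          by (rule diameter_ge_0) (rule bounded_subset[OF bounded_F], auto simp: V_def)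
        have "diameter (V i) \<le> C / wnorm w * diameter (U i)"
        proof (rule diameter_le)
          show "V i \<noteq> {} \<or> 0 \<le> C / wnorm w * diameter (U i)" using d0 wp C_ge_1 by simp
          fix x y assume xy: "x \<in> V i" "y \<in> V i"
          hence "\<bar>wmap w x - wmap w y\<bar> \<le> diameter (U i)"
            using diameter_bounded_bound[OF less.prems(3)[OF i], of "wmap w x" "wmap w y"]
            by (simp add: dist_real_def V_def)
          hence "C * \<bar>wmap w x - wmap w y\<bar> \<le> C * diameter (U i)"
            using C_ge_1 by (intro mult_left_mono) auto
          moreover have "wnorm w * \<bar>x - y\<bar> \<le> C * \<bar>wmap w x - wmap w y\<bar>"
            using xy F_interval by (intro word_map_expand[OF wW]) (auto simp: V_def)
          ultimately have "wnorm w * \<bar>x - y\<bar> \<le> C * diameter (U i)" by linarith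
          thus "norm (x - y) \<le> C / wnorm w * diameter (U i)"
            using wp by (simp add: pos_le_divide_eq mult.commute)
        qed
        hence "wnorm w / C * diameter (V i) \<le> diameter (U i)"
          using wp C_ge_1 by (simp add: field_simps)
        hence "(wnorm w / C * diameter (V i)) powr t \<le> diameter (U i) powr t"
          using t wp C_ge_1 dV0 by (intro powr_mono2) auto
        thus "(wnorm w / C) powr t * diameter (V i) powr t \<le> diameter (U i) powr t"
          by (subst (asm) powr_mult) (use wp C_ge_1 dV0 in auto)
      qed
      finally show ?thesis .
    qed
    have "g powr t = 1 * g powr t" by simp
    also have "\<dots> \<le> (\<Sum>w\<in>T. (wnorm w / C) powr t) * g powr t" by (rule mult_right_mono[OF sum]) simp
    also have "\<dots> \<le> (\<Sum>w\<in>T. \<Sum>i\<in>J w. diameter (U i) powr t)"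
      unfolding sum_distrib_right by (rule sum_mono[OF part])
    also have "\<dots> = (\<Sum>i\<in>(\<Union>w\<in>T. J w). diameter (U i) powr t)"
      by (rule sum.UNION_disjoint[symmetric]) (use T(1) fJ Jdisj in auto)
    also have "\<dots> \<le> (\<Sum>i\<in>I. diameter (U i) powr t)"
      by (rule sum_mono2) (use less.prems(1) in \<open>auto simp: J_def\<close>)
    finally show ?thesis .
  qed
qed

end

section \<open>Positive content from finite covers\<close>

lemma open_enlargement:
  fixes U :: "real set"
  assumes "bounded U" "e > 0"
  obtains V where "open V" "U \<subseteq> V" "bounded V" "diameter V \<le> diameter U + 2 * e"
proof
  let ?V = "\<Union>x\<in>U. ball x e"
  show "open ?V" by blast
  show "U \<subseteq> ?V" using assms(2) by auto
  have *: "dist x y \<le> diameter U + 2 * e" if xy: "x \<in> ?V" "y \<in> ?V" for x y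
  proof -
    obtain u v where uv: "u \<in> U" "v \<in> U" "dist u x < e" "dist v y < e" using xy by auto
    have "dist x y \<le> dist x u + (dist u v + dist v y)"
      using dist_triangle[of x y u] dist_triangle[of u y v] by linarith
    moreover have "dist u v \<le> diameter U" using diameter_bounded_bound[OF assms(1)] uv by blast
    ultimately show ?thesis using uv by (simp add: dist_commute)
  qed
  show "bounded ?V" unfolding bounded_two_points using * by blast
  show "diameter ?V \<le> diameter U + 2 * e"
    by (rule diameter_le) (use * diameter_ge_0[OF assms(1)] assms(2) in \<open>auto simp: dist_norm\<close>)
qed

text \<open>By compactness: the sets of a cheap countable cover are enlarged slightly to open sets,
  and a finite subcover contradicts the assumed bound.\<close>

lemma content_pos_of_finite_covers:
  fixes A :: "real set"
  assumes t: "t > 0" and A: "compact A" and c: "c > 0"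
    and fin: "\<And>(I :: nat set) U. finite I \<Longrightarrow> A \<subseteq> (\<Union>i\<in>I. U i) \<Longrightarrow> (\<And>i. i \<in> I \<Longrightarrow> bounded (U i)) \<Longrightarrow>
       c \<le> (\<Sum>i\<in>I. diameter (U i) powr t)"
  shows "hausdorff_content t A > 0"
proof (rule ccontr)
  \<comment> \<open>The 2 accounts for the original gauges and the enlargements, each of total at
    most \<eta>; \<open>2 powr t\<close> comes from
    \<open>(a + b) powr t <= 2 powr t * (a powr t + b powr t)\<close>.\<close>
  define \<eta> where "\<eta> = c / (2 * 2 powr t)"
  have \<eta>: "\<eta> > 0" using c by (simp add: \<eta>_def)
  assume "\<not> hausdorff_content t A > 0"
  hence "hausdorff_content t A < ennreal \<eta>" using \<eta> by simp
  then obtain U where U: "A \<subseteq> (\<Union>i. U i)" "\<And>i. bounded (U i)"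
      "(\<Sum>i. hausdorff_gauge t (U i)) < ennreal \<eta>"
    by (rule hausdorff_content_lessE) blast
  define e where "e n = (\<eta> * (1/2) ^ Suc n) powr (1 / t) / 2" for n
  have e: "e n > 0" "(2 * e n) powr t = \<eta> * (1/2) ^ Suc n" for n
    using \<eta> t by (simp_all add: e_def powr_powr)
  have "\<exists>V. open V \<and> U n \<subseteq> V \<and> bounded V \<and> diameter V \<le> diameter (U n) + 2 * e n" for n
    using open_enlargement[OF U(2) e(1)] by metis
  then obtain V where V: "\<And>n. open (V n)" "\<And>n. U n \<subseteq> V n" "\<And>n. bounded (V n)"
    "\<And>n. diameter (V n) \<le> diameter (U n) + 2 * e n" by metis
  have "A \<subseteq> (\<Union>n\<in>UNIV. V n)" using U(1) V(2) by blast
  have "\<exists>I. finite I \<and> A \<subseteq> (\<Union>i\<in>I. V i)"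
  proof (rule compactE_image[OF A, of UNIV V])
    show "open (V n)" for n by (rule V(1))
    show "A \<subseteq> (\<Union>n\<in>UNIV. V n)" by fact
    show ?thesis if "finite I" "A \<subseteq> (\<Union>i\<in>I. V i)" for I using that by blast
  qed
  then obtain I where I: "finite I" "A \<subseteq> (\<Union>i\<in>I. V i)" by blast
  have Vd: "diameter (V n) powr t \<le> 2 powr t * (diameter (U n) powr t + \<eta> * (1/2) ^ Suc n)" for n
  proof -
    let ?m = "max (diameter (U n)) (2 * e n)"
    have d0: "0 \<le> diameter (U n)" "0 \<le> diameter (V n)" using diameter_ge_0 U(2) V(3) by blast+
    have "diameter (V n) \<le> 2 * ?m" using V(4)[of n] by linarith
    hence "diameter (V n) powr t \<le> (2 * ?m) powr t" using t d0 by (intro powr_mono2) auto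
    also have "\<dots> = 2 powr t * ?m powr t" using e(1)[of n] by (intro powr_mult) 
    also have "?m powr t \<le> diameter (U n) powr t + (2 * e n) powr t"
      by (simp add: max_def)
    finally show ?thesis by (simp add: e(2))
  qed
  have "c \<le> (\<Sum>i\<in>I. diameter (V i) powr t)" by (rule fin[OF I]) (use V(3) in auto)
  also have "\<dots> \<le> (\<Sum>i\<in>I. 2 powr t * (diameter (U i) powr t + \<eta> * (1/2) ^ Suc i))" by (rule sum_mono[OF Vd])
  also have "\<dots> = 2 powr t * ((\<Sum>i\<in>I. diameter (U i) powr t) + \<eta> * (\<Sum>i\<in>I. (1/2) ^ Suc i))"
    unfolding sum_distrib_left[symmetric] sum.distrib ..
  also have "\<dots> < 2 powr t * (\<eta> + \<eta> * 1)"
  proof (intro mult_strict_left_mono add_less_le_mono mult_left_mono)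
    have "ennreal (\<Sum>i\<in>I. diameter (U i) powr t) = (\<Sum>i\<in>I. hausdorff_gauge t (U i))"
      using t by (simp add: hausdorff_gauge_pos)
    also have "\<dots> \<le> (\<Sum>i. hausdorff_gauge t (U i))" by (rule sum_le_suminf) (use I in auto)
    also have "\<dots> < ennreal \<eta>" by (rule U(3))
    finally show "(\<Sum>i\<in>I. diameter (U i) powr t) < \<eta>"
      by (subst (asm) ennreal_less_iff) (auto intro: sum_nonneg)
    have "(\<Sum>i\<in>I. (1/2::real) ^ Suc i) \<le> (\<Sum>i. (1/2) ^ Suc i)"
      by (rule sum_le_suminf) (use I power_half_series in \<open>auto simp: sums_iff\<close>)
    thus "(\<Sum>i\<in>I. (1/2::real) ^ Suc i) \<le> 1" using power_half_series by (simp add: sums_iff)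
  qed (use \<eta> in auto)
  also have "\<dots> = c" by (simp add: \<eta>_def)
  finally show False by simp
qed

text \<open>\<open>nontrivial\<close> excludes a one-point \<open>F\<close>, whose dimension is 0;
  it is what makes \<open>s_pos\<close> provable.\<close>

locale positive_measure = conformal_words +
  fixes s :: real
  assumes dim: "hausdorff_dim F = ereal s" and measure_pos: "hausdorff_measure s F > 0"
    and s_less_1: "s < 1" and nontrivial: "\<exists>x\<in>F. \<exists>y\<in>F. x \<noteq> y"
begin

text \<open>Cylinders are nonempty, so two distinct words with the same cylinder never occur
  together and overlaps are not counted twice.\<close>

definition packings :: "real set \<Rightarrow> nat list set set" where
  "packings A = {T. finite T \<and> T \<subseteq> Words \<and> (\<forall>w\<in>T. cyl w \<subseteq> A) \<and>
     (\<forall>v\<in>T. \<forall>w\<in>T. v \<noteq> w \<longrightarrow> cyl v \<inter> cyl w = {})}"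

lemma s_nonneg: "s \<ge> 0"
  using hausdorff_dim_nonneg[of F] dim by simp

text \<open>If the sum were larger, continuity of a finite sum would give \<open>?f t > 1\<close>
  for some \<open>t\<close> above \<open>s\<close>. The disjoint cylinders then act as a separated
  subsystem, and \<open>separated_finite_cover\<close> yields positive \<open>t\<close>-content for
  an exponent above the dimension.\<close>

lemma packing_sum_le:
  assumes T: "T \<in> packings A"
  shows "(\<Sum>w\<in>T. wnorm w powr s) \<le> C powr s"
proof (rule ccontr)
  assume big: "\<not> ?thesis"
  have T': "finite T" "T \<subseteq> Words"
    "\<And>v w. v \<in> T \<Longrightarrow> w \<in> T \<Longrightarrow> v \<noteq> w \<Longrightarrow> cyl v \<inter> cyl w = {}"
    using T by (auto simp: packings_def)
  have Cs: "C powr s \<ge> 1" using C_ge_1 s_nonneg by (rule ge_one_powr_ge_zero)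
  \<comment> \<open>A single word contributes at most 1, hence at most
    \<open>C powr s\<close>.\<close>
  have "2 \<le> card T"
  proof (rule ccontr)
    assume c: "\<not> 2 \<le> card T"
    have "(\<Sum>w\<in>T. wnorm w powr s) \<le> (\<Sum>w\<in>T. 1)"
    proof (rule sum_mono)
      fix w assume "w \<in> T"
      hence w: "w \<in> Words" using T' by blast
      show "wnorm w powr s \<le> 1" using wnorm_pos[OF w] wnorm_le_1[OF w] s_nonneg by (intro powr_le1) auto
    qed
    also have "\<dots> = card T" by simp
    also have "\<dots> \<le> 1" using c by simp
    finally show False using big Cs by simp
  qed
  let ?f = "\<lambda>t. \<Sum>w\<in>T. (wnorm w / C) powr t"
  have pos: "wnorm w / C > 0" if "w \<in> T" for w
    using wnorm_pos[of w] subsetD[OF T'(2) that] C_ge_1 by simp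
  have "?f s > 1"
  proof -
    have "?f s = (\<Sum>w\<in>T. wnorm w powr s / C powr s)"
    proof (rule sum.cong)
      fix w assume "w \<in> T"
      thus "(wnorm w / C) powr s = wnorm w powr s / C powr s"
        by (intro powr_divide)
    qed simp
    also have "\<dots> = (\<Sum>w\<in>T. wnorm w powr s) / C powr s" by (simp add: sum_divide_distrib)
    finally show ?thesis using big Cs C_ge_1 by (simp add: less_divide_eq)
  qed
  moreover have "isCont ?f s"
    by (intro continuous_intros) (use pos in force)
  ultimately have "\<forall>\<^sub>F t in at s. ?f t > 1" by (intro order_tendstoD(1)) (auto simp: isCont_def)
  hence "\<forall>\<^sub>F t in at_right s. ?f t > 1" by (simp add: eventually_at_split)
  then obtain b where b: "b > s" "\<And>t. s < t \<Longrightarrow> t < b \<Longrightarrow> ?f t > 1"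
    unfolding eventually_at_right_field by auto
  define t where "t = (s + b) / 2"
  have t: "s < t" "?f t > 1" "t > 0" using b s_nonneg by (auto simp: t_def)
  obtain g where g: "g > 0"
    "\<forall>v\<in>T. \<forall>w\<in>T. v \<noteq> w \<longrightarrow> (\<forall>x\<in>cyl v. \<forall>y\<in>cyl w. g \<le> \<bar>x - y\<bar>)"
    by (rule disjoint_cyl_gap[OF T']) blast
  have "hausdorff_content t F > 0"
  proof (rule content_pos_of_finite_covers[OF t(3) ifs(3)])
    show "g powr t > 0" using g(1) by simp
    show "g powr t \<le> (\<Sum>i\<in>I. diameter (U i) powr t)"
      if "finite I" "F \<subseteq> (\<Union>i\<in>I. U i)" "\<And>i. i \<in> I \<Longrightarrow> bounded (U i)" for I and U :: "nat \<Rightarrow> real set"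
      by (rule separated_finite_cover[OF t(3) T'(1,2) \<open>2 \<le> card T\<close> g]) (use t(2) that in auto)
  qed
  moreover have "hausdorff_content t F = 0"
    by (rule hausdorff_content_above_dim) (use dim t in simp)
  ultimately show False by simp
qed

text \<open>A diameter bound; the summand 1 ensures \<open>D >= 1\<close> even when
  \<open>lo = hi\<close>, so it can be divided by.\<close>

definition D :: real where "D = hi - lo + 1"

lemma D: "D \<ge> 1" using lo_le_hi by (simp add: D_def)

lemma F_dist: "x \<in> F \<Longrightarrow> y \<in> F \<Longrightarrow> \<bar>x - y\<bar> \<le> D"
  using F_interval[THEN subsetD, of x] F_interval[THEN subsetD, of y] by (auto simp: D_def abs_le_iff)

lemma cyl_dist:
  assumes "w \<in> Words" "x \<in> cyl w" "y \<in> cyl w"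
  shows "\<bar>x - y\<bar> \<le> wnorm w * D"
proof -
  obtain u v where uv: "u \<in> F" "v \<in> F" "x = wmap w u" "y = wmap w v"
    using assms unfolding cyl_def by blast
  have "\<bar>x - y\<bar> \<le> wnorm w * \<bar>u - v\<bar>"
    unfolding uv(3,4) using uv ifs(4) by (intro word_map_lipschitz[OF assms(1)]) auto
  also have "\<dots> \<le> wnorm w * D" using F_dist[OF uv(1,2)] wnorm_pos[OF assms(1)] by (intro mult_left_mono) auto
  finally show ?thesis .
qed

text \<open>At \<open>s = 0\<close> the packing bound reads: at most one cylinder. Two distinct
  points of \<open>F\<close>, however, lie in disjoint small cylinders.\<close>

lemma s_pos: "s > 0"
proof (rule ccontr)
  assume "\<not> s > 0"
  hence s0: "s = 0" using s_nonneg by simp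
  obtain x y where xy: "x \<in> F" "y \<in> F" "x \<noteq> y" using nontrivial by blast
  \<comment> \<open>Cylinders of norm at most \<open>e\<close> have diameter at most a third of the
    distance between \<open>x\<close> and \<open>y\<close>.\<close>
  define e where "e = \<bar>x - y\<bar> / (3 * D)"
  have e: "e > 0" using xy(3) D by (simp add: e_def)
  obtain v a where v: "v \<in> Words" "a \<in> F" "x = wmap v a" "wnorm v \<le> e"
    using small_word[OF xy(1) e] by blast
  obtain w b where w: "w \<in> Words" "b \<in> F" "y = wmap w b" "wnorm w \<le> e"
    using small_word[OF xy(2) e] by blast
  have disj: "cyl v \<inter> cyl w = {}"
  proof (rule ccontr)
    assume "cyl v \<inter> cyl w \<noteq> {}"
    then obtain z where z: "z \<in> cyl v" "z \<in> cyl w" by blast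
    have "\<bar>x - z\<bar> \<le> wnorm v * D" "\<bar>z - y\<bar> \<le> wnorm w * D"
      using v w z cylI by (auto intro!: cyl_dist)
    moreover have "wnorm v * D \<le> e * D" "wnorm w * D \<le> e * D" using v(4) w(4) D by (auto intro!: mult_right_mono)
    moreover have d: "\<bar>x - y\<bar> = 3 * (e * D)" using D by (simp add: e_def)
    ultimately have "\<bar>x - y\<bar> \<le> e * D + e * D" using abs_triangle_ineq[of "x - z" "z - y"] by simp
    hence "e * D \<le> 0" using d by simp
    moreover have "e * D > 0" using e D by simp
    ultimately show False by simp

  qed
  hence vw: "v \<noteq> w" using cyl_nonempty by auto
  have "{v, w} \<in> packings UNIV" using v w disj by (auto simp: packings_def)
  from packing_sum_le[OF this] vw show False
    using s0 wnorm_pos[OF v(1)] wnorm_pos[OF w(1)] C_ge_1 by simp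
qed

text \<open>The prefix \<open>w\<close> is needed because packings inside the set \<open>cyl w\<close> may use words that do not extend \<open>w\<close>; packings by
  extensions of \<open>w\<close> have total mass at most a constant times \<open>wnorm w powr s\<close>.\<close>
definition pk :: "nat list \<Rightarrow> real set \<Rightarrow> real" where
  "pk w A = (SUP T\<in>packings A. \<Sum>v\<in>T. wnorm (w @ v) powr s)"

lemma packings_empty: "{} \<in> packings A" by (simp add: packings_def)

lemma packings_words: "T \<in> packings A \<Longrightarrow> v \<in> T \<Longrightarrow> v \<in> Words"
  by (auto simp: packings_def)

lemma packing_sum_rel_le:
  assumes w: "w \<in> Words" and T: "T \<in> packings A"
  shows "(\<Sum>v\<in>T. wnorm (w @ v) powr s) \<le> C powr s * wnorm w powr s"
proof -
  have "(\<Sum>v\<in>T. wnorm (w @ v) powr s) \<le> (\<Sum>v\<in>T. wnorm w powr s * wnorm v powr s)"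
  proof (rule sum_mono)
    fix v assume "v \<in> T"
    hence v: "v \<in> Words" by (rule packings_words[OF T])
    show "wnorm (w @ v) powr s \<le> wnorm w powr s * wnorm v powr s"
      by (rule wnorm_powr_append_le[OF w v s_nonneg])
  qed
  also have "\<dots> = wnorm w powr s * (\<Sum>v\<in>T. wnorm v powr s)" by (simp add: sum_distrib_left)
  also have "\<dots> \<le> wnorm w powr s * C powr s" by (intro mult_left_mono packing_sum_le[OF T]) simp
  finally show ?thesis by (simp add: mult.commute)
qed

lemma pk_upper:
  assumes "w \<in> Words" "T \<in> packings A"
  shows "(\<Sum>v\<in>T. wnorm (w @ v) powr s) \<le> pk w A"
  unfolding pk_def
  by (rule cSUP_upper[OF assms(2)]) (rule bdd_aboveI2, rule packing_sum_rel_le[OF assms(1)])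

lemma pk_least: "(\<And>T. T \<in> packings A \<Longrightarrow> (\<Sum>v\<in>T. wnorm (w @ v) powr s) \<le> M) \<Longrightarrow> pk w A \<le> M"
  unfolding pk_def by (rule cSUP_least) (use packings_empty in auto)

lemma pk_approx:
  assumes "w \<in> Words" "e > 0"
  obtains T where "T \<in> packings A" "pk w A - e < (\<Sum>v\<in>T. wnorm (w @ v) powr s)"
proof (rule ccontr)
  assume "\<not> thesis"
  hence "pk w A \<le> pk w A - e" using that by (intro pk_least) force
  thus False using assms(2) by simp
qed

lemma pk_le: "w \<in> Words \<Longrightarrow> pk w A \<le> C powr s * wnorm w powr s"
  by (rule pk_least) (rule packing_sum_rel_le)

lemma pk_nonneg: "w \<in> Words \<Longrightarrow> 0 \<le> pk w A"
  using pk_upper[OF _ packings_empty] by fastforce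

lemma pk_mono: "w \<in> Words \<Longrightarrow> A \<subseteq> B \<Longrightarrow> pk w A \<le> pk w B"
  by (intro pk_least pk_upper) (auto simp: packings_def subset_iff)

lemma pk_UNIV_ge:
  assumes "w \<in> Words"
  shows "wnorm w powr s \<le> pk w UNIV"
proof -
  have "{[]} \<in> packings UNIV" by (simp add: packings_def)
  from pk_upper[OF assms this] show ?thesis by simp
qed

lemma pk_superadditive:
  assumes w: "w \<in> Words" and AB: "A \<inter> B = {}"
  shows "pk w A + pk w B \<le> pk w (A \<union> B)"
proof -
  have 1: "(\<Sum>v\<in>S. wnorm (w @ v) powr s) + (\<Sum>v\<in>T. wnorm (w @ v) powr s) \<le> pk w (A \<union> B)"
    if S: "S \<in> packings A" and T: "T \<in> packings B" for S T
  proof -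
    have dj: "cyl v \<inter> cyl u = {}" if "v \<in> S" "u \<in> T" for u v
    proof -
      have "cyl v \<subseteq> A" "cyl u \<subseteq> B" using S T that by (auto simp: packings_def)
      thus ?thesis using AB by blast
    qed
    have ST: "S \<inter> T = {}" using dj cyl_nonempty by blast
    have "S \<union> T \<in> packings (A \<union> B)"
      unfolding packings_def
    proof (intro CollectI conjI ballI impI)
      show "finite (S \<union> T)" "S \<union> T \<subseteq> Words" using S T by (auto simp: packings_def)
      show "cyl v \<subseteq> A \<union> B" if "v \<in> S \<union> T" for v
      proof -
        have "cyl v \<subseteq> A \<or> cyl v \<subseteq> B" using that S T by (auto simp: packings_def)
        thus ?thesis by blast
      qed
      show "cyl v \<inter> cyl u = {}" if "v \<in> S \<union> T" "u \<in> S \<union> T" "v \<noteq> u" for u v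
      proof -
        consider "v \<in> S" "u \<in> S" | "v \<in> T" "u \<in> T" | "v \<in> S" "u \<in> T" | "v \<in> T" "u \<in> S" using \<open>v \<in> S \<union> T\<close> \<open>u \<in> S \<union> T\<close> by blast
        thus ?thesis
        proof cases
          case 1 thus ?thesis using S \<open>v \<noteq> u\<close> by (simp add: packings_def)
        next
          case 2 thus ?thesis using T \<open>v \<noteq> u\<close> by (simp add: packings_def)
        next
          case 3 thus ?thesis by (rule dj)
        next
          case 4 thus ?thesis using dj[of u v] by (simp add: Int_commute)
        qed
      qed
    qed
    from pk_upper[OF w this] show ?thesis
      using S T ST by (subst (asm) sum.union_disjoint) (auto simp: packings_def)
  qed
  have "pk w A \<le> pk w (A \<union> B) - (\<Sum>v\<in>T. wnorm (w @ v) powr s)" if "T \<in> packings B" for T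
    by (rule pk_least) (use 1[OF _ that] in \<open>simp add: le_diff_eq\<close>)
  hence "pk w B \<le> pk w (A \<union> B) - pk w A"
    by (intro pk_least) (simp add: le_diff_eq add.commute)
  thus ?thesis by simp
qed

lemma pk_UN_superadditive:
  assumes w: "w \<in> Words" and "finite I"
    and "\<And>i j. i \<in> I \<Longrightarrow> j \<in> I \<Longrightarrow> i \<noteq> j \<Longrightarrow> A i \<inter> A j = {}"
  shows "(\<Sum>i\<in>I. pk w (A i)) \<le> pk w (\<Union>i\<in>I. A i)"
  using assms(2,3)
proof (induction I rule: finite_induct)
  case empty
  thus ?case using pk_nonneg[OF w] by simp
next
  case (insert i I)
  have "A i \<inter> (\<Union>j\<in>I. A j) = {}" using insert.prems[of i] insert.hyps(2) by blast
  from pk_superadditive[OF w this] insert show ?case by force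
qed

text \<open>Prefixing \<open>u\<close> moves a packing into \<open>cyl u\<close>; disjointness
  survives because \<open>wmap u\<close> is injective on \<open>{lo..hi}\<close>.\<close>

lemma pk_cyl:
  assumes w: "w \<in> Words" and u: "u \<in> Words"
  shows "pk (w @ u) UNIV \<le> pk w (cyl u)"
proof (rule pk_least)
  fix T assume T: "T \<in> packings UNIV"
  have inj: "inj_on ((@) u) T" by (simp add: inj_on_def)
  have "(@) u ` T \<in> packings (cyl u)"
    unfolding packings_def
  proof (intro CollectI conjI ballI impI)
    show "finite ((@) u ` T)" using T by (simp add: packings_def)
    show "(@) u ` T \<subseteq> Words"
    proof (rule image_subsetI)
      fix v assume "v \<in> T"
      thus "u @ v \<in> Words" using packings_words[OF T] u by simp
    qed
    fix x assume x: "x \<in> (@) u ` T"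
    then obtain v where v: "v \<in> T" "x = u @ v" by blast
    have vW: "v \<in> Words" by (rule packings_words[OF T v(1)])
    show "cyl x \<subseteq> cyl u" unfolding v(2) cyl_append unfolding cyl_def[of u] by (rule image_mono[OF cyl_subset_F[OF vW]])
    fix y assume "y \<in> (@) u ` T" "x \<noteq> y"
    then obtain v' where v': "v' \<in> T" "y = u @ v'" "v \<noteq> v'" using v by blast
    have v'W: "v' \<in> Words" by (rule packings_words[OF T v'(1)])
    have "cyl v \<inter> cyl v' = {}" using T v v' by (auto simp: packings_def)
    moreover have "cyl v \<subseteq> {lo..hi}" "cyl v' \<subseteq> {lo..hi}"
      using cyl_subset_F[OF vW] cyl_subset_F[OF v'W] F_interval by auto
    ultimately show "cyl x \<inter> cyl y = {}"
      unfolding v(2) v'(2) cyl_append by (subst inj_on_image_Int[OF word_map_inj[OF u], symmetric]) auto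
  qed
  from pk_upper[OF w this] show "(\<Sum>v\<in>T. wnorm ((w @ u) @ v) powr s) \<le> pk w (cyl u)"
    by (simp add: sum.reindex[OF inj])
qed

lemma pk_rel_ge:
  assumes w: "w \<in> Words"
  shows "(wnorm w / C) powr s * pk [] A \<le> pk w A"
proof -
  have c: "(wnorm w / C) powr s > 0" using wnorm_pos[OF w] C_ge_1 by simp
  have "pk [] A \<le> pk w A / (wnorm w / C) powr s"
  proof (rule pk_least)
    fix T assume T: "T \<in> packings A"
    have "(wnorm w / C) powr s * (\<Sum>v\<in>T. wnorm v powr s) \<le> (\<Sum>v\<in>T. wnorm (w @ v) powr s)"
      unfolding sum_distrib_left
    proof (rule sum_mono)
      fix v assume "v \<in> T"
      hence v: "v \<in> Words" by (rule packings_words[OF T])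
      show "(wnorm w / C) powr s * wnorm v powr s \<le> wnorm (w @ v) powr s"
        using wnorm_powr_append_ge[OF w v s_nonneg] C_ge_1
        by (simp add: powr_divide pos_divide_le_eq mult.commute)
    qed
    also have "\<dots> \<le> pk w A" by (rule pk_upper[OF w T])
    finally show "(\<Sum>v\<in>T. wnorm ([] @ v) powr s) \<le> pk w A / (wnorm w / C) powr s"
      using c by (simp only: pos_le_divide_eq append_Nil mult.commute)
  qed
  thus ?thesis using c by (simp only: pos_le_divide_eq mult.commute)
qed

text \<open>In \<open>vitali_content\<close> a ball has radius \<open>2 * D\<close> times the norm
  of its word, so the fivefold ball has diameter at most \<open>20 * D\<close> times that
  norm.\<close>

definition KV :: real where "KV = (20 * D) powr s"

lemma KV_pos: "KV > 0" using D by (simp add: KV_def)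

text \<open>Every point of \<open>F\<close> in \<open>U\<close> is the centre of a ball inside
  \<open>U\<close> that contains a cylinder of comparable size. Vitali's lemma selects disjoint
  balls, whose cylinders form packings of \<open>U\<close>, while the fivefold balls still
  cover.\<close>

lemma vitali_content:
  assumes U: "open U"
  shows "hcontent s (F \<inter> U) \<le> KV * pk [] U"
proof -
  have "\<exists>u. u \<in> Words \<and> cyl u \<subseteq> ball x (2 * D * wnorm u) \<and> ball x (2 * D * wnorm u) \<subseteq> U"
    if x: "x \<in> F \<inter> U" for x
  proof -
    obtain d where d: "d > 0" "ball x d \<subseteq> U" using U x openE by blast
    have "d / (2 * D) > 0" using d D by simp
    then obtain u z where u: "u \<in> Words" "z \<in> F" "x = wmap u z" "wnorm u \<le> d / (2 * D)"
      using small_word[of x "d / (2 * D)"] x by blast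
    have "2 * D * wnorm u \<le> d" using u(4) D by (simp add: pos_le_divide_eq mult.commute)
    hence "ball x (2 * D * wnorm u) \<subseteq> U" using d(2) by (meson subset_ball subset_trans)
    moreover have "cyl u \<subseteq> ball x (2 * D * wnorm u)"
    proof
      fix y assume "y \<in> cyl u"
      hence "\<bar>x - y\<bar> \<le> wnorm u * D" unfolding u(3) by (intro cyl_dist[OF u(1)] cylI[OF u(2)])
      also have "\<dots> < 2 * D * wnorm u" using wnorm_pos[OF u(1)] D by simp
      finally show "y \<in> ball x (2 * D * wnorm u)" by (simp add: dist_real_def)
    qed
    ultimately show ?thesis using u(1) by blast
  qed
  then obtain u where u': "\<forall>x\<in>F \<inter> U. u x \<in> Words \<and> cyl (u x) \<subseteq> ball x (2 * D * wnorm (u x)) \<and>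
      ball x (2 * D * wnorm (u x)) \<subseteq> U"
    using bchoice[of "F \<inter> U"] by meson
  define r where "r x = 2 * D * wnorm (u x)" for x
  have u: "u x \<in> Words" "r x = 2 * D * wnorm (u x)" "cyl (u x) \<subseteq> ball x (r x)" "ball x (r x) \<subseteq> U"
    if "x \<in> F \<inter> U" for x
    using bspec[OF u' that] by (simp_all add: r_def)
  have rpos: "0 < r x \<and> r x \<le> 2 * D" if x: "x \<in> F \<inter> U" for x
    using u(2)[OF x] wnorm_pos[OF u(1)[OF x]] wnorm_le_1[OF u(1)[OF x]] D by simp
  have "F \<inter> U \<subseteq> (\<Union>x\<in>F \<inter> U. ball x (r x))"
  proof
    fix x assume x: "x \<in> F \<inter> U"
    have "x \<in> ball x (r x)" using rpos[OF x] by simp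
    thus "x \<in> (\<Union>x\<in>F \<inter> U. ball x (r x))" using x by blast
  qed
  then obtain Q where Q: "countable Q" "Q \<subseteq> F \<inter> U"
     "pairwise (\<lambda>i j. disjnt (ball i (r i)) (ball j (r j))) Q"
     "F \<inter> U \<subseteq> (\<Union>x\<in>Q. ball x (5 * r x))"
    by (rule Vitali_covering_lemma_balls[where S = "F \<inter> U" and K = "F \<inter> U" and a = "\<lambda>x. x" and r = r and B = "2 * D"])
       (use rpos in blast)+
  have "hausdorff_content s (F \<inter> U) \<le> hausdorff_content s (\<Union>x\<in>Q. ball x (5 * r x))"
    by (rule hausdorff_content_mono[OF Q(4)])
  also have "\<dots> \<le> ennreal (KV * pk [] U)"
  proof (rule hausdorff_content_UN_countable[OF Q(1)])
    fix S assume S: "finite S" "S \<subseteq> Q"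
    have SU: "x \<in> F \<inter> U" if "x \<in> S" for x using that S Q(2) by blast
    have dj: "cyl (u x) \<inter> cyl (u y) = {}" if "x \<in> S" "y \<in> S" "x \<noteq> y" for x y
    proof -
      have "ball x (r x) \<inter> ball y (r y) = {}"
        using Q(3) S(2) that unfolding pairwise_def disjnt_def by blast
      thus ?thesis using u(3)[OF SU[OF that(1)]] u(3)[OF SU[OF that(2)]] by blast
    qed
    have inj: "inj_on u S" 
    proof (rule inj_onI, rule ccontr)
      fix x y assume "x \<in> S" "y \<in> S" "u x = u y" "x \<noteq> y"
      thus False using dj[of x y] cyl_nonempty[of "u y"] by simp
    qed
    have pack: "u ` S \<in> packings U"
      unfolding packings_def
    proof (intro CollectI conjI ballI impI)
      show "finite (u ` S)" using S by simp
      show "u ` S \<subseteq> Words" using u(1) SU by blast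
      show "cyl w \<subseteq> U" if "w \<in> u ` S" for w using that u(3,4) SU by blast
      show "cyl v \<inter> cyl w = {}" if "v \<in> u ` S" "w \<in> u ` S" "v \<noteq> w" for v w using that dj by blast
    qed
    have "(\<Sum>x\<in>S. hausdorff_content s (ball x (5 * r x))) \<le> (\<Sum>x\<in>S. ennreal (KV * wnorm (u x) powr s))"
    proof (rule sum_mono)
      fix x assume "x \<in> S"
      hence x: "x \<in> F \<inter> U" by (rule SU)
      have "diameter (ball x (5 * r x)) \<le> 10 * r x"
      proof (rule diameter_le)
        fix a b assume "a \<in> ball x (5 * r x)" "b \<in> ball x (5 * r x)"
        thus "norm (a - b) \<le> 10 * r x" by (simp add: dist_real_def abs_le_iff abs_less_iff)
      qed (use rpos[OF x] in auto)
      hence "diameter (ball x (5 * r x)) powr s \<le> (20 * D * wnorm (u x)) powr s"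
        using s_pos u(2)[OF x] by (intro powr_mono2) (auto intro: diameter_ge_0)
      also have "\<dots> = KV * wnorm (u x) powr s"
        unfolding KV_def by (rule powr_mult)
      finally show "hausdorff_content s (ball x (5 * r x)) \<le> ennreal (KV * wnorm (u x) powr s)"
        using hausdorff_content_bounded[of "ball x (5 * r x)" s] s_pos
        by (auto simp: hausdorff_gauge_pos intro: order_trans ennreal_leI)
    qed
    also have "\<dots> = ennreal (KV * (\<Sum>x\<in>S. wnorm (u x) powr s))"
      using KV_pos by (simp add: sum_distrib_left)
    also have "\<dots> \<le> ennreal (KV * pk [] U)"
    proof (intro ennreal_leI mult_left_mono)
      show "(\<Sum>x\<in>S. wnorm (u x) powr s) \<le> pk [] U"
        using pk_upper[OF _ pack, of "[]"] by (simp add: sum.reindex[OF inj])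
    qed (use KV_pos in simp)
    finally show "(\<Sum>x\<in>S. hausdorff_content s (ball x (5 * r x))) \<le> ennreal (KV * pk [] U)" .
  qed
  finally show ?thesis
    by (rule hcontent_leI) (use KV_pos pk_nonneg[of "[]"] in auto)
qed

lemma hcontent_F_pos: "hcontent s F > 0"
proof (rule ccontr)
  assume "\<not> hcontent s F > 0"
  hence "hcontent s F = 0" using hcontent_nonneg[of s F] by linarith
  hence "hausdorff_content s F = 0" using ennreal_hcontent[OF bounded_F, of s] by simp
  thus False using hausdorff_measure_eq_0[OF s_pos, of F] measure_pos by simp
qed

text \<open>The 2 is the threshold of the contradiction in \<open>pk_interval\<close>; one
  \<open>C powr s\<close> is lost in \<open>pk_rel_ge\<close>, the other in the lower bound for the
  best ratio \<open>M\<close>.\<close>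

definition KR :: real where "KR = 2 * (C powr s * C powr s) / hcontent s F"

text \<open>Upper regularity of packings. Transporting an efficiently covered interval \<open>{a..b}\<close> into every cylinder and
  covering the rest by a nearly optimal packing would lower the best ratio of content to packing number.\<close>
lemma pk_interval:
  assumes ab: "a < b"
  shows "pk [] {a..b} \<le> KR * (b - a) powr s"
proof -
  let ?J = "{a..b}" and ?W = "Words"
  define d where "d = (b - a) powr s"
  have d: "d > 0" using ab by (simp add: d_def)
  \<comment> \<open>Makes the content missed by the packing at most \<open>d / 2\<close>, half of
    the bound \<open>d\<close> for the interval.\<close>
  define \<epsilon> where "\<epsilon> = d / (2 * KV)"
  have \<epsilon>: "\<epsilon> > 0" "KV * \<epsilon> = d / 2" using d KV_pos by (auto simp: \<epsilon>_def)
  obtain T where T: "T \<in> packings (- ?J)" "pk [] (- ?J) - \<epsilon> < (\<Sum>v\<in>T. wnorm ([] @ v) powr s)"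
    using pk_approx[of "[]" \<epsilon> "- ?J"] \<epsilon>(1) by auto
  have TW: "u \<in> ?W" if "u \<in> T" for u using packings_words[OF T(1) that] .
  have fT: "finite T" and Tdj: "\<And>u v. u \<in> T \<Longrightarrow> v \<in> T \<Longrightarrow> u \<noteq> v \<Longrightarrow> cyl u \<inter> cyl v = {}"
    and TJ: "\<And>u. u \<in> T \<Longrightarrow> cyl u \<subseteq> - ?J"
    using T(1) by (auto simp: packings_def)
  define X where "X = (\<Union>u\<in>T. cyl u)"
  \<comment> \<open>What the interval and the packing leave over. A packing inside \<open>U\<close>
    could be added to the nearly optimal \<open>T\<close>, so \<open>pk [] U\<close> is at most
    \<epsilon>.\<close>
  define U where "U = - (?J \<union> X)"
  have "closed X" unfolding X_def using fT TW compact_cyl by (intro closed_UN) (auto intro: compact_imp_closed)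
  hence "open U" unfolding U_def by (intro open_Compl closed_Un) auto
  have "T \<in> packings X" using T(1) by (auto simp: packings_def X_def)
  hence "(\<Sum>v\<in>T. wnorm ([] @ v) powr s) \<le> pk [] X" by (intro pk_upper) auto
  moreover have "pk [] X + pk [] U \<le> pk [] (X \<union> U)" by (rule pk_superadditive) (auto simp: U_def)
  moreover have "pk [] (X \<union> U) \<le> pk [] (- ?J)" by (rule pk_mono) (use TJ in \<open>auto simp: X_def U_def\<close>)
  ultimately have "pk [] U \<le> \<epsilon>" using T(2) by linarith
  hence "KV * pk [] U \<le> KV * \<epsilon>" using KV_pos by (intro mult_left_mono) auto
  hence cU: "hcontent s (F \<inter> U) \<le> d / 2" using vitali_content[OF \<open>open U\<close>] \<epsilon>(2) by linarith
  have cJ: "hcontent s (F \<inter> ?J) \<le> d"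
  proof -
    have "hcontent s (F \<inter> ?J) \<le> hcontent s ?J" by (rule hcontent_mono) auto
    also have "\<dots> \<le> diameter ?J powr s" by (rule hcontent_diameter[OF s_pos]) simp
    also have "\<dots> = d" using ab by (simp add: d_def)
    finally show ?thesis .
  qed
  define c where "c w = hcontent s (cyl w)" for w
  define B where "B w = pk w UNIV" for w
  let ?P = "pk [] ?J"
  have Bge: "wnorm w powr s \<le> B w" and Ble: "B w \<le> C powr s * wnorm w powr s" if "w \<in> ?W" for w
    using that pk_UNIV_ge pk_le by (auto simp: B_def)
  have Bpos: "B w > 0" if "w \<in> ?W" for w
  proof -
    have "0 < wnorm w powr s" using wnorm_pos[OF that] by simp
    thus ?thesis using Bge[OF that] by linarith
  qed
  \<comment> \<open>The cost of covering a cylinder: \<open>d\<close> for the interval and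
    \<open>d / 2\<close> for \<open>U\<close>, both scaled by the norm, plus the subcylinders of the
    packing.\<close>
  have c_step: "c w \<le> wnorm w powr s * (3/2 * d) + (\<Sum>u\<in>T. c (w @ u))" if w: "w \<in> ?W" for w
  proof -
    let ?f = "wmap w"
    have FO: "F \<inter> A \<subseteq> \<Omega>" for A using ifs(4) by blast
    have wu: "w @ u \<in> ?W" if "u \<in> T" for u using w TW[OF that] by simp
    have "X \<subseteq> F" unfolding X_def using TW cyl_subset_F by blast
    hence "F = (F \<inter> ?J) \<union> (F \<inter> U) \<union> X" unfolding U_def by blast
    hence "cyl w = ?f ` ((F \<inter> ?J) \<union> (F \<inter> U) \<union> X)" by (simp add: cyl_def)
    also have "\<dots> = ?f ` (F \<inter> ?J) \<union> ?f ` (F \<inter> U) \<union> ?f ` X" by (simp only: image_Un)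
    also have "?f ` X = (\<Union>u\<in>T. cyl (w @ u))" by (simp add: X_def image_UN cyl_append)
    finally have eq: "cyl w = ?f ` (F \<inter> ?J) \<union> ?f ` (F \<inter> U) \<union> (\<Union>u\<in>T. cyl (w @ u))" .
    have bd: "bounded (?f ` (F \<inter> ?J))" "bounded (?f ` (F \<inter> U))" "\<And>u. u \<in> T \<Longrightarrow> bounded (cyl (w @ u))"
      using bounded_word_image[OF w FO] bounded_word_image[OF wu ifs(4)] by (simp_all add: cyl_def)
    have bdT: "bounded (\<Union>u\<in>T. cyl (w @ u))" using fT bd(3) by (intro bounded_UN) auto
    have "c w \<le> hcontent s (?f ` (F \<inter> ?J) \<union> ?f ` (F \<inter> U)) + hcontent s (\<Union>u\<in>T. cyl (w @ u))"
      unfolding c_def by (subst eq, rule hcontent_Un) (use bd bdT in auto)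
    moreover have "hcontent s (?f ` (F \<inter> ?J) \<union> ?f ` (F \<inter> U)) \<le> hcontent s (?f ` (F \<inter> ?J)) + hcontent s (?f ` (F \<inter> U))"
      by (rule hcontent_Un) (use bd in auto)
    moreover have "hcontent s (\<Union>u\<in>T. cyl (w @ u)) \<le> (\<Sum>u\<in>T. c (w @ u))"
      unfolding c_def by (rule hcontent_UN_finite[OF fT bd(3)])
    moreover have "hcontent s (?f ` (F \<inter> ?J)) \<le> wnorm w powr s * d"
      using hcontent_word_image[OF s_pos w FO, of ?J] mult_left_mono[OF cJ, of "wnorm w powr s"] by simp
    moreover have "hcontent s (?f ` (F \<inter> U)) \<le> wnorm w powr s * (d / 2)"
      using hcontent_word_image[OF s_pos w FO, of U] mult_left_mono[OF cU, of "wnorm w powr s"] by simp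
    ultimately show ?thesis by (simp add: algebra_simps)
  qed
  \<comment> \<open>On the packing side the interval is a gain: it is disjoint from
    \<open>X\<close>, so its own packings come on top of those in the subcylinders.\<close>
  have B_step: "(\<Sum>u\<in>T. B (w @ u)) + (wnorm w / C) powr s * ?P \<le> B w" if w: "w \<in> ?W" for w
  proof -
    have "(\<Sum>u\<in>T. B (w @ u)) \<le> (\<Sum>u\<in>T. pk w (cyl u))"
      unfolding B_def by (intro sum_mono pk_cyl[OF w] TW)
    also have "\<dots> \<le> pk w X" unfolding X_def by (rule pk_UN_superadditive[OF w fT Tdj])
    finally have "(\<Sum>u\<in>T. B (w @ u)) \<le> pk w X" .
    moreover have "(wnorm w / C) powr s * ?P \<le> pk w ?J" by (rule pk_rel_ge[OF w])
    moreover have "pk w X + pk w ?J \<le> pk w (X \<union> ?J)"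
      by (rule pk_superadditive[OF w]) (use TJ in \<open>auto simp: X_def\<close>)
    moreover have "pk w (X \<union> ?J) \<le> B w" unfolding B_def by (rule pk_mono[OF w]) auto
    ultimately show ?thesis by linarith
  qed
  \<comment> \<open>All constants that bound content by packing number uniformly over words. The
    infimum \<open>M\<close> is positive and again belongs to \<open>S\<close>; an overly dense
    interval would produce a smaller member.\<close>
  define S where "S = {M. \<forall>w\<in>?W. c w \<le> M * B w}"
  have S_lower: "hcontent s F / C powr s \<le> M" if "M \<in> S" for M
  proof -
    have "c [] \<le> M * B []" using that unfolding S_def by blast
    hence "hcontent s F \<le> M * B []" by (simp add: c_def cyl_def)
    moreover have "0 < M"
      using calculation hcontent_F_pos Bpos[of "[]"] by (intro zero_less_mult_pos2[of M "B []"]) auto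
    hence "M * B [] \<le> M * C powr s" using Ble[of "[]"] by (intro mult_left_mono) auto
    ultimately have "hcontent s F \<le> M * C powr s" by linarith
    thus ?thesis using C_ge_1 by (simp add: pos_divide_le_eq)
  qed
  have S_ne: "hcontent s F \<in> S"
    unfolding S_def
  proof (intro CollectI ballI)
    fix w assume w: "w \<in> ?W"
    have "c w \<le> wnorm w powr s * hcontent s F"
      unfolding c_def cyl_def by (rule hcontent_word_image[OF s_pos w ifs(4)])
    also have "\<dots> \<le> B w * hcontent s F" using Bge[OF w] by (intro mult_right_mono) auto
    finally show "c w \<le> hcontent s F * B w" by (simp add: mult.commute)
  qed
  define M where "M = Inf S"
  have bddS: "bdd_below S" using S_lower by (rule bdd_belowI)
  have M_lower: "hcontent s F / C powr s \<le> M"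
    unfolding M_def by (rule cInf_greatest) (use S_ne S_lower in auto)
  have Mpos: "M > 0" using M_lower hcontent_F_pos C_ge_1 by (smt (verit) divide_pos_pos powr_gt_zero)
  have MS: "c w \<le> M * B w" if w: "w \<in> ?W" for w
  proof -
    have "c w / B w \<le> M"
      unfolding M_def
    proof (rule cInf_greatest)
      show "S \<noteq> {}" using S_ne by blast
      fix x assume "x \<in> S"
      thus "c w / B w \<le> x" using w Bpos[OF w] by (simp add: S_def pos_divide_le_eq)
    qed
    thus ?thesis using Bpos[OF w] by (simp add: pos_divide_le_eq)
  qed
  have "M * ?P / C powr s < 2 * d"
  proof (rule ccontr)
    assume "\<not> ?thesis"
    hence big: "2 * d \<le> M * ?P / C powr s" by simp
    \<comment> \<open>The gain \<open>2 * d\<close> exceeds the cost \<open>3/2 * d\<close> by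
      \<open>d / 2\<close>; the division by \<open>C powr s\<close> turns norms into
      \<open>B\<close> via \<open>Ble\<close>.\<close>
    define q where "q = d / (2 * C powr s)"
    have q: "q > 0" using d C_ge_1 by (simp add: q_def)
    have "M - q \<in> S"
      unfolding S_def
    proof (intro CollectI ballI)
      fix w assume w: "w \<in> ?W"
      let ?a = "wnorm w powr s"
      have "(\<Sum>u\<in>T. c (w @ u)) \<le> (\<Sum>u\<in>T. M * B (w @ u))"
        by (intro sum_mono MS) (use w TW in simp)
      also have "\<dots> = M * (\<Sum>u\<in>T. B (w @ u))" by (simp add: sum_distrib_left)
      also have "\<dots> \<le> M * (B w - (wnorm w / C) powr s * ?P)"
        using B_step[OF w] Mpos by (intro mult_left_mono) auto
      also have "\<dots> = M * B w - ?a * (M * ?P / C powr s)"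
        using wnorm_pos[OF w] C_ge_1 by (simp add: powr_divide algebra_simps)
      also have "\<dots> \<le> M * B w - ?a * (2 * d)"
        using mult_left_mono[OF big, of ?a] by simp
      finally have "c w \<le> M * B w - ?a * d / 2" using c_step[OF w] by (simp add: algebra_simps)
      moreover have "q * B w \<le> q * (C powr s * ?a)" using Ble[OF w] q by (intro mult_left_mono) auto
      moreover have "q * (C powr s * ?a) = ?a * d / 2" using C_ge_1 by (simp add: q_def)
      ultimately show "c w \<le> (M - q) * B w" by (simp add: algebra_simps)
    qed
    hence "M \<le> M - q" unfolding M_def by (rule cInf_lower[OF _ bddS])
    thus False using q by simp
  qed
  hence MP: "M * ?P < 2 * d * C powr s" using C_ge_1 by (simp add: pos_divide_less_eq)
  have "hcontent s F / C powr s * ?P \<le> M * ?P" by (rule mult_right_mono[OF M_lower]) (simp add: pk_nonneg)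
  hence "hcontent s F / C powr s * ?P \<le> 2 * d * C powr s" using MP by linarith
  hence "?P * hcontent s F \<le> 2 * (C powr s * C powr s) * d"
    using C_ge_1 by (simp add: pos_divide_le_eq mult_ac)
  thus ?thesis using hcontent_F_pos by (simp add: KR_def d_def pos_le_divide_eq)
qed


section \<open>Counting separated points\<close>

text \<open>A word stopped at \<open>\<delta> / (3 * D)\<close> has norm at least
  \<open>cs * \<delta>\<close> and a cylinder of diameter at most \<open>\<delta> / 3\<close>, so
  cylinders through \<delta>-separated points are disjoint.\<close>

definition cs :: real where "cs = \<kappa> / (3 * D)"

lemma cs_pos: "cs > 0" using kappa D by (simp add: cs_def)

definition separated :: "real \<Rightarrow> real set \<Rightarrow> bool" where
  "separated \<delta> Y \<longleftrightarrow> (\<forall>x\<in>Y. \<forall>y\<in>Y. x \<noteq> y \<longrightarrow> \<delta> \<le> \<bar>x - y\<bar>)"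

text \<open>Attaching a cylinder of size about \<delta> to each point gives a packing; the interval
  is widened because these cylinders may stick out of it.\<close>

lemma separated_card:
  assumes Y: "finite Y" "Y \<subseteq> F" "Y \<subseteq> {a..b}" and \<delta>: "0 < \<delta>" "\<delta> \<le> 1" and sep: "separated \<delta> Y"
  shows "card Y * (cs * \<delta>) powr s \<le> pk [] {a - \<delta>..b + \<delta>}"
proof -
  define x where "x = \<delta> / (3 * D)"
  have x: "0 < x" "x \<le> 1" "x * D = \<delta> / 3" using \<delta> D by (auto simp: x_def divide_le_eq)
  have "\<exists>u. u \<in> Words \<and> y \<in> cyl u \<and> \<kappa> * x \<le> wnorm u \<and> wnorm u \<le> x" if "y \<in> Y" for y
  proof -
    have "y \<in> F" using that Y by blast
    then obtain u z where "u \<in> Words" "z \<in> F" "y = wmap u z" "\<kappa> * x \<le> wnorm u" "wnorm u \<le> x"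
      using stopping x by blast
    thus ?thesis using cylI by blast
  qed
  then obtain u where u: "\<forall>y\<in>Y. u y \<in> Words \<and> y \<in> cyl (u y) \<and> \<kappa> * x \<le> wnorm (u y) \<and> wnorm (u y) \<le> x"
    using bchoice[of Y "\<lambda>y u. u \<in> Words \<and> y \<in> cyl u \<and> \<kappa> * x \<le> wnorm u \<and> wnorm u \<le> x"] by blast
  have near: "\<bar>y - z\<bar> \<le> \<delta> / 3" if "y \<in> Y" "z \<in> cyl (u y)" for y z
  proof -
    have "\<bar>y - z\<bar> \<le> wnorm (u y) * D" using u that by (intro cyl_dist) auto
    also have "\<dots> \<le> x * D" using u that(1) D by (intro mult_right_mono) auto
    finally show ?thesis using x(3) by simp
  qed
  have disj: "cyl (u y) \<inter> cyl (u z) = {}" if yz: "y \<in> Y" "z \<in> Y" "y \<noteq> z" for y z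
  proof (rule ccontr)
    assume "cyl (u y) \<inter> cyl (u z) \<noteq> {}"
    then obtain a where a: "a \<in> cyl (u y)" "a \<in> cyl (u z)" by blast
    have "\<delta> \<le> \<bar>y - z\<bar>" using sep yz by (simp add: separated_def)
    also have "\<dots> \<le> \<bar>y - a\<bar> + \<bar>z - a\<bar>" by simp
    also have "\<dots> \<le> \<delta> / 3 + \<delta> / 3" using near[OF yz(1) a(1)] near[OF yz(2) a(2)] by (rule add_mono)
    finally show False using \<delta> by simp
  qed
  have inj: "inj_on u Y"
  proof (rule inj_onI, rule ccontr)
    fix y z assume "y \<in> Y" "z \<in> Y" "u y = u z" "y \<noteq> z"
    thus False using disj[of y z] cyl_nonempty[of "u z"] by simp
  qed
  have pack: "u ` Y \<in> packings {a - \<delta>..b + \<delta>}"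
    unfolding packings_def
  proof (intro CollectI conjI ballI impI)
    show "finite (u ` Y)" using Y by simp
    show "u ` Y \<subseteq> Words" using u by blast
    show "cyl w \<subseteq> {a - \<delta>..b + \<delta>}" if w: "w \<in> u ` Y" for w
    proof
      fix z assume z: "z \<in> cyl w"
      obtain y where y: "y \<in> Y" "w = u y" using w by blast
      have "\<bar>y - z\<bar> \<le> \<delta> / 3" using near y z by blast
      hence "y - z \<le> \<delta> / 3" "z - y \<le> \<delta> / 3" by (simp_all only: abs_le_iff minus_diff_eq)
      moreover have "a \<le> y" "y \<le> b" using y Y by auto
      ultimately have "a - \<delta> \<le> z" "z \<le> b + \<delta>" using \<delta>(1) by linarith+
      thus "z \<in> {a - \<delta>..b + \<delta>}" by simp
    qed
    show "cyl v \<inter> cyl w = {}" if "v \<in> u ` Y" "w \<in> u ` Y" "v \<noteq> w" for v w using that disj by blast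
  qed
  have "card Y * (cs * \<delta>) powr s = (\<Sum>y\<in>Y. (\<kappa> * x) powr s)" by (simp add: cs_def x_def)
  also have "\<dots> \<le> (\<Sum>y\<in>Y. wnorm (u y) powr s)"
    using u kappa x s_pos by (intro sum_mono powr_mono2) auto
  also have "\<dots> = (\<Sum>v\<in>u ` Y. wnorm ([] @ v) powr s)" by (simp add: sum.reindex[OF inj])
  also have "\<dots> \<le> pk [] {a - \<delta>..b + \<delta>}" by (rule pk_upper[OF _ pack]) simp
  finally show ?thesis .
qed

text \<open>Take a \<delta>-separated subset of maximal cardinality, which exists because
  \<open>separated_card\<close> bounds all cardinalities.\<close>

lemma net:
  assumes \<delta>: "0 < \<delta>" "\<delta> \<le> 1"
  obtains E where "finite E" "E \<subseteq> F" "card E * (cs * \<delta>) powr s \<le> C powr s" "\<forall>y\<in>F. \<exists>e\<in>E. \<bar>y - e\<bar> < \<delta>"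
proof -
  let ?P = "\<lambda>E. finite E \<and> E \<subseteq> F \<and> separated \<delta> E"
  have pos: "(cs * \<delta>) powr s > 0" using cs_pos \<delta> by simp
  have bound: "card E * (cs * \<delta>) powr s \<le> C powr s" if "?P E" for E
  proof -
    have "card E * (cs * \<delta>) powr s \<le> pk [] {lo - \<delta>..hi + \<delta>}"
      using that F_interval \<delta> by (intro separated_card) auto
    also have "\<dots> \<le> C powr s" using pk_le[of "[]" "{lo - \<delta>..hi + \<delta>}"] by simp
    finally show ?thesis .
  qed
  obtain B :: nat where B: "C powr s / (cs * \<delta>) powr s < B" using reals_Archimedean2 by blast
  have "card E \<le> B" if "?P E" for E
  proof -
    have "card E \<le> C powr s / (cs * \<delta>) powr s" using bound[OF that] pos by (simp only: pos_le_divide_eq)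
    thus ?thesis using B by linarith
  qed
  hence "\<forall>E. ?P E \<longrightarrow> card E < Suc B" by (simp add: less_Suc_eq_le)
  moreover have "?P {}" by (simp add: separated_def)
  ultimately have "\<exists>E. ?P E \<and> (\<forall>E'. ?P E' \<longrightarrow> card E' \<le> card E)"
    using ex_has_greatest_nat[of ?P "{}" card "Suc B"] by simp
  then obtain E where E0: "?P E \<and> (\<forall>E'. ?P E' \<longrightarrow> card E' \<le> card E)" ..
  note E = conjunct1[OF E0] conjunct2[OF E0]
  show ?thesis
  proof (rule that)
    show "finite E" "E \<subseteq> F" using E by auto
    show "card E * (cs * \<delta>) powr s \<le> C powr s" by (rule bound[OF E(1)])
    show "\<forall>y\<in>F. \<exists>e\<in>E. \<bar>y - e\<bar> < \<delta>"
    proof (rule ccontr)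
      assume "\<not> ?thesis"
      then obtain y where y: "y \<in> F" "\<And>e. e \<in> E \<Longrightarrow> \<delta> \<le> \<bar>y - e\<bar>" by (meson not_less)
      have "y \<notin> E" using y(2)[of y] \<delta> by auto
      have "?P (insert y E)"
        using E(1) y by (auto simp: separated_def abs_minus_commute)
      hence "card (insert y E) \<le> card E" using E(2) by blast
      thus False using \<open>y \<notin> E\<close> E(1) by simp
    qed
  qed
qed

section \<open>Close pairs of word maps\<close>

text \<open>The dyadic scale of the norm; words of one level have norms comparable within a factor
  2.\<close>

definition level :: "nat list \<Rightarrow> nat" where
  "level w = (LEAST l. (1/2) ^ Suc l < wnorm w)"

lemma level:
  assumes "w \<in> Words"
  shows "(1/2) ^ Suc (level w) < wnorm w" "wnorm w \<le> (1/2) ^ level w"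
proof -
  obtain n where n: "(1/2::real) ^ n < wnorm w" using real_arch_pow_inv[OF wnorm_pos[OF assms], of "1/2"] by auto
  have "(1/2::real) ^ Suc n \<le> (1/2) ^ n" by simp
  hence "\<exists>l. (1/2) ^ Suc l < wnorm w" using n by (meson le_less_trans)
  thus "(1/2) ^ Suc (level w) < wnorm w" unfolding level_def by (rule LeastI_ex)
  show "wnorm w \<le> (1/2) ^ level w"
  proof (cases "level w")
    case 0
    thus ?thesis using wnorm_le_1[OF assms] by simp
  next
    case (Suc l)
    hence "\<not> (1/2) ^ Suc l < wnorm w" using not_less_Least[of l "\<lambda>l. (1/2) ^ Suc l < wnorm w"] by (simp add: level_def)
    thus ?thesis using Suc by simp
  qed
qed

lemma finite_grid:
  assumes "d > 0"
  obtains G where "finite G" "G \<subseteq> {lo..hi}" "\<forall>x\<in>{lo..hi}. \<exists>g\<in>G. \<bar>x - g\<bar> \<le> d"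
proof -
  have "\<exists>k. finite k \<and> k \<subseteq> {lo..hi} \<and> {lo..hi} \<subseteq> (\<Union>x\<in>k. ball x d)"
    using seq_compact_imp_totally_bounded[OF compact_imp_seq_compact[OF compact_Icc[of lo hi]]] assms by simp
  then obtain k where k: "finite k" "k \<subseteq> {lo..hi}" "{lo..hi} \<subseteq> (\<Union>x\<in>k. ball x d)" by blast
  have "\<exists>g\<in>k. \<bar>x - g\<bar> \<le> d" if x: "x \<in> {lo..hi}" for x
  proof -
    obtain g where g: "g \<in> k" "x \<in> ball g d" using subsetD[OF k(3) x] by blast
    hence "\<bar>x - g\<bar> \<le> d" by (simp add: dist_real_def)
    thus ?thesis using g(1) by blast
  qed
  thus ?thesis using that[OF k(1,2)] by blast
qed

lemma geometric_tail:
  fixes q :: real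
  assumes "0 < q" "q < 1" "finite I" "\<And>l. l \<in> I \<Longrightarrow> L \<le> l"
  shows "(\<Sum>l\<in>I. q ^ l) \<le> q ^ L / (1 - q)"
proof -
  have inj: "inj_on (\<lambda>l. l - L) I" using assms(4) by (intro inj_onI) (metis le_add_diff_inverse)
  have "(\<Sum>l\<in>I. q ^ l) = (\<Sum>l\<in>I. q ^ L * q ^ (l - L))"
    by (rule sum.cong) (use assms(4) in \<open>auto simp: power_add[symmetric]\<close>)
  also have "\<dots> = q ^ L * (\<Sum>l\<in>(\<lambda>l. l - L) ` I. q ^ l)"
    by (simp add: sum_distrib_left sum.reindex[OF inj])
  also have "\<dots> \<le> q ^ L * (\<Sum>l. q ^ l)"
    by (intro mult_left_mono sum_le_suminf summable_geometric) (use assms in auto)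
  also have "(\<Sum>l. q ^ l) = 1 / (1 - q)" using assms by (intro suminf_geometric) auto
  finally show ?thesis by simp
qed

text \<open>The derivative part is what later makes the displacement
  \<open>wmap w x - wmap v x\<close> nearly constant on small sets.\<close>

definition close :: "real \<Rightarrow> nat list \<Rightarrow> nat list \<Rightarrow> bool" where
  "close \<epsilon> v w \<longleftrightarrow> (\<forall>x\<in>{lo..hi}. \<bar>wmap v x - wmap w x\<bar> \<le> \<epsilon> * wnorm v \<and>
     \<bar>wder v x - wder w x\<bar> \<le> \<epsilon> * wnorm v)"

lemma word_map_diff_lipschitz:
  assumes vw: "v \<in> Words" "w \<in> Words" and xy: "x \<in> {lo..hi}" "y \<in> {lo..hi}"
    and M: "\<And>z. z \<in> {lo..hi} \<Longrightarrow> \<bar>wder w z - wder v z\<bar> \<le> M"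
  shows "\<bar>(wmap w x - wmap v x) - (wmap w y - wmap v y)\<bar> \<le> M * \<bar>x - y\<bar>"
proof -
  have "norm ((\<lambda>x. wmap w x - wmap v x) x - (\<lambda>x. wmap w x - wmap v x) y) \<le> M * norm (x - y)"
  proof (rule field_differentiable_bound[of "{lo..hi}" _ "\<lambda>z. wder w z - wder v z"])
    fix z assume z: "z \<in> {lo..hi}"
    hence "z \<in> \<Omega>" using interval_Omega by blast
    thus "((\<lambda>x. wmap w x - wmap v x) has_field_derivative wder w z - wder v z) (at z within {lo..hi})"
      by (intro DERIV_diff has_field_derivative_at_within[OF word_map_deriv] vw)
    show "norm (wder w z - wder v z) \<le> M" using M[OF z] by simp
  qed (use xy in auto)
  thus ?thesis by simp
qed

text \<open>Pigeonhole: words of norm about \<open>r\<close> are determined up to \<open>close\<close> by the approximate position of one image point and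
  the approximate derivatives on a finite grid.\<close>
lemma close_classes:
  assumes \<epsilon>: "0 < \<epsilon>" "\<epsilon> \<le> 1"
  obtains B where "B > 0"
    "\<And>l W. W \<subseteq> Words \<Longrightarrow> finite W \<Longrightarrow> (\<And>w. w \<in> W \<Longrightarrow> level w = l) \<Longrightarrow>
       (\<And>v w. v \<in> W \<Longrightarrow> w \<in> W \<Longrightarrow> v \<noteq> w \<Longrightarrow> \<not> close \<epsilon> v w) \<Longrightarrow>
       card W * ((1/2) ^ l) powr s \<le> B"
proof -
  \<comment> \<open>Error budget in units of \<open>\<epsilon>1 * wnorm v\<close>: 5 for derivatives
    (grid value plus distortion of both words, with \<open>r <= 2 * wnorm v\<close>), 4 for the base
    point and \<open>5 * D\<close> for integrating the derivative error;
    \<open>4 + 5 * D <= 9 * D\<close>.\<close>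
  define \<epsilon>1 where "\<epsilon>1 = \<epsilon> / (9 * D)"
  have \<epsilon>1: "0 < \<epsilon>1" "\<epsilon>1 \<le> 1" "5 * \<epsilon>1 \<le> \<epsilon>" "(4 + 5 * D) * \<epsilon>1 \<le> \<epsilon>"
    using \<epsilon> D by (auto simp: \<epsilon>1_def field_simps)
  obtain d where d: "d > 0" "\<forall>w\<in>Words. \<forall>x\<in>{lo..hi}. \<forall>y\<in>{lo..hi}. \<bar>x - y\<bar> \<le> d \<longrightarrow>
        \<bar>wder w x - wder w y\<bar> \<le> \<epsilon>1 * \<bar>wder w y\<bar>"
    using small_distortion[OF \<epsilon>1(1)] by blast
  obtain G where G: "finite G" "G \<subseteq> {lo..hi}" "\<forall>x\<in>{lo..hi}. \<exists>g\<in>G. \<bar>x - g\<bar> \<le> d"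
    using finite_grid[OF d(1)] by blast
  define m where "m = \<lceil>1 / \<epsilon>1\<rceil>"
  define Q where "Q = PiE G (\<lambda>_. {- m - 1..m})"
  have fQ: "finite Q" unfolding Q_def using G(1) by (intro finite_PiE) auto
  obtain x0 where x0: "x0 \<in> F" using ifs(2) by blast
  define B where "B = C powr s / (cs * \<epsilon>1) powr s * (card Q + 1)"
  show ?thesis
  proof (rule that)
    show "B > 0" using C_ge_1 cs_pos \<epsilon>1 by (simp add: B_def add_nonneg_pos)
    fix l W
    assume W: "W \<subseteq> Words" "finite W" "\<And>w. w \<in> W \<Longrightarrow> level w = l"
      "\<And>v w. v \<in> W \<Longrightarrow> w \<in> W \<Longrightarrow> v \<noteq> w \<Longrightarrow> \<not> close \<epsilon> v w"
    define r :: real where "r = (1/2) ^ l"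
    have r: "0 < r" "r \<le> 1" by (auto simp: r_def power_le_one)
    have wr: "wnorm w \<le> r" "r \<le> 2 * wnorm w" if "w \<in> W" for w
    proof -
      have "w \<in> Words" using that W(1) by blast
      from level[OF this] W(3)[OF that] show "wnorm w \<le> r" "r \<le> 2 * wnorm w" by (auto simp: r_def)
    qed
    have \<delta>: "0 < \<epsilon>1 * r" "\<epsilon>1 * r \<le> 1" using \<epsilon>1 r by (auto intro: mult_le_one)
    obtain E where E: "finite E" "E \<subseteq> F" "card E * (cs * (\<epsilon>1 * r)) powr s \<le> C powr s" "\<forall>y\<in>F. \<exists>e\<in>E. \<bar>y - e\<bar> < \<epsilon>1 * r"
      using net[OF \<delta>] by blast
    obtain p where p: "\<forall>y\<in>F. p y \<in> E \<and> \<bar>y - p y\<bar> < \<epsilon>1 * r"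
      using E(4) bchoice[of F "\<lambda>y e. e \<in> E \<and> \<bar>y - e\<bar> < \<epsilon>1 * r"] by blast
    define code where "code w = (p (wmap w x0), restrict (\<lambda>g. \<lfloor>wder w g / (\<epsilon>1 * r)\<rfloor>) G)" for w
    have "code ` W \<subseteq> E \<times> Q"
    proof (rule image_subsetI)
      fix w assume w: "w \<in> W"
      hence wW: "w \<in> Words" using W(1) by blast
      have "p (wmap w x0) \<in> E" using p word_map_in_F[OF wW x0] by blast
      moreover have "\<lfloor>wder w g / (\<epsilon>1 * r)\<rfloor> \<in> {- m - 1..m}" if g: "g \<in> G" for g
      proof -
        have "g \<in> \<Omega>" using g G(2) interval_Omega by blast
        hence "\<bar>wder w g\<bar> \<le> r" using word_deriv_le_wnorm[OF wW] wr(1)[OF w] by (meson order_trans)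
        hence "\<bar>wder w g / (\<epsilon>1 * r)\<bar> \<le> 1 / \<epsilon>1"
          using r \<epsilon>1 by (simp add: abs_mult field_simps)
        hence "\<bar>wder w g / (\<epsilon>1 * r)\<bar> \<le> m" unfolding m_def by linarith
        thus ?thesis unfolding abs_le_iff by (simp add: floor_le_iff le_floor_iff)
      qed
      ultimately show "code w \<in> E \<times> Q" by (auto simp: code_def Q_def)
    qed
    moreover have "inj_on code W"
    proof (rule inj_onI, rule ccontr)
      fix v w assume v: "v \<in> W" and w: "w \<in> W" and eq: "code v = code w" and ne: "v \<noteq> w"
      have vW: "v \<in> Words" and wW: "w \<in> Words" using v w W(1) by auto
      have "\<bar>wmap v x0 - p (wmap v x0)\<bar> < \<epsilon>1 * r" "\<bar>wmap w x0 - p (wmap w x0)\<bar> < \<epsilon>1 * r"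
        using p word_map_in_F x0 vW wW by blast+
      moreover have "p (wmap v x0) = p (wmap w x0)" using eq by (simp add: code_def)
      ultimately have h0: "\<bar>wmap w x0 - wmap v x0\<bar> \<le> 2 * (\<epsilon>1 * r)" by linarith
      have er: "\<epsilon>1 * r \<le> 2 * (\<epsilon>1 * wnorm v)" "\<epsilon>1 * wnorm v \<le> \<epsilon>1 * r" "\<epsilon>1 * wnorm w \<le> \<epsilon>1 * r"
        using wr[OF v] wr[OF w] \<epsilon>1 by (auto simp: mult_le_cancel_left_pos)
      have grid: "\<bar>wder v g - wder w g\<bar> \<le> \<epsilon>1 * r" if g: "g \<in> G" for g
      proof -
        have "restrict (\<lambda>g. \<lfloor>wder v g / (\<epsilon>1 * r)\<rfloor>) G g = restrict (\<lambda>g. \<lfloor>wder w g / (\<epsilon>1 * r)\<rfloor>) G g"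
          using eq by (simp only: code_def prod.inject)
        hence "\<lfloor>wder v g / (\<epsilon>1 * r)\<rfloor> = \<lfloor>wder w g / (\<epsilon>1 * r)\<rfloor>" using g by simp
        hence "\<bar>wder v g / (\<epsilon>1 * r) - wder w g / (\<epsilon>1 * r)\<bar> \<le> 1" by linarith
        hence "\<bar>(wder v g - wder w g) / (\<epsilon>1 * r)\<bar> \<le> 1" by (simp add: diff_divide_distrib)
        thus ?thesis using \<delta>(1) by (simp add: abs_divide divide_le_eq)
      qed
      have der: "\<bar>wder w x - wder v x\<bar> \<le> 5 * \<epsilon>1 * wnorm v" if x: "x \<in> {lo..hi}" for x
      proof -
        obtain g where g: "g \<in> G" "\<bar>x - g\<bar> \<le> d" using G(3) x by blast
        have gI: "g \<in> {lo..hi}" "g \<in> \<Omega>" using g(1) G(2) interval_Omega by auto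
        have "\<bar>wder v x - wder v g\<bar> \<le> \<epsilon>1 * wnorm v" "\<bar>wder w x - wder w g\<bar> \<le> \<epsilon>1 * wnorm w"
          using d(2) vW wW x gI g(2) word_deriv_le_wnorm[OF vW gI(2)] word_deriv_le_wnorm[OF wW gI(2)] \<epsilon>1(1)
          by (meson mult_left_mono order_trans less_imp_le)+
        thus ?thesis using grid[OF g(1)] er by linarith
      qed
      have "close \<epsilon> v w"
        unfolding close_def
      proof (intro ballI conjI)
        fix x assume x: "x \<in> {lo..hi}"
        have vp: "wnorm v \<ge> 0" using wnorm_pos[OF vW] by simp
        have "\<bar>wder w x - wder v x\<bar> \<le> 5 * \<epsilon>1 * wnorm v" by (rule der[OF x])
        also have "\<dots> \<le> \<epsilon> * wnorm v" using \<epsilon>1(3) vp by (rule mult_right_mono)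
        finally show "\<bar>wder v x - wder w x\<bar> \<le> \<epsilon> * wnorm v" by (simp add: abs_minus_commute)
        have x0I: "x0 \<in> {lo..hi}" using x0 F_interval by blast
        have "\<bar>(wmap w x - wmap v x) - (wmap w x0 - wmap v x0)\<bar> \<le> 5 * \<epsilon>1 * wnorm v * \<bar>x - x0\<bar>"
          by (rule word_map_diff_lipschitz[OF vW wW x x0I der])
        also have "\<dots> \<le> 5 * \<epsilon>1 * wnorm v * D"
          using x x0I \<epsilon>1 vp by (intro mult_left_mono) (auto simp: D_def abs_le_iff)
        finally have "\<bar>wmap v x - wmap w x\<bar> \<le> 5 * \<epsilon>1 * wnorm v * D + 4 * (\<epsilon>1 * wnorm v)"
          using h0 er(1) by linarith
        also have "\<dots> = (4 + 5 * D) * \<epsilon>1 * wnorm v" by (simp add: algebra_simps)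
        also have "\<dots> \<le> \<epsilon> * wnorm v" using \<epsilon>1(4) vp by (rule mult_right_mono)
        finally show "\<bar>wmap v x - wmap w x\<bar> \<le> \<epsilon> * wnorm v" .
      qed
      thus False using W(4)[OF v w ne] by blast
    qed
    ultimately have "card W \<le> card (E \<times> Q)" using E(1) fQ by (intro card_inj_on_le) auto
    hence "card W * r powr s \<le> card E * card Q * r powr s"
      by (intro mult_right_mono) (auto simp: card_cartesian_product simp flip: of_nat_mult)
    \<comment> \<open>The net has at most a constant times \<open>r powr (- s)\<close> points, so
      the factor \<open>r powr s\<close> cancels its growth and the bound is uniform in
      \<open>l\<close>.\<close>
    also have "\<dots> = (card E * (cs * (\<epsilon>1 * r)) powr s) / (cs * \<epsilon>1) powr s * card Q"
    proof -
      have "(cs * (\<epsilon>1 * r)) powr s = (cs * \<epsilon>1) powr s * r powr s"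
        unfolding mult.assoc[symmetric] by (rule powr_mult)
      thus ?thesis using cs_pos \<epsilon>1 by simp
    qed
    also have "\<dots> \<le> C powr s / (cs * \<epsilon>1) powr s * (card Q + 1)"
      by (intro mult_mono divide_right_mono E(3)) auto
    finally show "card W * ((1/2) ^ l) powr s \<le> B" by (simp add: B_def r_def)
  qed
qed

text \<open>Without a close pair, level \<open>l\<close> contributes at most
  \<open>B * q ^ l\<close> to \<open>psum n pzero\<close>. Long words have only high levels, so the
  sum is a small geometric tail, against the uniform lower bound of
  \<open>psum_bounds\<close>.\<close>

lemma close_pair_exists:
  assumes less: "s < pzero" and \<epsilon>: "0 < \<epsilon>" "\<epsilon> \<le> 1"
  shows "\<exists>v\<in>Words. \<exists>w\<in>Words. v \<noteq> w \<and> close \<epsilon> v w"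
proof (rule ccontr)
  assume no: "\<not> ?thesis"
  let ?p = pzero
  obtain B where B: "B > 0"
    "\<And>l W. W \<subseteq> Words \<Longrightarrow> finite W \<Longrightarrow> (\<And>w. w \<in> W \<Longrightarrow> level w = l) \<Longrightarrow>
       (\<And>v w. v \<in> W \<Longrightarrow> w \<in> W \<Longrightarrow> v \<noteq> w \<Longrightarrow> \<not> close \<epsilon> v w) \<Longrightarrow>
       card W * ((1/2) ^ l) powr s \<le> B"
    using close_classes[OF \<epsilon>] by metis
  define q :: real where "q = (1/2) powr (?p - s)"
  have q: "0 < q" "q < 1" using powr_less_mono2[of "?p - s" "1/2::real" 1] less by (auto simp: q_def)
  have "0 < 1 / (C powr ?p * B / (1 - q))" using C_ge_1 B(1) q by simp
  then obtain L where L: "q ^ L < 1 / (C powr ?p * B / (1 - q))" using real_arch_pow_inv q(2) by blast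
  obtain n where n: "\<rho> ^ n < (1/2::real) ^ L" using real_arch_pow_inv[of "(1/2::real) ^ L" \<rho>] rho by auto
  have lvl: "L \<le> level w" if w: "w \<in> words N n" for w
  proof (rule ccontr)
    have wW: "w \<in> Words" by (rule words_lists[OF w])
    assume "\<not> L \<le> level w"
    hence "(1/2::real) ^ L \<le> (1/2) ^ Suc (level w)" by (intro power_decreasing) auto
    also have "\<dots> < wnorm w" by (rule level[OF wW])
    also have "\<dots> \<le> \<rho> ^ n" using wnorm_le_power[OF wW] words_lists(2)[OF w] by simp
    finally show False using n by simp
  qed
  have "psum n ?p = (\<Sum>l\<in>level ` words N n. \<Sum>w\<in>{w \<in> words N n. level w = l}. wnorm w powr ?p)"
    unfolding psum_def by (rule sum.image_gen) simp
  also have "\<dots> \<le> (\<Sum>l\<in>level ` words N n. B * q ^ l)"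
  proof (rule sum_mono)
    fix l
    let ?W = "{w \<in> words N n. level w = l}" and ?r = "(1/2::real) ^ l"
    have r: "?r > 0" by simp
    have "(\<Sum>w\<in>?W. wnorm w powr ?p) \<le> (\<Sum>w\<in>?W. ?r powr ?p)"
    proof (rule sum_mono)
      fix w assume w: "w \<in> ?W"
      hence wW: "w \<in> Words" using words_lists by blast
      show "wnorm w powr ?p \<le> ?r powr ?p"
        using level(2)[OF wW] w wnorm_pos[OF wW] pressure_zero(1) by (intro powr_mono2) auto
    qed
    also have "\<dots> = card ?W * ?r powr s * ?r powr (?p - s)" using r by (simp add: powr_add[symmetric])
    also have "?r powr (?p - s) = q ^ l"
      by (simp add: q_def powr_realpow[symmetric] powr_powr mult.commute del: powr_realpow)
    also have "card ?W * ?r powr s * q ^ l \<le> B * q ^ l"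
    proof (intro mult_right_mono B(2))
      show "?W \<subseteq> Words" using words_lists by blast
      show "\<not> close \<epsilon> v w" if "v \<in> ?W" "w \<in> ?W" "v \<noteq> w" for v w
        using no that words_lists by blast
    qed (use q in auto)
    finally show "(\<Sum>w\<in>?W. wnorm w powr ?p) \<le> B * q ^ l" .
  qed
  also have "\<dots> = B * (\<Sum>l\<in>level ` words N n. q ^ l)" by (simp add: sum_distrib_left)
  also have "\<dots> \<le> B * (q ^ L / (1 - q))"
    using B(1) lvl by (intro mult_left_mono geometric_tail[OF q]) auto
  finally have "C powr ?p * psum n ?p \<le> C powr ?p * (B * (q ^ L / (1 - q)))" by (intro mult_left_mono) auto
  also have "\<dots> = (C powr ?p * B / (1 - q)) * q ^ L" by simp
  also have "\<dots> < 1"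
  proof -
    have "C powr ?p * B / (1 - q) > 0" using C_ge_1 B(1) q by simp
    thus ?thesis using L by (simp only: pos_less_divide_eq mult.commute)
  qed
  finally show False using psum_bounds(2)[of ?p n] pressure_zero by simp
qed

section \<open>Long progressions\<close>

text \<open>A new point lies within \<open>(2 / \<kappa> + 1) * b\<close> of an extreme old one, and
  \<open>b\<close> is at most \<open>C * C\<close> times the spacing \<open>m * \<delta>\<close>
  read off from one derivative value; see \<open>gap_le\<close> in
  \<open>progression_step\<close>.\<close>

definition C1 :: real where "C1 = (2 / \<kappa> + 1) * (C * C)"

lemma C1_ge_1: "C1 \<ge> 1"
proof -
  have "1 * 1 \<le> (2 / \<kappa> + 1) * (C * C)"
    using kappa C_ge_1 mult_mono[of 1 C 1 C] by (intro mult_mono) auto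
  thus ?thesis by (simp add: C1_def)
qed

text \<open>\<eta> has two tasks: slack for accumulated distortion in the relative bound, and an
  absolute bound on the diameter that lets the next step use small distortion on
  \<open>Y\<close>.\<close>

definition progression :: "nat \<Rightarrow> real \<Rightarrow> real \<Rightarrow> real set \<Rightarrow> bool" where
  "progression k \<eta> \<delta> Y \<longleftrightarrow> finite Y \<and> card Y = k \<and> Y \<subseteq> F \<and> 0 < \<delta> \<and> separated \<delta> Y \<and>
     (\<forall>a\<in>Y. \<forall>b\<in>Y. \<bar>a - b\<bar> \<le> C1 * (1 + \<eta>) * k * \<delta> \<and> \<bar>a - b\<bar> \<le> \<eta>)"

text \<open>Given a tiny progression \<open>Y\<close> and a close pair \<open>v\<close>, \<open>w\<close>, shrink \<open>Y\<close> by a word \<open>u\<close> such that the spacing of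
  \<open>\<phi>\<^sub>v\<^sub>u(Y)\<close> is comparable with the displacement \<open>\<phi>\<^sub>w - \<phi>\<^sub>v\<close>, which is nearly constant there: displacing an extreme
  point of \<open>\<phi>\<^sub>v\<^sub>u(Y)\<close> adds one point to the progression.\<close>
lemma progression_step:
  assumes less: "s < pzero" and no_overlap: "\<not> has_exact_overlap N \<phi> F"
    and k: "k \<ge> 1" and IH: "\<And>\<eta>. \<eta> > 0 \<Longrightarrow> \<exists>\<delta> Y. progression k \<eta> \<delta> Y"
    and \<eta>: "0 < \<eta>" "\<eta> \<le> 1"
  shows "\<exists>\<delta> Y. progression (Suc k) \<eta> \<delta> Y"
proof -
  \<comment> \<open>Small enough that two factors \<open>1 + \<tau>\<close> and one factor
    \<open>1 / (1 - \<tau>)\<close> fit under \<open>1 + \<eta>\<close>.\<close>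
  define \<tau> where "\<tau> = \<eta> / 8"
  have \<tau>: "0 < \<tau>" "\<tau> < 1" using \<eta> by (auto simp: \<tau>_def)
  have \<tau>_est: "(1 + \<tau>) * (1 + \<tau>) \<le> (1 + \<eta>) * (1 - \<tau>)" "1 \<le> (1 + \<eta>) * (1 - \<tau>)"
  proof -
    have "\<eta> * \<eta> \<le> \<eta> * 1" using \<eta> by (intro mult_left_mono) auto
    moreover have "(1 + \<tau>) * (1 + \<tau>) = 1 + \<eta> / 4 + \<eta> * \<eta> / 64"
      "(1 + \<eta>) * (1 - \<tau>) = 1 + 7 / 8 * \<eta> - \<eta> * \<eta> / 8"
      by (simp_all add: \<tau>_def field_simps)
    ultimately show "(1 + \<tau>) * (1 + \<tau>) \<le> (1 + \<eta>) * (1 - \<tau>)" "1 \<le> (1 + \<eta>) * (1 - \<tau>)"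
      using \<eta>(1) by linarith+
  qed
  obtain d where d: "d > 0" "\<forall>w\<in>Words. \<forall>x\<in>{lo..hi}. \<forall>y\<in>{lo..hi}. \<bar>x - y\<bar> \<le> d \<longrightarrow>
        \<bar>wder w x - wder w y\<bar> \<le> \<tau> * \<bar>wder w y\<bar>"
    using small_distortion[OF \<tau>(1)] by blast
  \<comment> \<open>At most \<tau> so that the old slack fits into the new one, at most
    \<open>d\<close> so that distortion on \<open>Y\<close> is small.\<close>
  define \<eta>1 where "\<eta>1 = min \<tau> d"
  have \<eta>1: "0 < \<eta>1" "\<eta>1 \<le> \<tau>" "\<eta>1 \<le> d" using \<tau> d(1) by (auto simp: \<eta>1_def)
  obtain \<delta> Y where "progression k \<eta>1 \<delta> Y" using IH[OF \<eta>1(1)] by blast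
  hence Y: "finite Y" "card Y = k" "Y \<subseteq> F" "0 < \<delta>" "separated \<delta> Y"
     "\<And>a b. a \<in> Y \<Longrightarrow> b \<in> Y \<Longrightarrow> \<bar>a - b\<bar> \<le> C1 * (1 + \<eta>1) * k * \<delta>"
     "\<And>a b. a \<in> Y \<Longrightarrow> b \<in> Y \<Longrightarrow> \<bar>a - b\<bar> \<le> \<eta>1"
    by (auto simp: progression_def)
  have YI: "y \<in> {lo..hi}" if "y \<in> Y" for y using that Y(3) F_interval by blast
  obtain y0 where y0: "y0 \<in> Y" using Y(1,2) k by fastforce
  \<comment> \<open>The bound \<open>\<delta> / D\<close> keeps the variation of the displacement
    over \<open>cyl u\<close> below the spacing scale \<open>b\<close>; the last bound keeps the new
    progression shorter than \<eta>.\<close>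
  define \<epsilon> where "\<epsilon> = min 1 (min (\<delta> / D) (\<eta> / (4 * C1 * Suc k)))"
  have \<epsilon>: "0 < \<epsilon>" "\<epsilon> \<le> 1" "\<epsilon> * D \<le> \<delta>" "4 * C1 * Suc k * \<epsilon> \<le> \<eta>"
  proof -
    have pos: "4 * C1 * Suc k > 0" using C1_ge_1 by simp
    show "0 < \<epsilon>" using Y(4) D \<eta> pos by (simp add: \<epsilon>_def)
    show "\<epsilon> \<le> 1" by (simp add: \<epsilon>_def)
    have "\<epsilon> \<le> \<delta> / D" by (simp add: \<epsilon>_def)
    thus "\<epsilon> * D \<le> \<delta>" using D by (simp add: pos_le_divide_eq)
    have "\<epsilon> \<le> \<eta> / (4 * C1 * Suc k)" by (simp add: \<epsilon>_def)
    thus "4 * C1 * Suc k * \<epsilon> \<le> \<eta>" using pos by (simp only: pos_le_divide_eq mult.commute)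
  qed
  obtain v w where v: "v \<in> Words" and w: "w \<in> Words" and vw: "v \<noteq> w" and cl: "close \<epsilon> v w"
    using close_pair_exists[OF less \<epsilon>(1,2)] by blast
  define h where "h x = wmap w x - wmap v x" for x
  let ?av = "wnorm v"
  have av: "0 < ?av" "?av \<le> 1" using wnorm_pos[OF v] wnorm_le_1[OF v] by auto
  have h_le: "\<bar>h x\<bar> \<le> \<epsilon> * ?av" if "x \<in> {lo..hi}" for x
    using cl that by (auto simp: close_def h_def abs_minus_commute)
  have h_lip: "\<bar>h x - h y\<bar> \<le> \<epsilon> * ?av * \<bar>x - y\<bar>" if "x \<in> {lo..hi}" "y \<in> {lo..hi}" for x y
    unfolding h_def by (rule word_map_diff_lipschitz[OF v w that]) (use cl in \<open>auto simp: close_def abs_minus_commute\<close>)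
  obtain x where x: "x \<in> F" "h x \<noteq> 0"
  proof -
    have "\<not> (\<forall>x\<in>F. wmap v x = wmap w x)"
      using no_overlap v w vw unfolding has_exact_overlap_def by blast
    thus ?thesis using that by (auto simp: h_def)
  qed
  have xI: "x \<in> {lo..hi}" using x(1) F_interval by blast
  \<comment> \<open>The target norm for \<open>u\<close>: at norm exactly \<theta> the scale
    \<open>b\<close> would be half of the displacement at \<open>x\<close>.\<close>
  define \<theta> where "\<theta> = \<bar>h x\<bar> / (2 * ?av * \<delta>)"
  have \<theta>: "0 < \<theta>" "\<theta> \<le> 1" "\<bar>h x\<bar> = 2 * ?av * \<delta> * \<theta>"
  proof -
    show "0 < \<theta>" using x(2) av Y(4) by (simp add: \<theta>_def)
    have "\<epsilon> * 1 \<le> \<epsilon> * D" using D \<epsilon>(1) by (intro mult_left_mono) auto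
    hence "\<epsilon> \<le> 2 * \<delta>" using \<epsilon>(3) Y(4) by linarith
    hence "\<epsilon> * ?av \<le> 2 * \<delta> * ?av" using av by (intro mult_right_mono) auto
    hence "\<bar>h x\<bar> \<le> 2 * ?av * \<delta>" using h_le[OF xI] by (simp add: mult_ac)
    thus "\<theta> \<le> 1" using av Y(4) by (simp add: \<theta>_def)
    show "\<bar>h x\<bar> = 2 * ?av * \<delta> * \<theta>" using av Y(4) by (simp add: \<theta>_def)
  qed
  obtain u z where u: "u \<in> Words" "z \<in> F" "x = wmap u z" "\<kappa> * \<theta> \<le> wnorm u" "wnorm u \<le> \<theta>"
    using stopping[OF x(1) \<theta>(1,2)] by blast
  let ?au = "wnorm u"
  have au: "0 < ?au" by (rule wnorm_pos[OF u(1)])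
  define b where "b = \<delta> * (?av * ?au)"
  have b: "0 < b" using Y(4) av au by (simp add: b_def)
  have hx: "2 * b \<le> \<bar>h x\<bar>" "\<bar>h x\<bar> \<le> 2 / \<kappa> * b"
  proof -
    have "?av * \<delta> * ?au \<le> ?av * \<delta> * \<theta>" using u(5) av Y(4) by (intro mult_left_mono) auto
    thus "2 * b \<le> \<bar>h x\<bar>" unfolding \<theta>(3) b_def by (simp add: mult_ac)
    have "?av * \<delta> * (\<kappa> * \<theta>) \<le> ?av * \<delta> * ?au" using u(4) av Y(4) by (intro mult_left_mono) auto
    thus "\<bar>h x\<bar> \<le> 2 / \<kappa> * b" unfolding \<theta>(3) b_def using kappa(1) by (simp add: field_simps)
  qed
  let ?U = "wmap u"
  \<comment> \<open>A variation of at most \<open>b\<close> against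
    \<open>2 * b <= \<bar>h x\<bar>\<close>: on the shrunken set the displacement keeps its sign and
    has size at least \<open>b\<close>.\<close>
  have hU: "\<bar>h (?U y) - h x\<bar> \<le> b" if y: "y \<in> Y" for y
  proof -
    have yF: "y \<in> F" using y Y(3) by blast
    have UI: "?U y \<in> {lo..hi}" by (rule word_map_interval'[OF u(1) YI[OF y]])
    have "\<bar>h (?U y) - h x\<bar> \<le> \<epsilon> * ?av * \<bar>?U y - x\<bar>" by (rule h_lip[OF UI xI])
    also have "\<bar>?U y - x\<bar> \<le> ?au * D"
      unfolding u(3) by (rule cyl_dist[OF u(1) cylI[OF yF] cylI[OF u(2)]])
    also have "\<epsilon> * ?av * (?au * D) = \<epsilon> * D * (?av * ?au)" by simp
    also have "\<dots> \<le> b" unfolding b_def using \<epsilon>(3) av au by (intro mult_right_mono) auto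
    finally show ?thesis using \<epsilon>(1) av by (simp add: mult_left_mono)
  qed
  define g where "g = wmap (v @ u)"
  have vu: "v @ u \<in> Words" using v u(1) by simp
  \<comment> \<open>One reference derivative: on \<open>Y\<close> the map \<open>g\<close> is a
    similarity of ratio \<open>m\<close> up to factors between \<open>1 - \<tau>\<close> and
    \<open>1 + \<tau>\<close>.\<close>
  define m where "m = \<bar>wder (v @ u) y0\<bar>"
  have m: "0 < m" "m \<le> ?av * ?au" "?av * ?au \<le> C * C * m"
  proof -
    have y0O: "y0 \<in> \<Omega>" using YI[OF y0] interval_Omega by blast
    show "0 < m" using word_deriv_nonzero[OF vu y0O] by (simp add: m_def)
    show "m \<le> ?av * ?au" unfolding m_def
      using word_deriv_le_wnorm[OF vu y0O] wnorm_append_le[OF v u(1)] by linarith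
    have "?av * ?au \<le> C * wnorm (v @ u)" by (rule wnorm_append_ge[OF v u(1)])
    also have "\<dots> \<le> C * (C * m)" unfolding m_def using C_ge_1 by (intro mult_left_mono wnorm_le[OF vu YI[OF y0]]) auto
    finally show "?av * ?au \<le> C * C * m" by (simp add: mult.assoc)
  qed
  have g_est: "(1 - \<tau>) * m * \<bar>a - c\<bar> \<le> \<bar>g a - g c\<bar>" "\<bar>g a - g c\<bar> \<le> (1 + \<tau>) * m * \<bar>a - c\<bar>"
    if ac: "a \<in> Y" "c \<in> Y" for a c
  proof -
    obtain \<xi> where \<xi>: "min a c \<le> \<xi>" "\<xi> \<le> max a c" "g a - g c = (a - c) * wder (v @ u) \<xi>"
      unfolding g_def using word_map_mvt[OF vu YI[OF ac(1)] YI[OF ac(2)]] by blast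
    have \<xi>I: "\<xi> \<in> {lo..hi}" using \<xi>(1,2) YI[OF ac(1)] YI[OF ac(2)] by (auto simp: min_def max_def split: if_splits)
    have "\<bar>\<xi> - y0\<bar> \<le> d"
      using \<xi>(1,2) Y(7)[OF ac(1) y0] Y(7)[OF ac(2) y0] \<eta>1(3) by (auto simp: min_def max_def abs_le_iff split: if_splits)
    hence "\<bar>wder (v @ u) \<xi> - wder (v @ u) y0\<bar> \<le> \<tau> * m"
      unfolding m_def using d(2) vu \<xi>I YI[OF y0] by blast
    hence "(1 - \<tau>) * m \<le> \<bar>wder (v @ u) \<xi>\<bar>" "\<bar>wder (v @ u) \<xi>\<bar> \<le> (1 + \<tau>) * m"
      unfolding m_def by (simp_all add: algebra_simps)
    thus "(1 - \<tau>) * m * \<bar>a - c\<bar> \<le> \<bar>g a - g c\<bar>" "\<bar>g a - g c\<bar> \<le> (1 + \<tau>) * m * \<bar>a - c\<bar>"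
      unfolding \<xi>(3) abs_mult by (simp_all add: mult.commute mult_left_mono)
  qed
  define \<delta>' where "\<delta>' = (1 - \<tau>) * m * \<delta>"
  have \<delta>': "0 < \<delta>'" "\<delta>' \<le> b"
  proof -
    show "0 < \<delta>'" using \<tau> m Y(4) by (simp add: \<delta>'_def)
    have "(1 - \<tau>) * m \<le> 1 * (?av * ?au)" using \<tau> m by (intro mult_mono) auto
    thus "\<delta>' \<le> b" unfolding \<delta>'_def b_def using Y(4) by (simp add: mult.commute)
  qed
  have scale: "m * \<delta> \<le> (1 + \<eta>) * \<delta>'"
  proof -
    have "1 * (m * \<delta>) \<le> ((1 + \<eta>) * (1 - \<tau>)) * (m * \<delta>)" using \<tau>_est(2) m Y(4) by (intro mult_right_mono) auto
    thus ?thesis by (simp add: \<delta>'_def mult_ac)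
  qed
  have gap_le: "(2 / \<kappa> + 1) * b \<le> C1 * (1 + \<eta>) * \<delta>'"
  proof -
    have "b \<le> C * C * (m * \<delta>)" unfolding b_def using m(3) Y(4) by (simp add: mult_ac)
    also have "\<dots> \<le> C * C * ((1 + \<eta>) * \<delta>')" using scale C_ge_1 by (intro mult_left_mono) auto
    finally have "(2 / \<kappa> + 1) * b \<le> (2 / \<kappa> + 1) * (C * C * ((1 + \<eta>) * \<delta>'))"
      using kappa by (intro mult_left_mono) auto
    thus ?thesis by (simp add: C1_def mult_ac)
  qed
  have g_diam: "\<bar>g a - g c\<bar> \<le> C1 * (1 + \<eta>) * k * \<delta>'" if ac: "a \<in> Y" "c \<in> Y" for a c
  proof -
    have "\<bar>g a - g c\<bar> \<le> (1 + \<tau>) * m * \<bar>a - c\<bar>" by (rule g_est(2)[OF ac])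
    also have "\<dots> \<le> (1 + \<tau>) * m * (C1 * (1 + \<eta>1) * k * \<delta>)"
      by (rule mult_left_mono[OF Y(6)[OF ac]]) (use \<tau> m in simp)
    also have "\<dots> = ((1 + \<tau>) * (1 + \<eta>1)) * (C1 * k * (m * \<delta>))" by simp
    also have "\<dots> \<le> ((1 + \<eta>) * (1 - \<tau>)) * (C1 * k * (m * \<delta>))"
    proof (rule mult_right_mono)
      have "(1 + \<tau>) * (1 + \<eta>1) \<le> (1 + \<tau>) * (1 + \<tau>)" using \<eta>1 \<tau> by (intro mult_left_mono) auto
      thus "(1 + \<tau>) * (1 + \<eta>1) \<le> (1 + \<eta>) * (1 - \<tau>)" using \<tau>_est(1) by linarith
      show "0 \<le> C1 * k * (m * \<delta>)" using C1_ge_1 m Y(4) by simp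
    qed
    finally show ?thesis by (simp add: \<delta>'_def mult_ac)
  qed
  have g_sep: "\<delta>' \<le> \<bar>g a - g c\<bar>" if ac: "a \<in> Y" "c \<in> Y" "a \<noteq> c" for a c
  proof -
    have "\<delta> \<le> \<bar>a - c\<bar>" using Y(5) ac by (simp add: separated_def)
    hence "(1 - \<tau>) * m * \<delta> \<le> (1 - \<tau>) * m * \<bar>a - c\<bar>" using \<tau> m by (intro mult_left_mono) auto
    thus ?thesis using g_est(1)[OF ac(1,2)] by (simp add: \<delta>'_def)
  qed
  have gF: "g y \<in> F" if "y \<in> Y" for y unfolding g_def using that Y(3) by (intro word_map_in_F[OF vu]) auto
  have ginj: "inj_on g Y"
    by (rule inj_onI, rule ccontr) (use g_sep \<delta>'(1) in fastforce)
  define Z where "Z = g ` Y"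
  have Z: "finite Z" "Z \<noteq> {}" "card Z = k" using Y(1,2) y0 card_image[OF ginj] by (auto simp: Z_def)
  \<comment> \<open>The displaced point is the extreme one in the direction of the displacement, so
    all points of \<open>Z\<close> stay behind it.\<close>
  obtain y where y: "y \<in> Y" "0 < h x \<Longrightarrow> g y = Max Z" "h x < 0 \<Longrightarrow> g y = Min Z"
  proof (cases "0 < h x")
    case True
    have "Max Z \<in> g ` Y" using Max_in[OF Z(1,2)] by (simp add: Z_def)
    then obtain y where "y \<in> Y" "Max Z = g y" by blast
    thus ?thesis using True that[of y] by simp
  next
    case False
    have "Min Z \<in> g ` Y" using Min_in[OF Z(1,2)] by (simp add: Z_def)
    then obtain y where "y \<in> Y" "Min Z = g y" by blast
    thus ?thesis using False that[of y] by simp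
  qed
  define e where "e = wmap w (?U y)"
  have e_eq: "e = g y + h (?U y)" by (simp add: e_def g_def h_def)
  have eF: "e \<in> F" unfolding e_def using y(1) Y(3) by (intro word_map_in_F w u(1)) auto
  have gap_upper: "\<bar>h (?U y)\<bar> \<le> (2 / \<kappa> + 1) * b"
  proof -
    have "\<bar>h (?U y)\<bar> \<le> 2 / \<kappa> * b + b" using hU[OF y(1)] hx(2) by linarith
    thus ?thesis by (simp add: algebra_simps)
  qed
  have e_sep: "\<delta>' \<le> \<bar>e - c\<bar>" if c: "c \<in> Z" for c
  proof (cases "0 < h x")
    case True
    hence "b \<le> h (?U y)" using hU[OF y(1)] hx(1) by linarith
    moreover have "c \<le> g y" using y(2)[OF True] Z(1) c by simp
    ultimately show ?thesis unfolding e_eq using \<delta>' by linarith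
  next
    case False
    hence neg: "h x < 0" using x(2) by simp
    hence "h (?U y) \<le> - b" using hU[OF y(1)] hx(1) by linarith
    moreover have "g y \<le> c" using y(3)[OF neg] Z(1) c by simp
    ultimately show ?thesis unfolding e_eq using \<delta>' by linarith
  qed
  hence eZ: "e \<notin> Z" using \<delta>'(1) by force
  have C1\<delta>: "0 \<le> C1 * (1 + \<eta>) * \<delta>'" using C1_ge_1 \<eta> \<delta>'(1) by simp
  have Suc_eq: "C1 * (1 + \<eta>) * Suc k * \<delta>' = C1 * (1 + \<eta>) * k * \<delta>' + C1 * (1 + \<eta>) * \<delta>'"
    by (simp add: algebra_simps)
  have Z_diam: "\<bar>a - c\<bar> \<le> C1 * (1 + \<eta>) * k * \<delta>'" if "a \<in> Z" "c \<in> Z" for a c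
    using that g_diam by (auto simp: Z_def)
  have e_diam: "\<bar>e - c\<bar> \<le> C1 * (1 + \<eta>) * Suc k * \<delta>'" if "c \<in> Z" for c
  proof -
    have "\<bar>g y - c\<bar> \<le> C1 * (1 + \<eta>) * k * \<delta>'" using Z_diam[of "g y" c] that y(1) by (simp add: Z_def)
    thus ?thesis unfolding Suc_eq e_eq using gap_upper gap_le by linarith
  qed
  have diam: "\<bar>a - c\<bar> \<le> C1 * (1 + \<eta>) * Suc k * \<delta>'" if "a \<in> insert e Z" "c \<in> insert e Z" for a c
  proof -
    have "0 \<le> C1 * (1 + \<eta>) * Suc k * \<delta>'" using C1_ge_1 \<eta> \<delta>'(1) by simp
    thus ?thesis using that Z_diam[of a c] e_diam[of a] e_diam[of c] C1\<delta> Suc_eq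
      by (auto simp: abs_minus_commute)
  qed
  have small: "C1 * (1 + \<eta>) * Suc k * \<delta>' \<le> \<eta>"
  proof -
    have "\<delta>' \<le> \<bar>h x\<bar>" using \<delta>'(2) hx(1) b by linarith
    also have "\<dots> \<le> \<epsilon> * ?av" by (rule h_le[OF xI])
    also have "\<dots> \<le> \<epsilon> * 1" using av \<epsilon>(1) by (intro mult_left_mono) auto
    finally have "\<delta>' \<le> \<epsilon>" by simp
    have "C1 * (1 + \<eta>) * Suc k * \<delta>' \<le> C1 * 2 * Suc k * \<epsilon>"
      using \<open>\<delta>' \<le> \<epsilon>\<close> \<eta> C1_ge_1 \<delta>'(1) by (intro mult_mono) auto
    also have "\<dots> \<le> 4 * C1 * Suc k * \<epsilon>" using C1_ge_1 \<epsilon>(1) by simp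
    finally show ?thesis using \<epsilon>(4) by linarith
  qed
  have "progression (Suc k) \<eta> \<delta>' (insert e Z)"
    unfolding progression_def
  proof (intro conjI ballI)
    show "finite (insert e Z)" "card (insert e Z) = Suc k" using Z eZ by auto
    show "insert e Z \<subseteq> F" using eF gF by (auto simp: Z_def)
    show "0 < \<delta>'" by (rule \<delta>')
    have Zsep: "\<delta>' \<le> \<bar>a - c\<bar>" if "a \<in> Z" "c \<in> Z" "a \<noteq> c" for a c
      using that g_sep by (auto simp: Z_def)
    show "separated \<delta>' (insert e Z)"
      unfolding separated_def using e_sep Zsep by (auto simp: abs_minus_commute)
    fix a c assume "a \<in> insert e Z" "c \<in> insert e Z"
    from diam[OF this] small show "\<bar>a - c\<bar> \<le> C1 * (1 + \<eta>) * Suc k * \<delta>'" "\<bar>a - c\<bar> \<le> \<eta>" by auto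
  qed
  thus ?thesis by blast
qed

text \<open>The induction hypothesis has to cover every positive \<eta>, since
  \<open>progression_step\<close> calls for smaller ones; values above 1 reduce to 1.\<close>

lemma progression_exists:
  assumes less: "s < pzero" and no_overlap: "\<not> has_exact_overlap N \<phi> F" and "\<eta> > 0"
  shows "\<exists>\<delta> Y. progression (Suc k) \<eta> \<delta> Y"
  using \<open>\<eta> > 0\<close>
proof (induction k arbitrary: \<eta>)
  case 0
  obtain x where "x \<in> F" using ifs(2) by blast
  hence "progression (Suc 0) \<eta> 1 {x}" using 0 C1_ge_1 by (simp add: progression_def separated_def)
  thus ?case by blast
next
  case (Suc k)
  let ?\<eta> = "min \<eta> 1"
  have e: "0 < ?\<eta>" "?\<eta> \<le> 1" using Suc.prems by auto
  obtain \<delta> Y where Y: "progression (Suc (Suc k)) ?\<eta> \<delta> Y"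
    using progression_step[OF less no_overlap _ Suc.IH e] by auto
  have "C1 * (1 + ?\<eta>) * Suc (Suc k) * \<delta> \<le> C1 * (1 + \<eta>) * Suc (Suc k) * \<delta>"
    using C1_ge_1 Y by (intro mult_right_mono mult_left_mono) (auto simp: progression_def)
  hence "progression (Suc (Suc k)) \<eta> \<delta> Y" using Y unfolding progression_def by fastforce
  thus ?case by blast
qed

text \<open>The \<open>k\<close> points lie in an interval of length comparable with
  \<open>k * \<delta>\<close>; upper regularity applies at separation \<delta>, and the powers of
  \<delta> cancel.\<close>

lemma progression_bound:
  assumes Y: "progression k 1 \<delta> Y" and k: "k \<ge> 2"
  shows "k * cs powr s \<le> KR * (4 * C1 * k) powr s"
proof -
  have Y': "finite Y" "card Y = k" "Y \<subseteq> F" "0 < \<delta>" "separated \<delta> Y"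
     "\<And>a b. a \<in> Y \<Longrightarrow> b \<in> Y \<Longrightarrow> \<bar>a - b\<bar> \<le> C1 * 2 * k * \<delta>" "\<And>a b. a \<in> Y \<Longrightarrow> b \<in> Y \<Longrightarrow> \<bar>a - b\<bar> \<le> 1"
    using Y by (auto simp: progression_def)
  have ne: "Y \<noteq> {}" using Y'(1,2) k by auto
  define a where "a = Min Y"
  have a: "a \<in> Y" "\<And>y. y \<in> Y \<Longrightarrow> a \<le> y" using Y'(1) ne by (auto simp: a_def)
  define M where "M = C1 * 2 * k * \<delta>"
  have YM: "Y \<subseteq> {a..a + M}"
  proof
    fix y assume y: "y \<in> Y"
    have "\<bar>y - a\<bar> \<le> M" unfolding M_def by (rule Y'(6)[OF y a(1)])
    thus "y \<in> {a..a + M}" using a(2)[OF y] by (simp add: abs_le_iff)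
  qed
  have \<delta>1: "\<delta> \<le> 1"
  proof -
    have "\<not> Y \<subseteq> {a}" using Y'(2) k card_mono[of "{a}" Y] by auto
    then obtain y where y: "y \<in> Y" "y \<noteq> a" by blast
    have "\<delta> \<le> \<bar>y - a\<bar>" using Y'(5) y a(1) by (simp add: separated_def)
    thus ?thesis using Y'(7)[OF y(1) a(1)] by linarith
  qed
  have M: "M > 0" "(a + M + \<delta>) - (a - \<delta>) \<le> 4 * C1 * k * \<delta>"
  proof -
    show "M > 0" using C1_ge_1 k Y'(4) by (simp add: M_def)
    have "1 * 1 \<le> C1 * k" using C1_ge_1 k by (intro mult_mono) auto
    hence "1 * \<delta> \<le> (C1 * k) * \<delta>" using Y'(4) by (intro mult_right_mono) auto
    thus "(a + M + \<delta>) - (a - \<delta>) \<le> 4 * C1 * k * \<delta>" by (simp add: M_def algebra_simps)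
  qed
  have KR0: "KR \<ge> 0" using hcontent_F_pos by (simp add: KR_def)
  have "k * (cs * \<delta>) powr s \<le> pk [] {a - \<delta>..(a + M) + \<delta>}"
    using separated_card[OF Y'(1,3) YM Y'(4) \<delta>1 Y'(5)] Y'(2) by simp
  also have "\<dots> \<le> KR * ((a + M + \<delta>) - (a - \<delta>)) powr s"
    by (rule pk_interval) (use M Y'(4) in simp)
  also have "\<dots> \<le> KR * (4 * C1 * k * \<delta>) powr s"
    using M Y'(4) s_pos KR0 by (intro mult_left_mono powr_mono2) auto
  finally have "k * (cs powr s * \<delta> powr s) \<le> KR * ((4 * C1 * k) powr s * \<delta> powr s)"
    by (simp only: powr_mult)
  hence "(k * cs powr s) * \<delta> powr s \<le> (KR * (4 * C1 * k) powr s) * \<delta> powr s" by (simp add: mult_ac)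
  moreover have "\<delta> powr s > 0" using Y'(4) by simp
  ultimately show ?thesis by (simp only: mult_le_cancel_right_pos)
qed

text \<open>Progressions of every length would make \<open>k powr (1 - s)\<close> bounded in
  \<open>k\<close>, which fails for \<open>s < 1\<close>.\<close>

lemma no_overlap_imp_ge:
  assumes no_overlap: "\<not> has_exact_overlap N \<phi> F"
  shows "pzero \<le> s"
proof (rule ccontr)
  assume "\<not> ?thesis"
  hence less: "s < pzero" by simp
  define R where "R = KR * (4 * C1) powr s / cs powr s"
  have csp: "cs powr s > 0" using cs_pos by simp
  obtain j :: nat where j: "(\<bar>R\<bar> + 1) powr (1 / (1 - s)) < j" using reals_Archimedean2 by blast
  define k where "k = Suc (Suc j)"
  obtain \<delta> Y where "progression k 1 \<delta> Y" using progression_exists[OF less no_overlap, of 1 "Suc j"] by (auto simp: k_def)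
  hence "k * cs powr s \<le> KR * (4 * C1 * k) powr s" by (rule progression_bound) (simp add: k_def)
  hence "k * cs powr s \<le> KR * (4 * C1) powr s * k powr s" by (simp only: powr_mult mult.assoc)
  hence "k \<le> R * k powr s" using csp by (simp add: R_def field_simps)
  moreover have "real k = k powr (1 - s) * k powr s" by (simp add: powr_add[symmetric] k_def)
  moreover have "k powr s > 0" by (simp add: k_def)
  ultimately have "k powr (1 - s) \<le> R" by (metis mult_le_cancel_right_pos)
  moreover have "\<bar>R\<bar> + 1 \<le> k powr (1 - s)"
  proof -
    have "((\<bar>R\<bar> + 1) powr (1 / (1 - s))) powr (1 - s) \<le> k powr (1 - s)"
      using j s_less_1 by (intro powr_mono2) (auto simp: k_def)
    thus ?thesis using s_less_1 by (simp add: powr_powr)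
  qed
  ultimately show False by linarith
qed

end

theorem theorem4p3:
  fixes N :: nat and \<Omega> F :: "real set" and \<phi> :: "nat \<Rightarrow> real \<Rightarrow> real" and s :: real
  assumes "self_conformal_set N \<Omega> \<phi> F"
    and "hausdorff_dim F = ereal s"
    and "s < 1"
    and "hausdorff_measure s F > 0"
  shows "s = pressure_zero N \<Omega> \<phi> \<longleftrightarrow> \<not> has_exact_overlap N \<phi> F"
proof -
  interpret self_conformal N \<Omega> F \<phi> by (rule self_conformal.intro[OF assms(1)])
  obtain lo hi C \<rho> where cw: "conformal_words N \<Omega> F \<phi> lo hi C \<rho>" by (rule conformal_words_exists)
  interpret conformal_words N \<Omega> F \<phi> lo hi C \<rho> by (rule cw)
  have le: "s \<le> pressure_zero N \<Omega> \<phi>" using dim_le_pressure_zero assms(2) by simp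
  show ?thesis
  proof
    assume "s = pressure_zero N \<Omega> \<phi>"
    thus "\<not> has_exact_overlap N \<phi> F" using overlap_imp_dim_neq[OF _ assms(4)] by blast
  next
    assume no: "\<not> has_exact_overlap N \<phi> F"
    \<comment> \<open>On a one-point \<open>F\<close> the words \<open>[1]\<close> and
      \<open>[2]\<close> already overlap exactly.\<close>
    have nontriv: "\<exists>x\<in>F. \<exists>y\<in>F. x \<noteq> y"
    proof (rule ccontr)
      assume "\<not> ?thesis"
      hence "word_map \<phi> [1] x = word_map \<phi> [2] x" if "x \<in> F" for x
        using map_in_F[of 1 x] map_in_F[of 2 x] that N_ge_2 by auto
      hence "has_exact_overlap N \<phi> F"
        unfolding has_exact_overlap_def using N_ge_2
        by (intro bexI[of _ "[1]"] bexI[of _ "[2]"]) auto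
      thus False using no by blast
    qed
    interpret positive_measure N \<Omega> F \<phi> lo hi C \<rho> s
      by unfold_locales (use assms nontriv in auto)
    show "s = pressure_zero N \<Omega> \<phi>" using no_overlap_imp_ge[OF no] le by simp
  qed
qed

end
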